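(* Consider the generalized randomized subspace descent (GRSD) method $x^{k+1}=x^k-\alpha_kB_k\nabla f(x^k)$, $k\ge0$, where $f\in C^1(\mathbb R^d)$ is coercive, definable, and has a locally Lipschitz continuous gradient. Suppose that the stepsizes satisfy $0<\alpha_k\le\bar\alpha<2$ for all $k$ and $\sum_{k=0}^\infty\alpha_k=+\infty$, that $f$ is upper $1$-smooth along every $B\in\mathscr B$, and that there are constants $M,\nu>0$ with $0\preceq B_k\preceq MI$ and $\mathbb E[B_k^2\mid\mathcal F_k]\succeq\nu I$ almost surely, for all $k\ge0$. For each critical point $\bar x$ of $f$ let $\varphi_{\bar x}:[0,\eta_{\bar x})\to\mathbb R_+$ be a local KL desingularization function of $f$ at $\bar x$, fix $t_{0,\bar x}\in(0,\eta_{\bar x})$, and define $\phi_{\bar x}(0):=0$ and, for $t\in(0,\eta_{\bar x})$, $$\phi_{\bar x}(t):=\frac1{(\varphi_{\bar x}'(t))^2},\qquad\psi_{\bar x}(t):=\int_t^{t_{0,\bar x}}(\varphi_{\bar x}'(s))^2\,ds .$$ Then $1/\sqrt{\phi_{\bar x}}$ is integrable near zero for every critical point $\bar x$. Moreover, if $\bar x$ is not a local maximizer, then $1/\phi_{\bar x}$ is not integrable near zero. Consequently, with $c_1=(1-\frac{\bar\alpha}2)/M$, $c_2=\nu$, $c_3=M^2$ and $A_k:=\sum_{i=0}^{k-1}\alpha_i$, there exists a random variable $x^*$ such that, almost surely, $x^*$ is a critical point of $f$ with $f(x^* )\le f(x^0)$ and $x^k\to x^*$. Moreover $\mathbb P(E_0)=1$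 for the event $$E_0=\Big\{\omega:\ \|\nabla f(x^k)\|^2\to0,\ \liminf_{k\to\infty}\frac{\sum_{i=1}^k\alpha_iz_i}{\sum_{i=1}^k\alpha_i}\ge c_2\Big\},$$ and the following hold on $E_0$: (i) if $1/\phi_{x^*(\omega)}$ is integrable near $0$, then $\{x^k(\omega)\}$ terminates in finitely many iterations (is eventually constant); (ii) if $1/\phi_{x^*(\omega)}$ is not integrable near $0$, then there is a positive integer $K_4(\omega)$ such that for all $k\ge K_4(\omega)$, with $f^\infty(\omega):=\lim_{j\to\infty}f(x^j(\omega))$, $$f(x^k(\omega))-f^\infty(\omega)\le\psi_{x^*(\omega)}^{-1}\Big(\frac{c_1c_2}2A_k\Big),\qquad\|x^k(\omega)-x^*(\omega)\|\le\frac{\sqrt2}{c_1\sqrt{c_2}}\,\varphi_{x^*(\omega)}\Big(\psi_{x^*(\omega)}^{-1}\Big(\frac{c_1c_2}2A_k\Big)\Big).$$ In particular, the iterates converge almost surely to a critical point $x^*$. On every such convergent path, either $x^*$ is a local maximizer and the sequence terminates at $x^*$ after finitely many iterations, or $x^*$ is not a local maximizer and the rate estimates in (ii) hold.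
   Context: Setting. $(\Omega,\mathcal F,\{\mathcal F_k\}_{k\ge0},\mathbb P)$ is a filtered probability space, $x^0\in\mathbb R^d$ is deterministic, $\{\alpha_k\}$ is deterministic, and $\{B_k\}_{k\ge0}$ are random symmetric positive semidefinite $d\times d$ matrices with $B_k$ $\mathcal F_{k+1}$-measurable; $\mathscr B$ is the collection of possible realizations of the $B_k$. $f$ is upper $1$-smooth along $B$ if $f(x+Bu)\le f(x)+\langle\nabla f(x),Bu\rangle+\frac12\langle u,Bu\rangle$ for all $x,u\in\mathbb R^d$. Random variables $z_k$: $z_k:=\frac{\|x^{k+1}-x^k\|^2}{\alpha_k^2\|\nabla f(x^k)\|^2}$ if $\nabla f(x^k)\ne0$, and $z_k:=c_2$ otherwise. "Definable" means definable in a fixed o-minimal structure over the real field. Local KL desingularization function of $f$ at $\bar x$: for some $\delta_{\bar x},\eta_{\bar x}\in(0,+\infty]$, a continuous concave function $\varphi_{\bar x}:[0,\eta_{\bar x})\to\mathbb R_+$ with $\varphi_{\bar x}(0)=0$, continuously differentiable on $(0,\eta_{\bar x})$ with $\varphi_{\bar x}'>0$ there, such that $\varphi_{\bar x}'(f(x)-f(\bar x))\,\|\nabla f(x)\|\ge1$ whenever $\|x-\bar x\|<\delta_{\bar x}$ and $0<f(x)-f(\bar x)<\eta_{\bar x}$. (It is a known theorem that one exists at every point for every definable $C^1$ function.) A nonnegative function is integrable near $0$ if it is integrable on $(0,\tau']$ for some $\tau'>0$. $\psi_{\bar x}$ is strictly decreasing; when $1/\phi_{\bar x}$ is not integrable near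 $0$, $\psi_{\bar x}(t)\to+\infty$ as $t\downarrow0$ and $\psi_{\bar x}^{-1}$ is defined on $(\lim_{t\uparrow\eta_{\bar x}}\psi_{\bar x}(t),+\infty)$.
   Formalization: Since B_k ⪯ MI is assumed only almost surely, the conclusions "on E_0" (i), (ii) and the final dichotomy are asserted for those paths in E_0 on which 0 ⪯ B_k ⪯ MI holds for all k, an event of probability one; on exceptional null paths of E_0 the rates can fail. *)

theory Defs
  imports "HOL-Probability.Probability"
begin

text \<open>
  O-minimal structures over the ordered field of real numbers, axiomatised as in van den Dries,
  \<^emph>\<open>Tame topology and o-minimal structures\<close>.  The space of \<open>n\<close>-tuples is represented by the
  lists of length \<open>n\<close>, and \<open>S n\<close> consists of the definable sets of \<open>n\<close>-tuples.  Finite unions of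
  points and of (bounded or unbounded) intervals are the finite unions of sets satisfying
  \<^const>\<open>is_interval\<close>; the equivalence in \<open>one_dim\<close> makes all singletons definable, so that
  definability is with parameters.
\<close>

locale o_minimal_structure =
  fixes S :: "nat \<Rightarrow> real list set set"
  assumes boolean_algebra: "algebra {xs. length xs = n} (S n)"
    and cylinder_left: "A \<in> S n \<Longrightarrow> {t # xs | t xs. xs \<in> A} \<in> S (Suc n)"
    and cylinder_right: "A \<in> S n \<Longrightarrow> {xs @ [t] | xs t. xs \<in> A} \<in> S (Suc n)"
    and diagonal: "n \<ge> 1 \<Longrightarrow> {xs. length xs = n \<and> hd xs = last xs} \<in> S n"
    and projection: "A \<in> S (Suc n) \<Longrightarrow> butlast ` A \<in> S n"
    and less_definable: "{[s, t] | s t. s < t} \<in> S 2"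
    and add_definable: "{[s, t, s + t] | s t. True} \<in> S 3"
    and mult_definable: "{[s, t, s * t] | s t. True} \<in> S 3"
    and one_dim: "A \<in> S 1 \<longleftrightarrow>
      (\<exists>\<I>. finite \<I> \<and> (\<forall>I\<in>\<I>. is_interval I) \<and> A = (\<lambda>t. [t]) ` \<Union>\<I>)"

text \<open>
  A function is definable if its graph is.  The coordinates, indexed by a finite type, are listed
  by means of an enumeration \<open>e\<close>; definable sets are closed under permutation of the coordinates,
  so the choice of \<open>e\<close> does not matter.
\<close>

definition definable :: "(nat \<Rightarrow> real list set set) \<Rightarrow> (real ^ 'd \<Rightarrow> real) \<Rightarrow> bool" where
  "definable S f \<longleftrightarrow>
    (\<exists>e. bij_betw e {..<CARD('d)} (UNIV :: 'd set) \<and>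
      {map (\<lambda>i. x $ e i) [0..<CARD('d)] @ [f x] | x. True} \<in> S (Suc CARD('d)))"

definition gradient :: "('a::real_inner \<Rightarrow> real) \<Rightarrow> 'a \<Rightarrow> 'a" where
  "gradient f x = (THE g. GDERIV f x :> g)"

lemma gradient_eq: "GDERIV f x :> g \<Longrightarrow> gradient f x = g"
  unfolding gradient_def
proof (rule the_equality)
  fix h assume "GDERIV f x :> g" "GDERIV f x :> h"
  then have "(\<lambda>v. v \<bullet> h) = (\<lambda>v. v \<bullet> g)"
    unfolding gderiv_def by (rule has_derivative_unique[rotated])
  then show "h = g"
    by (metis inner_commute vector_eq_rdot)
qed

definition C1 :: "('a::real_inner \<Rightarrow> real) \<Rightarrow> bool" where
  "C1 f \<longleftrightarrow> (\<forall>x. f differentiable (at x)) \<and> continuous_on UNIV (gradient f)"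

definition locally_Lipschitz :: "('a::metric_space \<Rightarrow> 'b::metric_space) \<Rightarrow> bool" where
  "locally_Lipschitz g \<longleftrightarrow> (\<forall>x. \<exists>r>0. \<exists>L. L-lipschitz_on (ball x r) g)"

definition coercive :: "('a::real_normed_vector \<Rightarrow> real) \<Rightarrow> bool" where
  "coercive f \<longleftrightarrow> filterlim f at_top at_infinity"

definition critical_point :: "('a::real_inner \<Rightarrow> real) \<Rightarrow> 'a \<Rightarrow> bool" where
  "critical_point f x \<longleftrightarrow> gradient f x = 0"

definition local_maximizer :: "('a::topological_space \<Rightarrow> real) \<Rightarrow> 'a \<Rightarrow> bool" where
  "local_maximizer f x \<longleftrightarrow> (\<forall>\<^sub>F y in nhds x. f y \<le> f x)"

definition psd :: "real ^ 'd ^ 'd \<Rightarrow> bool" where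
  "psd A \<longleftrightarrow> transpose A = A \<and> (\<forall>v. 0 \<le> v \<bullet> (A *v v))"

definition loewner_le :: "real ^ 'd ^ 'd \<Rightarrow> real ^ 'd ^ 'd \<Rightarrow> bool" (infix \<open>\<preceq>\<close> 50) where
  "A \<preceq> B \<longleftrightarrow> psd (B - A)"

definition upper_one_smooth_along :: "(real ^ 'd \<Rightarrow> real) \<Rightarrow> real ^ 'd ^ 'd \<Rightarrow> bool" where
  "upper_one_smooth_along f B \<longleftrightarrow>
    (\<forall>x u. f (x + B *v u) \<le> f x + gradient f x \<bullet> (B *v u) + 1 / 2 * (u \<bullet> (B *v u)))"

text \<open>The conditional expectation of a random matrix is taken entrywise.\<close>

definition matrix_cond_exp ::
    "'w measure \<Rightarrow> 'w measure \<Rightarrow> ('w \<Rightarrow> real ^ 'n ^ 'm) \<Rightarrow> 'w \<Rightarrow> real ^ 'n ^ 'm" where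
  "matrix_cond_exp P G X \<omega> = (\<chi> i j. real_cond_exp P G (\<lambda>\<omega>'. X \<omega>' $ i $ j) \<omega>)"

definition realizations :: "'w measure \<Rightarrow> (nat \<Rightarrow> 'w \<Rightarrow> 'b) \<Rightarrow> 'b set" where
  "realizations P B = (\<Union>k. B k ` space P)"

text \<open>
  The end point \<open>\<eta>\<close> and the radius \<open>\<delta>\<close> may be infinite, so they are extended reals.  The values of
  \<open>\<phi>\<close> outside \<open>[0, \<eta>)\<close> are irrelevant.
\<close>

definition KL_desingularization ::
    "(real ^ 'd \<Rightarrow> real) \<Rightarrow> real ^ 'd \<Rightarrow> ereal \<Rightarrow> (real \<Rightarrow> real) \<Rightarrow> bool" where
  "KL_desingularization f xb \<eta> \<phi> \<longleftrightarrow>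
    0 < \<eta> \<and>
    (\<forall>t. 0 \<le> t \<and> ereal t < \<eta> \<longrightarrow> 0 \<le> \<phi> t) \<and>
    continuous_on {t. 0 \<le> t \<and> ereal t < \<eta>} \<phi> \<and>
    concave_on {t. 0 \<le> t \<and> ereal t < \<eta>} \<phi> \<and>
    \<phi> 0 = 0 \<and>
    (\<forall>t. 0 < t \<and> ereal t < \<eta> \<longrightarrow> \<phi> differentiable (at t) \<and> 0 < deriv \<phi> t) \<and>
    continuous_on {t. 0 < t \<and> ereal t < \<eta>} (deriv \<phi>) \<and>
    (\<exists>\<delta>::ereal. 0 < \<delta> \<and>
      (\<forall>x. ereal (norm (x - xb)) < \<delta> \<and> 0 < f x - f xb \<and> ereal (f x - f xb) < \<eta> \<longrightarrow>
        1 \<le> deriv \<phi> (f x - f xb) * norm (gradient f x)))"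

definition KL_phi :: "(real \<Rightarrow> real) \<Rightarrow> real \<Rightarrow> real" where
  "KL_phi \<phi> t = (if t = 0 then 0 else 1 / (deriv \<phi> t)\<^sup>2)"

text \<open>The interval integral is oriented: \<open>KL_psi \<phi> t0 t\<close> is negative for \<open>t > t0\<close>.\<close>

definition KL_psi :: "(real \<Rightarrow> real) \<Rightarrow> real \<Rightarrow> real \<Rightarrow> real" where
  "KL_psi \<phi> t0 t = (LBINT s=ereal t..ereal t0. (deriv \<phi> s)\<^sup>2)"

definition KL_psi_inv :: "(real \<Rightarrow> real) \<Rightarrow> ereal \<Rightarrow> real \<Rightarrow> real \<Rightarrow> real" where
  "KL_psi_inv \<phi> \<eta> t0 = the_inv_into {t. 0 < t \<and> ereal t < \<eta>} (KL_psi \<phi> t0)"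

text \<open>Integrability near \<open>0\<close> of a function whose domain is \<open>(0, \<eta>)\<close>.\<close>

definition integrable_near_0 :: "ereal \<Rightarrow> (real \<Rightarrow> real) \<Rightarrow> bool" where
  "integrable_near_0 \<eta> h \<longleftrightarrow> (\<exists>\<tau>>0. ereal \<tau> < \<eta> \<and> set_integrable lborel {0<..\<tau>} h)"

text \<open>
  The rate estimates along a single path \<open>x\<close> with limit \<open>xs\<close>, where \<open>\<phi>\<close>, \<open>\<eta>\<close> and \<open>t0\<close> belong to
  \<open>xs\<close> and \<open>A k\<close> is the sum of the first \<open>k\<close> stepsizes.  The first conjunct says that the inverse
  of \<^term>\<open>KL_psi \<phi> t0\<close> is evaluated inside its domain.
\<close>

definition KL_rate_estimates ::
    "(real ^ 'd \<Rightarrow> real) \<Rightarrow> (real \<Rightarrow> real) \<Rightarrow> ereal \<Rightarrow> real \<Rightarrow> real \<Rightarrow> real \<Rightarrow> (nat \<Rightarrow> real) \<Rightarrow>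
      (nat \<Rightarrow> real ^ 'd) \<Rightarrow> real ^ 'd \<Rightarrow> bool" where
  "KL_rate_estimates f \<phi> \<eta> t0 c1 c2 A x xs \<longleftrightarrow>
    (\<exists>K>0. \<forall>k\<ge>K.
      c1 * c2 / 2 * A k \<in> KL_psi \<phi> t0 ` {t. 0 < t \<and> ereal t < \<eta>} \<and>
      f (x k) - lim (\<lambda>j. f (x j)) \<le> KL_psi_inv \<phi> \<eta> t0 (c1 * c2 / 2 * A k) \<and>
      norm (x k - xs) \<le> sqrt 2 / (c1 * sqrt c2) * \<phi> (KL_psi_inv \<phi> \<eta> t0 (c1 * c2 / 2 * A k)))"

end

theory Submission
  imports Defs "HOL-Real_Asymp.Real_Asymp"
begin

text \<open>
  The descent inequality and the conditional second moment bound give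
  \<open>E (\<Sum>k. \<alpha> k * |\<nabla>f (x k)|\<^sup>2) < \<infinity>\<close>, hence \<open>\<nabla>f (x k) \<longlonglongrightarrow> 0\<close> almost surely, and a
  weighted law of large numbers gives the density condition on \<open>z\<close>.  The rest is deterministic.
  Along a path on which the KL inequality holds, \<open>\<psi> (f (x k) - finf)\<close> grows by at least
  \<open>c1 * \<alpha> k * z k\<close> in each step, so \<open>f (x k) - finf \<le> y (k + 1)\<close> eventually, with
  \<open>y k = \<psi>_inv (c1 * c2 / 2 * A k)\<close>.  Because single values of \<open>z\<close> may be small, the length of a
  step is not controlled by the decrease of \<open>\<phi> (f (x k) - finf)\<close>; instead
  \<open>c1 * |x (k + 1) - x k|\<^sup>2 \<le> \<alpha> k * (f (x k) - f (x (k + 1)))\<close> is split by AM-GM with the weights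
  \<open>\<phi>' (y (k + 1))\<close>: both resulting sums are at most a multiple of \<open>\<phi> (y n)\<close>, the first one by
  summation by parts.  A uniformized KL inequality first yields convergence on all of the
  event; then the estimate is applied with the function of the limit.  At a critical point that is
  not a local maximizer, \<open>\<phi> * \<phi>'\<close> is bounded away from \<open>0\<close>, which rules out integrability of
  \<open>\<phi>'\<^sup>2\<close>.
\<close>

section \<open>Desingularizing functions\<close>

text \<open>Write \<open>v k\<close> for \<open>f (x k) - finf\<close>. The usual KL argument bounds
  a step by the decrease of \<open>\<phi> (v k)\<close> divided by \<open>c1 * sqrt (z k)\<close>,
  which is useless for small \<open>z k\<close>. Weights along the deterministic sequence
  \<open>y\<close> avoid this: they increase with \<open>k\<close>, and \<open>\<alpha> k\<close>
  is, up to a constant, the increment of \<open>\<psi>\<close> along \<open>y\<close>, so one sum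
  telescopes in \<open>\<phi> (y k)\<close> while \<open>v k \<le> y (k + 1)\<close> controls the
  other. Since \<open>c2\<close> bounds \<open>z\<close> only on average and in the limit, half of
  it is given away in the argument of \<open>\<psi>_inv\<close>; balancing the two sums then
  produces \<open>sqrt 2 / (c1 * sqrt c2)\<close>. The KL inequality says nothing at excess 0, so
  each path is split by whether it reaches its limiting level. If it does, the descent inequality
  leaves no room for further steps; if not, \<open>\<psi> (v k)\<close> tends to infinity, which
  integrability of \<open>\<phi>'\<^sup>2\<close> forbids. Before convergence is known, iterates may
  lie near several critical points, each with its own function; hence the detour through one
  function that serves all of them.\<close>

lemma increments_bounded_of_integrable:
  fixes G G' h :: "real \<Rightarrow> real"
  assumes G: "\<And>t. 0 < t \<Longrightarrow> t \<le> \<tau> \<Longrightarrow> (G has_field_derivative G' t) (at t)"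
    and le: "\<And>t. 0 < t \<Longrightarrow> t \<le> \<tau> \<Longrightarrow> G' t \<le> h t"
    and nonneg: "\<And>t. 0 < t \<Longrightarrow> t \<le> \<tau> \<Longrightarrow> 0 \<le> h t"
    and int: "set_integrable lborel {0<..\<tau>} h"
  shows "\<exists>C. \<forall>t. 0 < t \<and> t \<le> \<tau> \<longrightarrow> G \<tau> - G t \<le> C"
proof (intro exI allI impI)
  fix t assume t: "0 < t \<and> t \<le> \<tau>"
  have FTC: "(G' has_integral G \<tau> - G t) {t..\<tau>}"
  proof (rule fundamental_theorem_of_calculus)
    show "t \<le> \<tau>" using t by simp
    fix s assume "s \<in> {t..\<tau>}"
    then have "(G has_field_derivative G' s) (at s)" using t by (intro G) auto
    then show "(G has_vector_derivative G' s) (at s within {t..\<tau>})"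
      by (simp add: has_real_derivative_iff_has_vector_derivative has_vector_derivative_at_within)
  qed
  have sub: "set_integrable lborel {t..\<tau>} h"
    by (rule set_integrable_subset[OF int]) (use t in auto)
  have "(h has_integral integral {t..\<tau>} h) {t..\<tau>}"
    using set_borel_integral_eq_integral(1)[OF sub] by (rule integrable_integral)
  with FTC have "G \<tau> - G t \<le> integral {t..\<tau>} h"
    by (rule has_integral_le) (use t le in auto)
  also have "integral {t..\<tau>} h = (LINT s:{t..\<tau>}|lborel. h s)"
    using set_borel_integral_eq_integral(2)[OF sub] by simp
  also have "\<dots> \<le> (LINT s:{0<..\<tau>}|lborel. h s)"
    unfolding set_lebesgue_integral_def
  proof (rule integral_mono)
    show "integrable lborel (\<lambda>s. indicat_real {t..\<tau>} s *\<^sub>R h s)"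
      "integrable lborel (\<lambda>s. indicat_real {0<..\<tau>} s *\<^sub>R h s)"
      using sub int by (auto simp: set_integrable_def)
    show "indicat_real {t..\<tau>} s *\<^sub>R h s \<le> indicat_real {0<..\<tau>} s *\<^sub>R h s" for s
      using t nonneg[of s] by (auto simp: indicator_def)
  qed
  finally show "G \<tau> - G t \<le> (LINT s:{0<..\<tau>}|lborel. h s)" .
qed

text \<open>A nonnegative derivative makes \<open>G\<close> nondecreasing, so its limit at 0 is the
  infimum \<open>I\<close>, finite by the lower bound; with finite limits at both ends the
  fundamental theorem on the open interval gives integrability. With the preceding lemma,
  integrability near 0 becomes boundedness of an antiderivative.\<close>

lemma set_integrable_deriv_of_bounded:
  fixes G h :: "real \<Rightarrow> real"
  assumes "0 < \<tau>"
    and G: "\<And>t. 0 < t \<Longrightarrow> t \<le> \<tau> \<Longrightarrow> (G has_field_derivative h t) (at t)"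
    and nonneg: "\<And>t. 0 < t \<Longrightarrow> t \<le> \<tau> \<Longrightarrow> 0 \<le> h t"
    and cont: "continuous_on {0<..\<tau>} h"
    and bound: "\<And>t. 0 < t \<Longrightarrow> t \<le> \<tau> \<Longrightarrow> c \<le> G t"
  shows "set_integrable lborel {0<..\<tau>} h"
proof -
  have mono: "G s \<le> G t" if "0 < s" "s \<le> t" "t \<le> \<tau>" for s t
    using that by (intro DERIV_nonneg_imp_nondecreasing[of s t G]) (auto intro!: exI G nonneg)
  define I where "I = Inf (G ` {0<..\<tau>})"
  have bdd: "bdd_below (G ` {0<..\<tau>})"
    using bound by (intro bdd_belowI[of _ c]) auto
  have lim0: "(G \<longlongrightarrow> I) (at_right 0)"
  proof (rule order_tendstoI)
    fix a assume "a < I"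
    have "eventually (\<lambda>t. t \<in> {0<..<\<tau>}) (at_right 0)"
      by (rule eventually_at_right_real) fact
    then show "eventually (\<lambda>t. a < G t) (at_right 0)"
    proof eventually_elim
      case (elim t)
      then have "I \<le> G t" unfolding I_def using bdd by (intro cINF_lower) auto
      with \<open>a < I\<close> show ?case by simp
    qed
  next
    fix a assume "I < a"
    then obtain s where s: "0 < s" "s \<le> \<tau>" "G s < a"
      using \<open>0 < \<tau>\<close> bdd by (auto simp: I_def cINF_less_iff)
    have "eventually (\<lambda>t. t \<in> {0<..<s}) (at_right 0)"
      by (rule eventually_at_right_real) fact
    then show "eventually (\<lambda>t. G t < a) (at_right 0)"
    proof eventually_elim
      case (elim t)
      then have "G t \<le> G s" using s by (intro mono) auto
      with s show ?case by simp
    qed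
  qed
  have "isCont G \<tau>"
    using G[of \<tau>] \<open>0 < \<tau>\<close> by (auto intro: DERIV_isCont)
  then have lim1: "(G \<longlongrightarrow> G \<tau>) (at_left \<tau>)"
    by (auto simp: isCont_def intro: tendsto_mono[OF at_le])
  have "isCont h t" if "0 < t" "t < \<tau>" for t
    using continuous_on_interior[OF cont, of t] that by simp
  then have "set_integrable lborel (einterval (ereal 0) (ereal \<tau>)) h"
    using G nonneg lim0 lim1 \<open>0 < \<tau>\<close>
    by (intro interval_integral_FTC_nonneg(1)[where F = G and A = I and B = "G \<tau>"])
      (auto simp: at_right_ereal at_left_ereal ereal_tendsto_simps o_def filterlim_filtermap)
  \<comment> \<open>The open interval misses only the end point \<open>\<tau>\<close>, a null
    set.\<close>
  then show ?thesis
    by (subst set_integrable_discrete_difference[where X = "{\<tau>}" and B = "{0<..<\<tau>}"])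
      (use \<open>0 < \<tau>\<close> in auto)
qed

text \<open>The conditions on a desingularization that involve neither \<open>f\<close> nor the
  point. They survive addition, and a sum that serves several critical points has no base point of
  its own.\<close>

locale desingularizing =
  fixes \<phi> :: "real \<Rightarrow> real" and \<eta> :: ereal
  assumes eta_pos: "0 < \<eta>"
    and nonneg: "0 \<le> t \<Longrightarrow> ereal t < \<eta> \<Longrightarrow> 0 \<le> \<phi> t"
    and cont: "continuous_on {t. 0 \<le> t \<and> ereal t < \<eta>} \<phi>"
    and concave: "concave_on {t. 0 \<le> t \<and> ereal t < \<eta>} \<phi>"
    and zero [simp]: "\<phi> 0 = 0"
    and diff: "0 < t \<Longrightarrow> ereal t < \<eta> \<Longrightarrow> \<phi> differentiable (at t)"
    and deriv_pos: "0 < t \<Longrightarrow> ereal t < \<eta> \<Longrightarrow> 0 < deriv \<phi> t"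
    and deriv_cont: "continuous_on {t. 0 < t \<and> ereal t < \<eta>} (deriv \<phi>)"

lemma KL_desingularization_iff:
  "KL_desingularization f xb \<eta> \<phi> \<longleftrightarrow> desingularizing \<phi> \<eta> \<and>
    (\<exists>\<delta>::ereal. 0 < \<delta> \<and>
      (\<forall>x. ereal (norm (x - xb)) < \<delta> \<and> 0 < f x - f xb \<and> ereal (f x - f xb) < \<eta> \<longrightarrow>
        1 \<le> deriv \<phi> (f x - f xb) * norm (gradient f x)))"
  unfolding KL_desingularization_def desingularizing_def by auto

context desingularizing
begin

abbreviation dom :: "real set" where "dom \<equiv> {t. 0 < t \<and> ereal t < \<eta>}"

lemma exists_dom: "\<exists>t. t \<in> dom"
proof -
  obtain t where "0 < ereal t" "ereal t < \<eta>"
    using ereal_dense2[OF eta_pos] by blast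
  then show ?thesis by auto
qed

lemma dom_down: "t \<in> dom \<Longrightarrow> 0 < s \<Longrightarrow> s \<le> t \<Longrightarrow> s \<in> dom"
  by (auto intro: le_less_trans[of "ereal s" "ereal t"])

lemma dom_between: "s \<in> dom \<Longrightarrow> t \<in> dom \<Longrightarrow> s \<le> r \<Longrightarrow> r \<le> t \<Longrightarrow> r \<in> dom"
  by (auto intro: le_less_trans[of "ereal r" "ereal t"])

lemma open_dom: "open dom"
proof -
  have "dom = {0<..} \<inter> ereal -` {..<\<eta>}" by auto
  moreover have "open (ereal -` {..<\<eta>})"
    by (intro open_vimage continuous_on_ereal continuous_on_id open_lessThan)
  ultimately show ?thesis by (simp add: open_Int)
qed

lemma DERIV: "t \<in> dom \<Longrightarrow> (\<phi> has_field_derivative deriv \<phi> t) (at t)"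
  using diff[of t] by (auto simp: DERIV_deriv_iff_real_differentiable)

text \<open>Concavity at an interior point \<open>s\<close>. The other point may be 0, where
  \<open>\<phi>\<close> need not be differentiable; that case yields
  \<open>t * deriv \<phi> t \<le> \<phi> t\<close>.\<close>

lemma tangent:
  assumes "s \<in> dom" "0 \<le> t" "ereal t < \<eta>"
  shows "\<phi> t \<le> \<phi> s + deriv \<phi> s * (t - s)"
proof -
  have conv: "convex {t. 0 \<le> t \<and> ereal t < \<eta>}"
    unfolding is_interval_convex_1[symmetric] is_interval_1
    by (auto intro: le_less_trans[of "ereal _" "ereal _"])
  have "s \<in> interior {t. 0 \<le> t \<and> ereal t < \<eta>}"
    using open_dom assms(1) by (auto intro!: interiorI[of dom])
  then have "(\<lambda>t. - \<phi> t) t - (\<lambda>t. - \<phi> t) s \<ge> (- deriv \<phi> s) * (t - s)"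
    using concave assms conv
    by (intro convex_on_imp_above_tangent[where A = "{t. 0 \<le> t \<and> ereal t < \<eta>}"])
      (auto simp: concave_on_def intro!: convex_connected DERIV_subset[OF DERIV] derivative_eq_intros)
  then show ?thesis by (simp add: algebra_simps)
qed

lemma deriv_antimono:
  assumes "s \<in> dom" "t \<in> dom" "s \<le> t"
  shows "deriv \<phi> t \<le> deriv \<phi> s"
proof (cases "s = t")
  case False
  have "\<phi> t \<le> \<phi> s + deriv \<phi> s * (t - s)" "\<phi> s \<le> \<phi> t + deriv \<phi> t * (s - t)"
    using tangent assms by auto
  then have "deriv \<phi> t * (t - s) \<le> deriv \<phi> s * (t - s)"
    by (simp add: algebra_simps)
  then show ?thesis using assms False by simp
qed simp

lemma mult_deriv_le: "t \<in> dom \<Longrightarrow> t * deriv \<phi> t \<le> \<phi> t"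
  using tangent[of t 0] eta_pos by (simp add: algebra_simps zero_ereal_def)

lemma pos: "t \<in> dom \<Longrightarrow> 0 < \<phi> t"
  using mult_deriv_le[of t] deriv_pos[of t] by (auto intro: less_le_trans[OF mult_pos_pos])

lemma strict_mono:
  assumes "0 \<le> s" "s < t" "ereal t < \<eta>"
  shows "\<phi> s < \<phi> t"
proof -
  have t: "t \<in> dom" using assms by auto
  have "0 < deriv \<phi> t * (t - s)" using deriv_pos[of t] assms by auto
  moreover have "\<phi> s \<le> \<phi> t + deriv \<phi> t * (s - t)"
    using assms t by (intro tangent) (auto intro: less_trans[of "ereal s" "ereal t"])
  ultimately show ?thesis by (simp add: algebra_simps)
qed

lemma tendsto_0: "(\<phi> \<longlongrightarrow> 0) (at_right 0)"
proof -
  obtain \<tau> where \<tau>: "\<tau> \<in> dom" using exists_dom by blast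
  have "continuous_on {0..\<tau>} \<phi>"
    using cont \<tau> by (auto elim!: continuous_on_subset intro: le_less_trans[of "ereal _" "ereal \<tau>"])
  then show ?thesis
    using \<tau> by (auto dest: continuous_on_Icc_at_rightD)
qed

lemma deriv_integrable: "\<exists>\<tau>>0. ereal \<tau> < \<eta> \<and> set_integrable lborel {0<..\<tau>} (deriv \<phi>)"
proof -
  obtain \<tau> where \<tau>: "\<tau> \<in> dom" using exists_dom by blast
  have "set_integrable lborel {0<..\<tau>} (deriv \<phi>)"
    using \<tau> dom_down[OF \<tau>]
    by (intro set_integrable_deriv_of_bounded[where G = \<phi> and c = 0])
      (auto intro!: DERIV less_imp_le[OF deriv_pos] nonneg continuous_on_subset[OF deriv_cont])
  with \<tau> show ?thesis by auto
qed

lemma integrable_near_0_inverse_sqrt_KL_phi: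
  "integrable_near_0 \<eta> (\<lambda>t. 1 / sqrt (KL_phi \<phi> t))"
proof -
  obtain \<tau> where \<tau>: "0 < \<tau>" "ereal \<tau> < \<eta>" "set_integrable lborel {0<..\<tau>} (deriv \<phi>)"
    using deriv_integrable by blast
  have "1 / sqrt (KL_phi \<phi> t) = deriv \<phi> t" if "t \<in> {0<..\<tau>}" for t
    using deriv_pos[of t] dom_down[of \<tau> t] \<tau> that by (auto simp: KL_phi_def real_sqrt_divide)
  then have "set_integrable lborel {0<..\<tau>} (\<lambda>t. 1 / sqrt (KL_phi \<phi> t))"
    using \<tau>(3) by (subst set_integrable_cong[OF refl refl, where f' = "deriv \<phi>"]) auto
  with \<tau> show ?thesis unfolding integrable_near_0_def by blast
qed

text \<open>This covers points beyond \<open>\<eta>\<close> too: at a vanishing derivative both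
  sides are 0, as \<open>1 / 0 = 0\<close>.\<close>

lemma inverse_KL_phi: "t > 0 \<Longrightarrow> 1 / KL_phi \<phi> t = (deriv \<phi> t)\<^sup>2"
  by (simp add: KL_phi_def)

lemma integrable_near_0_inverse_KL_phi_iff:
  "integrable_near_0 \<eta> (\<lambda>t. 1 / KL_phi \<phi> t) \<longleftrightarrow>
    (\<exists>\<tau>>0. ereal \<tau> < \<eta> \<and> set_integrable lborel {0<..\<tau>} (\<lambda>t. (deriv \<phi> t)\<^sup>2))"
proof -
  have "set_integrable lborel {0<..\<tau>} (\<lambda>t. 1 / KL_phi \<phi> t) =
      set_integrable lborel {0<..\<tau>} (\<lambda>t. (deriv \<phi> t)\<^sup>2)" for \<tau>
    by (rule set_integrable_cong) (auto simp: inverse_KL_phi)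
  then show ?thesis unfolding integrable_near_0_def by simp
qed

end

lemma desingularizing_add:
  assumes "desingularizing \<phi>1 \<eta>1" "desingularizing \<phi>2 \<eta>2"
  shows "desingularizing (\<lambda>t. \<phi>1 t + \<phi>2 t) (min \<eta>1 \<eta>2)"
    and "\<And>t. 0 < t \<Longrightarrow> ereal t < min \<eta>1 \<eta>2 \<Longrightarrow>
      deriv (\<lambda>t. \<phi>1 t + \<phi>2 t) t = deriv \<phi>1 t + deriv \<phi>2 t"
proof -
  interpret D1: desingularizing \<phi>1 \<eta>1 by fact
  interpret D2: desingularizing \<phi>2 \<eta>2 by fact
  have D: "((\<lambda>t. \<phi>1 t + \<phi>2 t) has_field_derivative deriv \<phi>1 t + deriv \<phi>2 t) (at t)"
    if "0 < t" "ereal t < min \<eta>1 \<eta>2" for t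
    using that by (auto intro!: DERIV_add D1.DERIV D2.DERIV)
  then show *: "deriv (\<lambda>t. \<phi>1 t + \<phi>2 t) t = deriv \<phi>1 t + deriv \<phi>2 t"
    if "0 < t" "ereal t < min \<eta>1 \<eta>2" for t
    using that by (auto intro!: DERIV_imp_deriv)
  have conv: "convex {t. 0 \<le> t \<and> ereal t < min \<eta>1 \<eta>2}"
    unfolding is_interval_convex_1[symmetric] is_interval_1
    by (auto intro: le_less_trans[of "ereal _" "ereal _"])
  have con: "concave_on {t. 0 \<le> t \<and> ereal t < min \<eta>1 \<eta>2} \<phi>1"
    "concave_on {t. 0 \<le> t \<and> ereal t < min \<eta>1 \<eta>2} \<phi>2"
    using D1.concave D2.concave conv unfolding concave_on_def
    by (auto elim!: convex_on_subset)
  show "desingularizing (\<lambda>t. \<phi>1 t + \<phi>2 t) (min \<eta>1 \<eta>2)"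
  proof
    show "0 < min \<eta>1 \<eta>2" using D1.eta_pos D2.eta_pos by simp
    show "0 \<le> \<phi>1 t + \<phi>2 t" if "0 \<le> t" "ereal t < min \<eta>1 \<eta>2" for t
      using that D1.nonneg D2.nonneg by auto
    show "continuous_on {t. 0 \<le> t \<and> ereal t < min \<eta>1 \<eta>2} (\<lambda>t. \<phi>1 t + \<phi>2 t)"
      by (intro continuous_on_add continuous_on_subset[OF D1.cont] continuous_on_subset[OF D2.cont]) auto
    show "concave_on {t. 0 \<le> t \<and> ereal t < min \<eta>1 \<eta>2} (\<lambda>t. \<phi>1 t + \<phi>2 t)"
      using con by (rule concave_on_add)
    show "(\<lambda>t. \<phi>1 t + \<phi>2 t) differentiable at t" if "0 < t" "ereal t < min \<eta>1 \<eta>2" for t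
      using D[OF that] real_differentiable_def by blast
    show "0 < deriv (\<lambda>t. \<phi>1 t + \<phi>2 t) t" if "0 < t" "ereal t < min \<eta>1 \<eta>2" for t
      using *[OF that] that D1.deriv_pos[of t] D2.deriv_pos[of t] by simp
    have "continuous_on {t. 0 < t \<and> ereal t < min \<eta>1 \<eta>2} (\<lambda>t. deriv \<phi>1 t + deriv \<phi>2 t)"
      by (intro continuous_on_add continuous_on_subset[OF D1.deriv_cont]
          continuous_on_subset[OF D2.deriv_cont]) auto
    then show "continuous_on {t. 0 < t \<and> ereal t < min \<eta>1 \<eta>2} (deriv (\<lambda>t. \<phi>1 t + \<phi>2 t))"
      using * by (auto cong: continuous_on_cong_simp)
  qed auto
qed

text \<open>Sums rather than maxima: a sum of concave, continuously differentiable functions is of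
  the same kind, and as all derivatives are positive, the derivative of the sum dominates each of
  them.\<close>

lemma desingularizing_uniformize:
  assumes "finite C" "C \<noteq> {}" "\<And>p. p \<in> C \<Longrightarrow> desingularizing (\<phi> p) (\<eta> p)"
  shows "\<exists>\<Phi> \<eta>'. desingularizing \<Phi> \<eta>' \<and> (\<forall>p\<in>C. \<eta>' \<le> \<eta> p \<and>
    (\<forall>t. 0 < t \<and> ereal t < \<eta>' \<longrightarrow> deriv (\<phi> p) t \<le> deriv \<Phi> t))"
  using assms
proof (induction rule: finite_ne_induct)
  case (singleton p)
  then show ?case by (intro exI[of _ "\<phi> p"] exI[of _ "\<eta> p"]) auto
next
  case (insert p C)
  then have "\<exists>\<Phi> \<eta>'. desingularizing \<Phi> \<eta>' \<and> (\<forall>p\<in>C. \<eta>' \<le> \<eta> p \<and>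
    (\<forall>t. 0 < t \<and> ereal t < \<eta>' \<longrightarrow> deriv (\<phi> p) t \<le> deriv \<Phi> t))"
    by simp
  then obtain \<Phi> \<eta>' where *: "desingularizing \<Phi> \<eta>'" "\<And>q. q \<in> C \<Longrightarrow> \<eta>' \<le> \<eta> q"
    "\<And>q t. q \<in> C \<Longrightarrow> 0 < t \<Longrightarrow> ereal t < \<eta>' \<Longrightarrow> deriv (\<phi> q) t \<le> deriv \<Phi> t"
    by blast
  have p: "desingularizing (\<phi> p) (\<eta> p)" using insert by simp
  interpret D1: desingularizing "\<phi> p" "\<eta> p" by fact
  interpret D2: desingularizing \<Phi> \<eta>' by fact
  note add = desingularizing_add[OF p *(1)]
  show ?case
  proof (intro exI conjI ballI allI impI)
    show "desingularizing (\<lambda>t. \<phi> p t + \<Phi> t) (min (\<eta> p) \<eta>')" by (rule add)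
  next
    fix q assume "q \<in> insert p C"
    then show "min (\<eta> p) \<eta>' \<le> \<eta> q" using *(2) by (auto simp: min_le_iff_disj)
    fix t assume t: "0 < t \<and> ereal t < min (\<eta> p) \<eta>'"
    then show "deriv (\<phi> q) t \<le> deriv (\<lambda>t. \<phi> p t + \<Phi> t) t"
      using add(2)[of t] \<open>q \<in> insert p C\<close> *(3)[of q t] D1.deriv_pos[of t] D2.deriv_pos[of t]
      by auto
  qed
qed

section \<open>The rate estimate for KL paths\<close>

locale desingularizing_base = desingularizing +
  fixes t0 :: real
  assumes t0_pos: "0 < t0" and t0_less: "ereal t0 < \<eta>"
begin

abbreviation \<psi> :: "real \<Rightarrow> real" where "\<psi> \<equiv> KL_psi \<phi> t0"
abbreviation \<psi>_inv :: "real \<Rightarrow> real" where "\<psi>_inv \<equiv> KL_psi_inv \<phi> \<eta> t0"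

lemma t0_dom: "t0 \<in> dom"
  using t0_pos t0_less by simp

lemma psi_t0: "\<psi> t0 = 0"
  by (simp add: KL_psi_def)

lemma psi_DERIV:
  assumes "t \<in> dom"
  shows "(\<psi> has_field_derivative - (deriv \<phi> t)\<^sup>2) (at t)"
proof -
  \<comment> \<open>The fundamental theorem is applied on a compact interval in the domain with both
    \<open>t\<close> and \<open>t0\<close> in its interior; hence \<open>a\<close> lies below the
    smaller and \<open>b\<close> slightly above the larger of the two.\<close>
  define a where "a = min t t0 / 2"
  have "max t t0 \<in> dom" using assms t0_dom by (auto simp: max_def)
  then obtain e where e: "e > 0" "ball (max t t0) e \<subseteq> dom"
    using open_dom open_contains_ball by blast
  define b where "b = max t t0 + e / 2"
  have "b \<in> ball (max t t0) e" using e by (simp add: b_def dist_real_def)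
  with e have b: "b \<in> dom" by blast
  have ab: "0 < a" "a < t" "a < t0" "t < b" "t0 < b"
    using assms t0_dom e by (auto simp: a_def b_def)
  have sub: "{a..b} \<subseteq> dom" using b ab dom_down[OF b] by auto
  have "((\<lambda>u. LBINT s=ereal t0..ereal u. (deriv \<phi> s)\<^sup>2) has_vector_derivative (deriv \<phi> t)\<^sup>2)
      (at t within {a..b})"
    using ab sub by (intro interval_integral_FTC2 continuous_on_power
        continuous_on_subset[OF deriv_cont]) auto
  then have "((\<lambda>u. LBINT s=ereal t0..ereal u. (deriv \<phi> s)\<^sup>2) has_field_derivative (deriv \<phi> t)\<^sup>2)
      (at t)"
    using ab by (simp add: has_real_derivative_iff_has_vector_derivative at_within_Icc_at)
  then have "((\<lambda>u. - (LBINT s=ereal t0..ereal u. (deriv \<phi> s)\<^sup>2)) has_field_derivative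
      - (deriv \<phi> t)\<^sup>2) (at t)"
    by (rule DERIV_minus)
  \<comment> \<open>The variable of \<open>\<psi>\<close> is the lower limit of integration;
    reversing the limits produces the sign.\<close>
  moreover have "\<psi> = (\<lambda>u. - (LBINT s=ereal t0..ereal u. (deriv \<phi> s)\<^sup>2))"
    unfolding KL_psi_def by (subst interval_integral_endpoints_reverse) simp
  ultimately show ?thesis by simp
qed

text \<open>The difference of \<open>\<psi>\<close> is the integral of
  \<open>(deriv \<phi>)\<^sup>2\<close> over \<open>[s, t]\<close>, and this integrand is
  nonincreasing, so its value at the right end is a lower bound. It converts a decrease of
  \<open>f\<close> into growth of \<open>\<psi>\<close>.\<close>

lemma psi_diff_ge:
  assumes "s \<in> dom" "t \<in> dom" "s \<le> t"
  shows "(deriv \<phi> t)\<^sup>2 * (t - s) \<le> \<psi> s - \<psi> t"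
proof -
  have "- \<psi> s - (deriv \<phi> t)\<^sup>2 * s \<le> - \<psi> t - (deriv \<phi> t)\<^sup>2 * t"
  proof (rule DERIV_nonneg_imp_nondecreasing[OF \<open>s \<le> t\<close>])
    fix r assume r: "s \<le> r" "r \<le> t"
    then have "r \<in> dom" using dom_between assms by blast
    then have "((\<lambda>r. - \<psi> r - (deriv \<phi> t)\<^sup>2 * r) has_field_derivative
        (deriv \<phi> r)\<^sup>2 - (deriv \<phi> t)\<^sup>2) (at r)"
      by (auto intro!: derivative_eq_intros psi_DERIV)
    moreover have "(deriv \<phi> t)\<^sup>2 \<le> (deriv \<phi> r)\<^sup>2"
      using deriv_antimono[OF \<open>r \<in> dom\<close> assms(2) r(2)] deriv_pos[of t] assms by (intro power_mono) auto
    ultimately show "\<exists>y. ((\<lambda>r. - \<psi> r - (deriv \<phi> t)\<^sup>2 * r) has_field_derivative y) (at r) \<and> 0 \<le> y"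
      by auto
  qed
  then show ?thesis by (simp add: algebra_simps)
qed

text \<open>On \<open>[s, t]\<close> one factor of \<open>(deriv \<phi>)\<^sup>2\<close> is replaced
  by its largest value \<open>deriv \<phi> s\<close>; the other integrates to
  \<open>\<phi> t - \<phi> s\<close>. This bounds the stepsizes by the decrease of
  \<open>\<phi>\<close> along \<open>y\<close>.\<close>

lemma psi_diff_le:
  assumes "s \<in> dom" "t \<in> dom" "s \<le> t"
  shows "\<psi> s - \<psi> t \<le> deriv \<phi> s * (\<phi> t - \<phi> s)"
proof -
  have "\<psi> s + deriv \<phi> s * \<phi> s \<le> \<psi> t + deriv \<phi> s * \<phi> t"
  proof (rule DERIV_nonneg_imp_nondecreasing[OF \<open>s \<le> t\<close>])
    fix r assume r: "s \<le> r" "r \<le> t"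
    then have "r \<in> dom" using dom_between assms by blast
    then have "((\<lambda>r. \<psi> r + deriv \<phi> s * \<phi> r) has_field_derivative
        - (deriv \<phi> r)\<^sup>2 + deriv \<phi> s * deriv \<phi> r) (at r)"
      by (auto intro!: derivative_eq_intros psi_DERIV DERIV)
    moreover have "deriv \<phi> r * deriv \<phi> r \<le> deriv \<phi> s * deriv \<phi> r"
      using deriv_antimono[OF assms(1) \<open>r \<in> dom\<close> r(1)] deriv_pos[of r] \<open>r \<in> dom\<close>
      by (intro mult_right_mono) auto
    ultimately show "\<exists>y. ((\<lambda>r. \<psi> r + deriv \<phi> s * \<phi> r) has_field_derivative y) (at r) \<and> 0 \<le> y"
      by (auto simp: power2_eq_square)
  qed
  then show ?thesis by (simp add: algebra_simps)
qed

lemma psi_strict_antimono: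
  assumes "s \<in> dom" "t \<in> dom" "s < t"
  shows "\<psi> t < \<psi> s"
proof -
  have "0 < (deriv \<phi> t)\<^sup>2 * (t - s)" using deriv_pos[of t] assms by simp
  also have "\<dots> \<le> \<psi> s - \<psi> t" using psi_diff_ge assms by simp
  finally show ?thesis by simp
qed

lemma psi_le_iff: "s \<in> dom \<Longrightarrow> t \<in> dom \<Longrightarrow> \<psi> t \<le> \<psi> s \<longleftrightarrow> s \<le> t"
  using psi_strict_antimono[of s t] psi_strict_antimono[of t s]
  by (cases s t rule: linorder_cases) auto

lemma inj_on_psi: "inj_on \<psi> dom"
  by (rule inj_onI) (metis order_antisym order_refl psi_le_iff)

lemma psi_inv_dom: "c \<in> \<psi> ` dom \<Longrightarrow> \<psi>_inv c \<in> dom"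
  unfolding KL_psi_inv_def using the_inv_into_into[OF inj_on_psi] by blast

lemma psi_psi_inv: "c \<in> \<psi> ` dom \<Longrightarrow> \<psi> (\<psi>_inv c) = c"
  unfolding KL_psi_inv_def using f_the_inv_into_f[OF inj_on_psi] by blast

lemma psi_bounded_of_integrable:
  assumes "integrable_near_0 \<eta> (\<lambda>t. 1 / KL_phi \<phi> t)"
  shows "\<exists>C. \<forall>t\<in>dom. \<psi> t \<le> C"
proof -
  obtain \<tau> where \<tau>: "0 < \<tau>" "ereal \<tau> < \<eta>" "set_integrable lborel {0<..\<tau>} (\<lambda>t. (deriv \<phi> t)\<^sup>2)"
    using assms unfolding integrable_near_0_inverse_KL_phi_iff by blast
  have dom: "t \<in> dom" if "0 < t" "t \<le> \<tau>" for t
    using dom_down[of \<tau> t] \<tau> that by simp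
  have D: "((\<lambda>t. - \<psi> t) has_field_derivative (deriv \<phi> t)\<^sup>2) (at t)" if "0 < t" "t \<le> \<tau>" for t
    using DERIV_minus[OF psi_DERIV[OF dom[OF that]]] by simp
  obtain C where C: "\<And>t. 0 < t \<Longrightarrow> t \<le> \<tau> \<Longrightarrow> - \<psi> \<tau> - - \<psi> t \<le> C"
    using increments_bounded_of_integrable[OF D _ _ \<tau>(3)] by auto
  have "\<psi> t \<le> max (C + \<psi> \<tau>) (\<psi> \<tau>)" if t: "t \<in> dom" for t
  proof (cases "t \<le> \<tau>")
    case True
    then show ?thesis using C[of t] t by auto
  next
    case False
    then show ?thesis using psi_le_iff[of \<tau> t] dom[of \<tau>] \<tau> t by auto
  qed
  then show ?thesis by blast
qed

lemma psi_unbounded: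
  assumes "\<not> integrable_near_0 \<eta> (\<lambda>t. 1 / KL_phi \<phi> t)"
  shows "\<exists>t\<in>dom. C \<le> \<psi> t"
proof (rule ccontr)
  assume *: "\<not> (\<exists>t\<in>dom. C \<le> \<psi> t)"
  have "set_integrable lborel {0<..t0} (\<lambda>t. (deriv \<phi> t)\<^sup>2)"
  proof (rule set_integrable_deriv_of_bounded[where G = "\<lambda>t. - \<psi> t" and c = "- C"])
    fix t assume "0 < t" "t \<le> t0"
    then have t: "t \<in> dom" using dom_down t0_dom by blast
    show "((\<lambda>t. - \<psi> t) has_field_derivative (deriv \<phi> t)\<^sup>2) (at t)"
      using DERIV_minus[OF psi_DERIV[OF t]] by simp
    show "- C \<le> - \<psi> t" using * t by force
  next
    show "continuous_on {0<..t0} (\<lambda>t. (deriv \<phi> t)\<^sup>2)"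
      using dom_down[OF t0_dom] by (intro continuous_on_power continuous_on_subset[OF deriv_cont]) auto
  qed (auto simp: t0_pos)
  then show False
    using assms t0_pos t0_less unfolding integrable_near_0_inverse_KL_phi_iff by blast
qed

text \<open>Intermediate values between \<open>t0\<close>, where \<open>\<psi>\<close> vanishes, and
  a point near 0 with a large value. Since sums of stepsizes are nonnegative,
  \<open>\<psi>_inv\<close> is evaluated inside its domain from \<open>k = 0\<close> on.\<close>

lemma nonneg_in_psi_image:
  assumes "\<not> integrable_near_0 \<eta> (\<lambda>t. 1 / KL_phi \<phi> t)" "0 \<le> c"
  shows "c \<in> \<psi> ` dom"
proof -
  obtain s where s: "s \<in> dom" "c \<le> \<psi> s" using psi_unbounded assms by blast
  then have "s \<le> t0" using psi_le_iff[OF s(1) t0_dom] assms psi_t0 by simp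
  have "\<forall>x. s \<le> x \<and> x \<le> t0 \<longrightarrow> isCont \<psi> x"
    using dom_between s(1) t0_dom by (blast intro: DERIV_isCont psi_DERIV)
  then obtain t where "s \<le> t" "t \<le> t0" "\<psi> t = c"
    using IVT2[of \<psi> t0 c s] \<open>s \<le> t0\<close> s assms psi_t0 by auto
  moreover from this have "t \<in> dom" using dom_between s(1) t0_dom by blast
  ultimately show ?thesis by blast
qed

end

text \<open>The scalar trace of a path: \<open>v\<close> is the excess over the limiting level,
  \<open>G\<close> the gradient norm, \<open>d\<close> the step length, and the KL inequality holds
  from \<open>K\<close> on. No limit point occurs, so that the same estimates apply before
  convergence, with a sum of desingularizing functions, and afterwards, with the function of the
  limit.\<close>

locale KL_path = desingularizing_base +
  fixes v G z d \<alpha> :: "nat \<Rightarrow> real" and c1 c2 :: real and K :: nat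
  assumes c12_pos: "0 < c1" "0 < c2"
    and alpha: "\<And>k. 0 < \<alpha> k" "\<And>k. \<alpha> k \<le> 2" "filterlim (\<lambda>k. \<Sum>i<k. \<alpha> i) at_top sequentially"
    and z_nonneg: "\<And>k. 0 \<le> z k"
    and v_pos: "\<And>k. 0 < v k"
    and v_dom: "\<And>k. k \<ge> K \<Longrightarrow> ereal (v k) < \<eta>"
    and KL: "\<And>k. k \<ge> K \<Longrightarrow> 1 \<le> deriv \<phi> (v k) * G k"
    and descent: "\<And>k. c1 * \<alpha> k * z k * (G k)\<^sup>2 \<le> v k - v (Suc k)"
    and step: "\<And>k. c1 * (d k)\<^sup>2 \<le> \<alpha> k * (v k - v (Suc k))"
    and density: "ereal c2 \<le> liminf (\<lambda>k. ereal ((\<Sum>i=1..k. \<alpha> i * z i) / (\<Sum>i=1..k. \<alpha> i)))"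
begin

definition A :: "nat \<Rightarrow> real" where "A k = (\<Sum>i<k. \<alpha> i)"
definition c :: real where "c = c1 * c2 / 2"

lemma A_Suc: "A (Suc k) = A k + \<alpha> k"
  by (simp add: A_def)

lemma A_nonneg: "0 \<le> A k"
  unfolding A_def using alpha(1) by (intro sum_nonneg) (auto intro: less_imp_le)

lemma c_pos: "0 < c"
  using c12_pos by (simp add: c_def)

lemma v_in_dom: "k \<ge> K \<Longrightarrow> v k \<in> dom"
  using v_pos v_dom by simp

lemma v_Suc_le: "v (Suc k) \<le> v k"
proof -
  have "0 \<le> c1 * \<alpha> k * z k * (G k)\<^sup>2"
    using c12_pos alpha(1)[of k] z_nonneg[of k] by (intro mult_nonneg_nonneg) auto
  then show ?thesis using descent[of k] by simp
qed

lemma psi_v_Suc: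
  assumes "k \<ge> K"
  shows "\<psi> (v k) + c1 * (\<alpha> k * z k) \<le> \<psi> (v (Suc k))"
proof -
  have "1 \<le> (deriv \<phi> (v k) * G k)\<^sup>2" using KL[OF assms] by (simp add: one_le_power)
  then have "c1 * (\<alpha> k * z k) * 1 \<le> c1 * (\<alpha> k * z k) * (deriv \<phi> (v k) * G k)\<^sup>2"
    using c12_pos alpha(1)[of k] z_nonneg[of k] by (intro mult_left_mono mult_nonneg_nonneg) auto
  also have "\<dots> = (deriv \<phi> (v k))\<^sup>2 * (c1 * \<alpha> k * z k * (G k)\<^sup>2)"
    by (simp add: power_mult_distrib)
  also have "\<dots> \<le> (deriv \<phi> (v k))\<^sup>2 * (v k - v (Suc k))"
    by (intro mult_left_mono descent) auto
  also have "\<dots> \<le> \<psi> (v (Suc k)) - \<psi> (v k)"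
    using assms by (intro psi_diff_ge v_in_dom v_Suc_le) auto
  finally show ?thesis by simp
qed

text \<open>The limit inferior leaves a factor of slack over \<^term>\<open>c2 / 2\<close>, which pays both for the
  finitely many initial steps and for the shift from \<^term>\<open>k\<close> to \<^term>\<open>Suc k\<close>.\<close>

lemma eventually_psi_v_ge: "eventually (\<lambda>k. k \<ge> K \<and> c * A (Suc k) \<le> \<psi> (v k)) sequentially"
proof -
  define D where "D = \<psi> (v K) - c1 * (\<Sum>i<K. \<alpha> i * z i)"
  have lower: "D + c1 * (\<Sum>i<k. \<alpha> i * z i) \<le> \<psi> (v k)" if "k \<ge> K" for k
    using that
  proof (induction k rule: dec_induct)
    case (step k)
    then show ?case using psi_v_Suc[of k] by (simp add: algebra_simps)
  qed (simp add: D_def)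
  have "ereal (3 / 4 * c2) < ereal c2" using c12_pos by simp
  also note density
  finally have "eventually (\<lambda>k. ereal (3 / 4 * c2) <
      ereal ((\<Sum>i=1..k. \<alpha> i * z i) / (\<Sum>i=1..k. \<alpha> i))) sequentially"
    by (rule less_LiminfD)
  \<comment> \<open>This threshold solves \<open>c * (A (Suc k) + 2) \<le> D + c1 * (3 / 4 * c2 * (A
    (Suc k) - \<alpha> 0))\<close>: the 2 bounds the next stepsize, \<open>\<alpha> 0\<close> is
    absent from the averages, which start at index 1, and \<open>D\<close> collects the initial
    steps.\<close>
  moreover have "eventually (\<lambda>k. A k \<ge> 3 * \<alpha> 0 + 4 + 4 * \<bar>D\<bar> / (c1 * c2)) sequentially"
    using alpha(3) unfolding A_def filterlim_at_top by blast
  then have "eventually (\<lambda>k. A (Suc k) \<ge> 3 * \<alpha> 0 + 4 + 4 * \<bar>D\<bar> / (c1 * c2)) sequentially"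
    by (rule eventually_compose_filterlim[OF _ filterlim_Suc])
  moreover have "eventually (\<lambda>k. k \<ge> K \<and> k \<ge> 1) sequentially"
    by (intro eventually_conj eventually_ge_at_top)
  ultimately have "eventually (\<lambda>k. Suc k \<ge> K \<and> c * A (Suc (Suc k)) \<le> \<psi> (v (Suc k))) sequentially"
  proof eventually_elim
    case (elim k)
    have "(\<Sum>i=1..k. \<alpha> i) > 0"
      using alpha(1) elim by (intro sum_pos) auto
    then have "3 / 4 * c2 * (\<Sum>i=1..k. \<alpha> i) \<le> (\<Sum>i=1..k. \<alpha> i * z i)"
      using elim(1) by (simp add: pos_less_divide_eq)
    also have "(\<Sum>i=1..k. \<alpha> i) = A (Suc k) - \<alpha> 0"
      unfolding A_def sum.lessThan_Suc_shift sum.atLeast1_atMost_eq One_nat_def by simp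
    also have "(\<Sum>i=1..k. \<alpha> i * z i) \<le> (\<Sum>i<Suc k. \<alpha> i * z i)"
      using alpha(1)[of 0] z_nonneg[of 0]
      unfolding sum.lessThan_Suc_shift sum.atLeast1_atMost_eq One_nat_def by simp
    finally have *: "3 / 4 * c2 * (A (Suc k) - \<alpha> 0) \<le> (\<Sum>i<Suc k. \<alpha> i * z i)" .
    have "c * A (Suc (Suc k)) \<le> c * (A (Suc k) + 2)"
      using alpha(2)[of "Suc k"] c_pos by (simp add: A_Suc)
    also have "\<dots> \<le> D + c1 * (3 / 4 * c2 * (A (Suc k) - \<alpha> 0))"
    proof -
      have "c1 * c2 * (3 * \<alpha> 0 + 4 + 4 * \<bar>D\<bar> / (c1 * c2)) \<le> c1 * c2 * A (Suc k)"
        using elim(2) c12_pos by (intro mult_left_mono) auto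
      also have "c1 * c2 * (3 * \<alpha> 0 + 4 + 4 * \<bar>D\<bar> / (c1 * c2)) =
          c1 * c2 * (3 * \<alpha> 0 + 4) + 4 * \<bar>D\<bar>"
        using c12_pos by (simp add: distrib_left)
      finally have "3 * (c1 * c2 * \<alpha> 0) + 4 * (c1 * c2) + 4 * \<bar>D\<bar> \<le> c1 * c2 * A (Suc k)"
        by (simp add: distrib_left mult_ac)
      moreover have "c * (A (Suc k) + 2) = c1 * c2 * A (Suc k) / 2 + c1 * c2"
        by (simp add: c_def distrib_left)
      moreover have "c1 * (3 / 4 * c2 * (A (Suc k) - \<alpha> 0)) =
          3 / 4 * (c1 * c2 * A (Suc k)) - 3 / 4 * (c1 * c2 * \<alpha> 0)"
        by (simp add: right_diff_distrib)
      ultimately show ?thesis using abs_ge_minus_self[of D] by linarith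
    qed
    also have "\<dots> \<le> D + c1 * (\<Sum>i<Suc k. \<alpha> i * z i)"
      using * c12_pos by simp
    also have "\<dots> \<le> \<psi> (v (Suc k))" using elim by (intro lower) simp
    finally show ?case using elim by simp
  qed
  then show ?thesis by (rule eventually_sequentially_Suc[THEN iffD1])
qed

text \<open>Integrability would bound \<open>\<psi>\<close>, but \<open>\<psi> (v k)\<close>
  eventually exceeds \<open>c * A (Suc k)\<close>, which is unbounded. Read contrapositively: under
  integrability a path must reach its limiting level.\<close>

lemma not_integrable: "\<not> integrable_near_0 \<eta> (\<lambda>t. 1 / KL_phi \<phi> t)"
proof
  assume "integrable_near_0 \<eta> (\<lambda>t. 1 / KL_phi \<phi> t)"
  then obtain C where C: "\<And>t. t \<in> dom \<Longrightarrow> \<psi> t \<le> C"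
    using psi_bounded_of_integrable by blast
  have "eventually (\<lambda>k. A k \<ge> (C + 1) / c) sequentially"
    using alpha(3) unfolding A_def filterlim_at_top by blast
  then have "eventually (\<lambda>k. A (Suc k) \<ge> (C + 1) / c) sequentially"
    by (rule eventually_compose_filterlim[OF _ filterlim_Suc])
  with eventually_psi_v_ge have "eventually (\<lambda>k. False) sequentially"
  proof eventually_elim
    case (elim k)
    then have "C + 1 \<le> c * A (Suc k)" using c_pos by (simp add: pos_divide_le_eq mult.commute)
    also have "\<dots> \<le> C" using elim C[of "v k"] v_in_dom by force
    finally show ?case by simp
  qed
  then show False by simp
qed

definition y :: "nat \<Rightarrow> real" where "y k = \<psi>_inv (c * A k)"

lemma A_in_image: "c * A k \<in> \<psi> ` dom"
  using nonneg_in_psi_image[OF not_integrable] c_pos A_nonneg by simp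

lemma y_dom: "y k \<in> dom"
  unfolding y_def using A_in_image by (rule psi_inv_dom)

lemma psi_y: "\<psi> (y k) = c * A k"
  unfolding y_def using A_in_image by (rule psi_psi_inv)

lemma y_Suc_le: "y (Suc k) \<le> y k"
  using psi_le_iff[OF y_dom y_dom, of "Suc k" k] alpha(1)[of k] c_pos by (simp add: psi_y A_Suc)

lemma v_le_y: "k \<ge> K \<Longrightarrow> c * A (Suc k) \<le> \<psi> (v k) \<Longrightarrow> v k \<le> y (Suc k)"
  using psi_le_iff[OF v_in_dom y_dom] by (simp add: psi_y)

text \<open>By the choice of \<open>y\<close>, \<open>c * \<alpha> k\<close> is exactly the
  increment of \<open>\<psi>\<close> from \<open>y k\<close> to \<open>y (Suc k)\<close>. The
  right-hand side telescopes.\<close>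

lemma alpha_le: "\<alpha> k / deriv \<phi> (y (Suc k)) \<le> (\<phi> (y k) - \<phi> (y (Suc k))) / c"
proof -
  have "c * \<alpha> k = \<psi> (y (Suc k)) - \<psi> (y k)" by (simp add: psi_y A_Suc algebra_simps)
  also have "\<dots> \<le> deriv \<phi> (y (Suc k)) * (\<phi> (y k) - \<phi> (y (Suc k)))"
    by (intro psi_diff_le y_dom y_Suc_le)
  finally show ?thesis
    using c_pos deriv_pos[of "y (Suc k)"] y_dom[of "Suc k"]
    by (simp add: divide_le_eq le_divide_eq mult_ac)
qed

text \<open>Summation by parts; the boundary terms are part of the statement to make it inductive.\<close>

lemma sum_weighted_decrease:
  assumes n: "n \<ge> K" "\<And>k. k \<ge> n \<Longrightarrow> c * A (Suc k) \<le> \<psi> (v k)" and "Suc n \<le> N"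
  shows "(\<Sum>k=n..<N. (v k - v (Suc k)) * deriv \<phi> (y (Suc k))) + v N * deriv \<phi> (y N) \<le>
    \<phi> (y (Suc n)) - \<phi> (y N) + y N * deriv \<phi> (y N)"
  using \<open>Suc n \<le> N\<close>
proof (induction N rule: dec_induct)
  case base
  have "v n * deriv \<phi> (y (Suc n)) \<le> y (Suc n) * deriv \<phi> (y (Suc n))"
    using n deriv_pos[of "y (Suc n)"] y_dom[of "Suc n"] by (intro mult_right_mono v_le_y) auto
  then show ?case by (simp add: algebra_simps)
next
  case (step N)
  let ?w = "\<lambda>k. deriv \<phi> (y k)"
  \<comment> \<open>The left side of the claim grows by exactly this product. The weights increase
    because \<open>y\<close> decreases, so \<open>v N\<close> may be replaced by its bound
    \<open>y (Suc N)\<close>; the tangent at \<open>y N\<close> then matches the growth of the right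
    side.\<close>
  have "v N * (?w (Suc N) - ?w N) \<le> y (Suc N) * (?w (Suc N) - ?w N)"
    using n step.hyps deriv_antimono[OF y_dom y_dom y_Suc_le, of N]
    by (intro mult_right_mono v_le_y) auto
  moreover have "\<phi> (y (Suc N)) \<le> \<phi> (y N) + ?w N * (y (Suc N) - y N)"
    using y_dom[of "Suc N"] by (intro tangent y_dom) auto
  moreover have "(\<Sum>k=n..<Suc N. (v k - v (Suc k)) * ?w (Suc k)) =
      (\<Sum>k=n..<N. (v k - v (Suc k)) * ?w (Suc k)) + (v N - v (Suc N)) * ?w (Suc N)"
    using step.hyps by simp
  ultimately show ?case using step.IH by (simp add: algebra_simps)
qed

lemma sum_d_le:
  assumes n: "n \<ge> K" "\<And>k. k \<ge> n \<Longrightarrow> c * A (Suc k) \<le> \<psi> (v k)"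
  shows "(\<Sum>k=n..<N. d k) \<le> sqrt 2 / (c1 * sqrt c2) * \<phi> (y n)"
proof (cases "Suc n \<le> N")
  case True
  let ?w = "\<lambda>k. deriv \<phi> (y k)"
  \<comment> \<open>The two sums contribute \<open>\<phi> (y n) / (c1 * b)\<close> and
    \<open>b * \<phi> (y n) / c\<close>; they are equal for
    \<open>b\<^sup>2 = c / c1 = c2 / 2\<close>, which is the source of the final constant.\<close>
  define b where "b = sqrt (c2 / 2)"
  have b: "b > 0" "b\<^sup>2 = c2 / 2" using c12_pos by (auto simp: b_def)
  have w: "?w k > 0" for k using deriv_pos y_dom[of k] by auto
  have am_gm: "p * q \<le> ((p + q) / 2)\<^sup>2" for p q :: real
    using sum_squares_bound[of p q] by (simp add: power2_eq_square field_simps)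
  have summand: "d k \<le> ((v k - v (Suc k)) * ?w (Suc k) / (c1 * b) + b * (\<alpha> k / ?w (Suc k))) / 2" for k
  proof -
    let ?p = "(v k - v (Suc k)) * ?w (Suc k) / (c1 * b)" and ?q = "b * (\<alpha> k / ?w (Suc k))"
    have pq: "?p * ?q = \<alpha> k * (v k - v (Suc k)) / c1"
      using b w[of "Suc k"] c12_pos by (simp add: field_simps)
    have "0 \<le> ?p" "0 \<le> ?q"
      using v_Suc_le[of k] w[of "Suc k"] b c12_pos alpha(1)[of k] by auto
    have "(d k)\<^sup>2 \<le> ?p * ?q" using step[of k] c12_pos unfolding pq by (simp add: field_simps)
    also have "\<dots> \<le> ((?p + ?q) / 2)\<^sup>2"
      by (rule am_gm)
    finally show ?thesis
    proof (rule power2_le_imp_le)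
      show "0 \<le> (?p + ?q) / 2"
        using add_nonneg_nonneg[OF \<open>0 \<le> ?p\<close> \<open>0 \<le> ?q\<close>] by (rule divide_nonneg_nonneg) simp
    qed
  qed
  have "(\<Sum>k=n..<N. (v k - v (Suc k)) * ?w (Suc k)) \<le>
      \<phi> (y (Suc n)) - \<phi> (y N) + y N * ?w N - v N * ?w N"
    using sum_weighted_decrease[OF n True] by simp
  \<comment> \<open>The boundary term \<open>y N * ?w N\<close> is at most
    \<open>\<phi> (y N)\<close>, by concavity and \<open>\<phi> 0 = 0\<close>, and the subtracted
    \<open>v N * ?w N\<close> is positive.\<close>
  also have "\<dots> \<le> \<phi> (y (Suc n))"
    using mult_deriv_le[OF y_dom, of N] w[of N] v_pos[of N] mult_pos_pos[of "v N" "?w N"] by linarith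
  also have "\<dots> \<le> \<phi> (y n)"
    using strict_mono[of "y (Suc n)" "y n"] y_Suc_le[of n] y_dom[of n] y_dom[of "Suc n"]
    by (cases "y (Suc n) = y n") auto
  finally have sum1: "(\<Sum>k=n..<N. (v k - v (Suc k)) * ?w (Suc k)) \<le> \<phi> (y n)" .
  have "(\<Sum>k=n..<N. \<alpha> k / ?w (Suc k)) \<le> (\<Sum>k=n..<N. (\<phi> (y k) - \<phi> (y (Suc k))) / c)"
    by (intro sum_mono alpha_le)
  also have "\<dots> = (\<phi> (y n) - \<phi> (y N)) / c"
    using sum_Suc_diff'[of n N "\<lambda>k. - \<phi> (y k)"] True by (simp flip: sum_divide_distrib)
  also have "\<dots> \<le> \<phi> (y n) / c"
    using pos[OF y_dom, of N] c_pos by (intro divide_right_mono) auto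
  finally have sum2: "(\<Sum>k=n..<N. \<alpha> k / ?w (Suc k)) \<le> \<phi> (y n) / c" .
  have "(\<Sum>k=n..<N. d k) \<le>
      (\<Sum>k=n..<N. ((v k - v (Suc k)) * ?w (Suc k) / (c1 * b) + b * (\<alpha> k / ?w (Suc k))) / 2)"
    by (intro sum_mono summand)
  also have "\<dots> = ((\<Sum>k=n..<N. (v k - v (Suc k)) * ?w (Suc k)) / (c1 * b) +
      b * (\<Sum>k=n..<N. \<alpha> k / ?w (Suc k))) / 2"
    by (simp only: sum.distrib sum_distrib_left flip: sum_divide_distrib)
  also have "\<dots> \<le> (\<phi> (y n) / (c1 * b) + b * (\<phi> (y n) / c)) / 2"
    using sum1 sum2 b c12_pos by (intro divide_right_mono add_mono mult_left_mono) auto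
  also have "\<dots> = \<phi> (y n) / (c1 * b)"
    using c12_pos b unfolding c_def by (simp add: field_simps power2_eq_square)
  also have "\<dots> = sqrt 2 / (c1 * sqrt c2) * \<phi> (y n)"
    by (simp add: b_def real_sqrt_divide)
  finally show ?thesis .
next
  case False
  have "0 \<le> \<phi> (y n)" using pos[OF y_dom, of n] by simp
  then show ?thesis using False c12_pos by simp
qed

end

section \<open>Desingularization at points that are not local maximizers\<close>

text \<open>Representing the derivative in the orthonormal basis shows that a gradient exists, so
  that the definite description behind \<open>gradient\<close> denotes it.\<close>

lemma C1_GDERIV:
  fixes f :: "'a::euclidean_space \<Rightarrow> real"
  assumes "C1 f"
  shows "GDERIV f x :> gradient f x"
proof -
  obtain f' where f': "(f has_derivative f') (at x)"
    using assms unfolding C1_def differentiable_def by blast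
  then interpret bounded_linear f' by (rule has_derivative_bounded_linear)
  have "f' = (\<lambda>h. h \<bullet> (\<Sum>b\<in>Basis. f' b *\<^sub>R b))"
  proof
    fix h
    have "f' h = f' (\<Sum>b\<in>Basis. (h \<bullet> b) *\<^sub>R b)" by (simp add: euclidean_representation)
    also have "\<dots> = h \<bullet> (\<Sum>b\<in>Basis. f' b *\<^sub>R b)"
      by (simp add: sum scaleR inner_sum_right mult.commute)
    finally show "f' h = h \<bullet> (\<Sum>b\<in>Basis. f' b *\<^sub>R b)" .
  qed
  with f' have "GDERIV f x :> (\<Sum>b\<in>Basis. f' b *\<^sub>R b)" unfolding gderiv_def by simp
  then show ?thesis using gradient_eq by metis
qed

lemma C1_continuous_on: "C1 f \<Longrightarrow> continuous_on s f"
  unfolding C1_def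
  by (meson continuous_at_imp_continuous_on differentiable_imp_continuous_within)

lemma C1_continuous_on_gradient: "C1 f \<Longrightarrow> continuous_on s (gradient f)"
  unfolding C1_def using continuous_on_subset by blast

lemma GDERIV_along_line:
  fixes f :: "'a::euclidean_space \<Rightarrow> real"
  assumes "GDERIV f x :> D"
  shows "((\<lambda>t. f (x + t *\<^sub>R e)) has_field_derivative e \<bullet> D) (at 0)"
proof -
  have "((\<lambda>t. x + t *\<^sub>R e) has_derivative (\<lambda>t. t *\<^sub>R e)) (at (0::real))"
    by (auto intro!: derivative_eq_intros)
  moreover have "(f has_derivative (\<lambda>h. h \<bullet> D)) (at (x + 0 *\<^sub>R e))"
    using assms by (simp add: gderiv_def)
  ultimately have "((\<lambda>t. f (x + t *\<^sub>R e)) has_derivative (\<lambda>t. (t *\<^sub>R e) \<bullet> D)) (at 0)"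
    by (rule has_derivative_compose)
  then show ?thesis by (simp add: has_field_derivative_def mult.commute[of _ "e \<bullet> D"])
qed

context desingularizing
begin

text \<open>Every level above a point that is not a local maximizer is attained nearby: otherwise the
  maximum of \<^term>\<open>\<lambda>x. \<phi> (f x - f xb) - dist x y / 2\<close> over a ball around a nearby point
  \<^term>\<open>y\<close> with \<^term>\<open>f y > f xb\<close> would be an interior point, although \<^term>\<open>\<lambda>x. \<phi> (f x - f xb)\<close>
  has slope at least 1 there.\<close>

lemma exists_nearby_level_point:
  fixes f :: "'a::euclidean_space \<Rightarrow> real"
  assumes f: "C1 f" and not_max: "\<not> local_maximizer f xb" and v: "v \<in> dom"
    and KL: "\<And>x. norm (x - xb) \<le> 4 * \<phi> v \<Longrightarrow> 0 < f x - f xb \<Longrightarrow> ereal (f x - f xb) < \<eta> \<Longrightarrow>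
      1 \<le> deriv \<phi> (f x - f xb) * norm (gradient f x)"
  shows "\<exists>x. norm (x - xb) \<le> 4 * \<phi> v \<and> f x - f xb = v"
proof -
  \<comment> \<open>A point \<open>p\<close> with positive value
    \<open>\<phi> (f p - f xb) - dist p y / 2\<close> and level below \<open>v\<close> satisfies
    \<open>dist p y < 2 * \<phi> v\<close>, so this radius makes a maximizer interior. The centre
    \<open>y\<close> is itself within \<open>r\<close> of \<open>xb\<close>, which doubles the
    radius to \<open>4 * \<phi> v\<close>.\<close>
  define r where "r = 2 * \<phi> v"
  have r: "0 < r" using pos[OF v] by (simp add: r_def)
  note contf = C1_continuous_on[OF f]
  obtain y where y: "dist y xb < r" "f xb < f y"
    using not_max r unfolding local_maximizer_def eventually_nhds_metric
    by (auto simp: not_le)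
  have "\<exists>x\<in>cball xb (2 * r). v \<le> f x - f xb"
  proof (rule ccontr)
    assume "\<not> ?thesis"
    then have less: "f x - f xb < v" if "x \<in> cball xb (2 * r)" for x using that by force
    have sub: "cball y r \<subseteq> cball xb (2 * r)"
      using y by (intro cball_subset_cball_iff[THEN iffD2] disjI1) (simp add: dist_commute)
    \<comment> \<open>Cutting off at 0 keeps the argument of \<open>\<phi>\<close> in its domain and
      gives \<open>h x \<le> 0\<close> at every point with \<open>f x \<le> f xb\<close>, so that
      the maximizer lies strictly above that level.\<close>
    define h where "h x = \<phi> (max 0 (f x - f xb)) - dist x y / 2" for x
    have "continuous_on (cball y r) (\<lambda>x. \<phi> (max 0 (f x - f xb)))"
    proof (rule continuous_on_compose2[of "{0..v}" \<phi>])
      show "continuous_on {0..v} \<phi>"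
      proof (rule continuous_on_subset[OF cont], clarify)
        fix t assume "t \<in> {0..v}"
        then have "0 \<le> t" "ereal t \<le> ereal v" by auto
        then show "0 \<le> t \<and> ereal t < \<eta>" using v by (auto intro: le_less_trans[OF \<open>ereal t \<le> ereal v\<close>])
      qed
      show "continuous_on (cball y r) (\<lambda>x. max 0 (f x - f xb))"
        by (intro continuous_intros contf)
      show "(\<lambda>x. max 0 (f x - f xb)) ` cball y r \<subseteq> {0..v}"
      proof clarify
        fix x assume "x \<in> cball y r"
        then have "f x - f xb < v" using sub by (intro less) auto
        then show "max 0 (f x - f xb) \<in> {0..v}" using v by auto
      qed
    qed
    then have "continuous_on (cball y r) h"
      unfolding h_def by (intro continuous_intros) simp_all
    then obtain p where p: "p \<in> cball y r" "\<And>x. x \<in> cball y r \<Longrightarrow> h x \<le> h p"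
      using continuous_attains_sup[of "cball y r" h] r by auto
    have y_dom: "f y - f xb \<in> dom"
      using less[of y] y r by (intro dom_down[OF v]) (auto simp: dist_commute)
    have "0 < h y" using pos[OF y_dom] y by (simp add: h_def max_def)
    also have "h y \<le> h p" using p r by simp
    finally have hp: "0 < h p" .
    then have p_gt: "f xb < f p"
      by (rule contrapos_pp) (simp add: h_def max_def)
    have p_less: "f p - f xb < v" using sub p(1) by (intro less) auto
    have p_dom: "f p - f xb \<in> dom"
      by (rule dom_down[OF v]) (use p_gt p_less in auto)
    have "\<phi> (f p - f xb) < \<phi> v" using v p_gt p_less by (intro strict_mono) auto
    then have dist_p: "dist p y < r" using hp p_gt by (simp add: h_def r_def max_def)
    let ?g = "gradient f p"
    have "norm (p - xb) \<le> 4 * \<phi> v"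
      using subsetD[OF sub p(1)] by (simp add: r_def dist_norm norm_minus_commute)
    then have slope: "1 \<le> deriv \<phi> (f p - f xb) * norm ?g"
      using KL p_gt p_dom by auto
    then have g0: "?g \<noteq> 0" by auto
    \<comment> \<open>Along the normalized gradient \<open>\<phi> (f x - f xb)\<close> grows at rate
      at least 1, whereas the penalty \<open>dist x y / 2\<close> grows at rate at most 1/2.\<close>
    define e where "e = sgn ?g"
    have e: "norm e = 1" "e \<bullet> ?g = norm ?g"
      using g0 by (auto simp: e_def norm_sgn sgn_div_norm power2_norm_eq_inner[symmetric] power2_eq_square)
    have D1: "((\<lambda>t. f (p + t *\<^sub>R e)) has_field_derivative norm ?g) (at 0)"
      using GDERIV_along_line[OF C1_GDERIV[OF f], of p e] e by simp
    have D2: "((\<lambda>t. f (p + t *\<^sub>R e) - f xb) has_field_derivative norm ?g) (at 0)"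
      using D1 by (auto intro!: derivative_eq_intros)
    have "(\<phi> has_field_derivative deriv \<phi> (f p - f xb)) (at (f (p + 0 *\<^sub>R e) - f xb))"
      using DERIV[OF p_dom] by simp
    then have "((\<lambda>t. \<phi> (f (p + t *\<^sub>R e) - f xb)) has_field_derivative
        deriv \<phi> (f p - f xb) * norm ?g) (at 0)"
      using D2 by (rule DERIV_chain2)
    then have "((\<lambda>t. \<phi> (f (p + t *\<^sub>R e) - f xb) - t / 2) has_field_derivative
        deriv \<phi> (f p - f xb) * norm ?g - 1 / 2) (at 0)"
      by (auto intro!: derivative_eq_intros)
    then obtain d1 where d1: "d1 > 0" "\<And>t. 0 < t \<Longrightarrow> t < d1 \<Longrightarrow>
        \<phi> (f p - f xb) < \<phi> (f (p + t *\<^sub>R e) - f xb) - t / 2"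
      using DERIV_pos_inc_right[of "\<lambda>t. \<phi> (f (p + t *\<^sub>R e) - f xb) - t / 2" _ 0] slope by force
    obtain d2 where d2: "d2 > 0" "\<And>t. 0 < t \<Longrightarrow> t < d2 \<Longrightarrow> f p < f (p + t *\<^sub>R e)"
      using DERIV_pos_inc_right[OF D1] g0 by force
    \<comment> \<open>Small enough for three things: \<open>d1\<close> gives the gain over the
      penalty, \<open>d2\<close> keeps \<open>f\<close> above \<open>f xb\<close> so that the
      cut-off is inactive, and the last bound keeps the new point inside the ball.\<close>
    define t where "t = min (min d1 d2) (r - dist p y) / 2"
    have t: "0 < t" "t < d1" "t < d2" "t < r - dist p y"
      using d1 d2 dist_p by (auto simp: t_def)
    have dist_t: "dist (p + t *\<^sub>R e) y \<le> dist p y + t"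
      using norm_triangle_ineq[of "p - y" "t *\<^sub>R e"] e t by (simp add: dist_norm algebra_simps)
    then have "h (p + t *\<^sub>R e) \<le> h p"
      using t by (intro p) (simp add: dist_commute)
    moreover have "h p < h (p + t *\<^sub>R e)"
      using d1(2)[OF t(1,2)] d2(2)[OF t(1,3)] p_gt dist_t by (simp add: h_def max_def)
    ultimately show False by simp
  qed
  then obtain q where q: "q \<in> cball xb (2 * r)" "v \<le> f q - f xb" by blast
  have "connected (f ` cball xb (2 * r))"
    by (intro connected_continuous_image contf) simp
  moreover have "f xb \<in> f ` cball xb (2 * r)" using r by (intro imageI) simp
  moreover have "f q \<in> f ` cball xb (2 * r)" using q by (intro imageI)
  \<comment> \<open>A point at level at least \<open>v\<close> suffices: the ball is connected and
    its centre has level 0.\<close>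
  ultimately have "f xb + v \<in> f ` cball xb (2 * r)"
    by (rule connectedD_interval) (use q v in auto)
  then obtain x where x: "f x = f xb + v" "dist xb x \<le> 2 * r" by (auto elim!: imageE)
  then show ?thesis
    by (intro exI[of _ x]) (simp add: r_def dist_norm norm_minus_commute)
qed

text \<open>A Lipschitz gradient is at most \<^term>\<open>4 * L * \<phi> v\<close> at the level point above, so that
  \<^term>\<open>(deriv \<phi> v)\<^sup>2\<close> dominates the derivative of \<^term>\<open>ln (\<phi> v) / (4 * L)\<close>.\<close>

lemma not_integrable_of_not_local_maximizer:
  fixes f :: "'a::euclidean_space \<Rightarrow> real"
  assumes f: "C1 f" "locally_Lipschitz (gradient f)" "critical_point f xb" "\<not> local_maximizer f xb"
    and \<delta>: "0 < \<delta>" and KL: "\<And>x. ereal (norm (x - xb)) < \<delta> \<Longrightarrow> 0 < f x - f xb \<Longrightarrow>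
      ereal (f x - f xb) < \<eta> \<Longrightarrow> 1 \<le> deriv \<phi> (f x - f xb) * norm (gradient f x)"
  shows "\<not> integrable_near_0 \<eta> (\<lambda>t. 1 / KL_phi \<phi> t)"
proof
  assume "integrable_near_0 \<eta> (\<lambda>t. 1 / KL_phi \<phi> t)"
  then obtain \<tau>0 where \<tau>0: "0 < \<tau>0" "ereal \<tau>0 < \<eta>"
    "set_integrable lborel {0<..\<tau>0} (\<lambda>t. (deriv \<phi> t)\<^sup>2)"
    unfolding integrable_near_0_inverse_KL_phi_iff by blast
  obtain r L0 where r: "0 < r" and L0: "L0-lipschitz_on (ball xb r) (gradient f)"
    using f(2) unfolding locally_Lipschitz_def by blast
  obtain \<delta>' where \<delta>': "0 < ereal \<delta>'" "ereal \<delta>' < \<delta>" using ereal_dense2[OF \<delta>] by blast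
  define L where "L = max L0 1"
  have L: "0 < L" "L0 \<le> L" by (auto simp: L_def)
  \<comment> \<open>Within this distance of \<open>xb\<close> both the Lipschitz bound and the KL
    inequality are available; \<open>\<phi> v < \<rho> / 4\<close> places the level point
    there.\<close>
  define \<rho> where "\<rho> = min r \<delta>'"
  have "0 < \<rho>" using r \<delta>' by (simp add: \<rho>_def)
  then have "eventually (\<lambda>v. \<phi> v < \<rho> / 4) (at_right 0)"
    using order_tendstoD(2)[OF tendsto_0, of "\<rho> / 4"] by simp
  then obtain b where b: "0 < b" "\<And>v. 0 < v \<Longrightarrow> v < b \<Longrightarrow> \<phi> v < \<rho> / 4"
    unfolding eventually_at_right_field by auto
  define \<tau> where "\<tau> = min \<tau>0 (b / 2)"
  have \<tau>: "0 < \<tau>" "\<tau> < b" "\<tau> \<le> \<tau>0" using \<tau>0 b by (auto simp: \<tau>_def)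
  have "\<tau>0 \<in> dom" using \<tau>0 by simp
  then have dom: "t \<in> dom" if "0 < t" "t \<le> \<tau>" for t
    by (rule dom_down) (use that \<tau> in auto)
  have key: "1 \<le> deriv \<phi> v * (4 * L * \<phi> v)" if v: "0 < v" "v \<le> \<tau>" for v
  proof -
    have small: "4 * \<phi> v < \<rho>" using b(2)[of v] v \<tau> by simp
    have KL': "1 \<le> deriv \<phi> (f x - f xb) * norm (gradient f x)"
      if "norm (x - xb) \<le> 4 * \<phi> v" "0 < f x - f xb" "ereal (f x - f xb) < \<eta>" for x
    proof (rule KL[OF _ that(2,3)])
      have "ereal (norm (x - xb)) < ereal \<delta>'" using that(1) small by (simp add: \<rho>_def)
      then show "ereal (norm (x - xb)) < \<delta>" using \<delta>'(2) by (rule less_trans)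
    qed
    obtain x where x: "norm (x - xb) \<le> 4 * \<phi> v" "f x - f xb = v"
      using exists_nearby_level_point[OF f(1,4) dom[OF v] KL'] by blast
    have "dist (gradient f x) (gradient f xb) \<le> L0 * dist x xb"
      using x small r by (intro lipschitz_onD[OF L0]) (auto simp: \<rho>_def dist_norm norm_minus_commute)
    also have "\<dots> \<le> L * (4 * \<phi> v)"
      using x L by (intro mult_mono) (auto simp: dist_norm)
    finally have "norm (gradient f x) \<le> 4 * L * \<phi> v"
      using f(3) by (simp add: critical_point_def)
    then have "deriv \<phi> v * norm (gradient f x) \<le> deriv \<phi> v * (4 * L * \<phi> v)"
      using deriv_pos[of v] dom[OF v] by (intro mult_left_mono) auto
    moreover have "1 \<le> deriv \<phi> v * norm (gradient f x)"
      using KL'[of x] x dom[OF v] v by auto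
    ultimately show ?thesis by simp
  qed
  have "\<exists>C. \<forall>t. 0 < t \<and> t \<le> \<tau> \<longrightarrow> ln (\<phi> \<tau>) / (4 * L) - ln (\<phi> t) / (4 * L) \<le> C"
  proof (rule increments_bounded_of_integrable[where G = "\<lambda>t. ln (\<phi> t) / (4 * L)"
        and G' = "\<lambda>t. deriv \<phi> t / \<phi> t / (4 * L)" and h = "\<lambda>t. (deriv \<phi> t)\<^sup>2"])
    show "set_integrable lborel {0<..\<tau>} (\<lambda>t. (deriv \<phi> t)\<^sup>2)"
      by (rule set_integrable_subset[OF \<tau>0(3)]) (use \<tau> in auto)
    fix t assume t: "0 < t" "t \<le> \<tau>"
    note t_dom = dom[OF t]
    show "((\<lambda>t. ln (\<phi> t) / (4 * L)) has_field_derivative deriv \<phi> t / \<phi> t / (4 * L)) (at t)"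
      using DERIV_cdivide[OF DERIV_chain2[OF DERIV_ln_divide[OF pos[OF t_dom]] DERIV[OF t_dom]], of "4 * L"]
      by simp
    have "deriv \<phi> t * 1 \<le> deriv \<phi> t * (deriv \<phi> t * (4 * L * \<phi> t))"
      using key[OF t] deriv_pos[of t] t_dom by (intro mult_left_mono) auto
    then show "deriv \<phi> t / \<phi> t / (4 * L) \<le> (deriv \<phi> t)\<^sup>2"
      using pos[OF t_dom] L by (simp add: divide_le_eq power2_eq_square mult_ac)
  qed simp
  then obtain C where C: "\<And>t. 0 < t \<Longrightarrow> t \<le> \<tau> \<Longrightarrow> ln (\<phi> \<tau>) / (4 * L) - ln (\<phi> t) / (4 * L) \<le> C"
    by blast
  \<comment> \<open>Where \<open>\<phi> t < m\<close>, \<open>ln (\<phi> t)\<close> is at least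
    \<open>4 * L * (C + 1)\<close> below \<open>ln (\<phi> \<tau>)\<close>, more than
    \<open>C\<close> permits. Such \<open>t\<close> exist because \<open>\<phi>\<close> tends to
    0.\<close>
  define m where "m = exp (ln (\<phi> \<tau>) - 4 * L * (C + 1))"
  have "eventually (\<lambda>v. \<phi> v < m) (at_right 0)"
    using order_tendstoD(2)[OF tendsto_0, of m] by (simp add: m_def)
  moreover have "eventually (\<lambda>t. t \<in> {0<..<\<tau>}) (at_right 0)"
    by (rule eventually_at_right_real) (rule \<tau>)
  ultimately have "eventually (\<lambda>t. False) (at_right (0::real))"
  proof eventually_elim
    case (elim t)
    then have t: "0 < t" "t \<le> \<tau>" by auto
    have "ln (\<phi> t) \<le> ln m"
      using elim pos[OF dom[OF t]] by (intro ln_mono) auto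
    then have "ln (\<phi> t) \<le> ln (\<phi> \<tau>) - 4 * L * (C + 1)" by (simp add: m_def)
    moreover have "ln (\<phi> \<tau>) - ln (\<phi> t) \<le> 4 * L * C"
      using C[OF t] L by (simp add: field_simps)
    ultimately have "4 * L * (C + 1) \<le> 4 * L * C" by linarith
    then show ?case using L by simp
  qed
  then show False by simp
qed

end

section \<open>Positive semidefinite matrices and the Loewner order\<close>

lemma psd_inner_commute:
  assumes "psd B"
  shows "u \<bullet> (B *v w) = (B *v u) \<bullet> w"
  using assms unfolding psd_def by (metis dot_lmul_matrix inner_commute vector_transpose_matrix)

lemma transpose_diff: "transpose (A - B) = transpose A - transpose (B :: real ^ 'n ^ 'm)"
  by (simp add: transpose_def vec_eq_iff)

lemma loewner_le_mat_iff:
  "psd B \<Longrightarrow> B \<preceq> M *\<^sub>R mat 1 \<longleftrightarrow> (\<forall>u. u \<bullet> (B *v u) \<le> M * (u \<bullet> u))"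
  by (auto simp: loewner_le_def psd_def transpose_diff transpose_scalar
      matrix_vector_mult_diff_rdistrib scaleR_matrix_vector_assoc[symmetric] inner_diff_right)

lemma mat_loewner_le_D:
  "M *\<^sub>R mat 1 \<preceq> B \<Longrightarrow> M * (u \<bullet> u) \<le> u \<bullet> (B *v u)"
  by (auto simp: loewner_le_def psd_def
      matrix_vector_mult_diff_rdistrib scaleR_matrix_vector_assoc[symmetric] inner_diff_right)

text \<open>The first bound is \<open>B\<^sup>2 \<preceq> M B\<close>, obtained without
  diagonalization: test the form of \<open>B\<close> at \<open>M u - B u\<close> and bound the term
  cubic in \<open>B\<close> by \<open>B \<preceq> M I\<close>. Cauchy-Schwarz then gives the
  operator norm bound.\<close>

lemma norm_psd_mult_le:
  assumes "psd B" "B \<preceq> M *\<^sub>R mat 1" "0 < M"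
  shows "(norm (B *v u))\<^sup>2 \<le> M * (u \<bullet> (B *v u))" "norm (B *v u) \<le> M * norm u"
proof -
  let ?b = "B *v u"
  have *: "w \<bullet> (B *v w) \<le> M * (w \<bullet> w)" for w using assms loewner_le_mat_iff by blast
  have "0 \<le> (M *\<^sub>R u - ?b) \<bullet> (B *v (M *\<^sub>R u - ?b))"
    using assms(1) unfolding psd_def by blast
  also have "\<dots> = M\<^sup>2 * (u \<bullet> ?b) - 2 * M * (?b \<bullet> ?b) + ?b \<bullet> (B *v ?b)"
    using psd_inner_commute[OF assms(1), of u ?b]
    by (simp add: matrix_vector_mult_diff_distrib inner_diff_left inner_diff_right
        matrix_vector_mult_scaleR algebra_simps power2_eq_square inner_commute)
  also have "\<dots> \<le> M\<^sup>2 * (u \<bullet> ?b) - 2 * M * (?b \<bullet> ?b) + M * (?b \<bullet> ?b)"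
    using *[of ?b] by simp
  finally have "M * (?b \<bullet> ?b) \<le> M * (M * (u \<bullet> ?b))"
    by (simp add: power2_eq_square algebra_simps)
  then show b: "(norm ?b)\<^sup>2 \<le> M * (u \<bullet> ?b)"
    using assms(3) by (simp add: power2_norm_eq_inner)
  also have "\<dots> \<le> M * (norm u * norm ?b)"
    using assms(3) by (intro mult_left_mono norm_cauchy_schwarz) auto
  finally have "norm ?b * norm ?b \<le> (M * norm u) * norm ?b"
    by (simp add: power2_eq_square mult_ac)
  then show "norm ?b \<le> M * norm u"
    using assms(3) by (cases "norm ?b = 0") (auto simp: mult_le_cancel_right)
qed

section \<open>Convergence of a single path\<close>

lemma coercive_compact_sublevel:
  fixes f :: "'a::euclidean_space \<Rightarrow> real"
  assumes "coercive f" "continuous_on UNIV f"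
  shows "compact {y. f y \<le> a}"
proof -
  have "eventually (\<lambda>y. a + 1 \<le> f y) at_infinity"
    using assms(1) unfolding coercive_def filterlim_at_top by blast
  then obtain b where b: "\<And>y. b \<le> norm y \<Longrightarrow> a + 1 \<le> f y"
    unfolding eventually_at_infinity by blast
  have "norm y \<le> b" if "f y \<le> a" for y using b[of y] that by linarith
  then have "bounded {y. f y \<le> a}" unfolding bounded_iff by blast
  moreover have "closed {y. f y \<le> a}"
    using assms(2) by (intro closed_Collect_le) auto
  ultimately show ?thesis by (simp add: compact_eq_bounded_closed)
qed

lemma coercive_bounded_below:
  fixes f :: "'a::euclidean_space \<Rightarrow> real"
  assumes "coercive f" "continuous_on UNIV f"
  shows "\<exists>a. \<forall>y. a \<le> f y"
proof -
  have "continuous_on {y. f y \<le> f 0} f" using assms(2) by (rule continuous_on_subset) simp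
  then obtain p where p: "f p \<le> f 0" "\<And>y. f y \<le> f 0 \<Longrightarrow> f p \<le> f y"
    using continuous_attains_inf[OF coercive_compact_sublevel[OF assms], of "f 0"] by auto
  have "f p \<le> f y" for y using p(2)[of y] p(1) by linarith
  then show ?thesis by blast
qed

text \<open>One realization on which the bounds hold for all \<open>B k\<close> at once; everything
  derived here is deterministic.\<close>

locale GRSD_path =
  fixes f :: "real ^ 'd \<Rightarrow> real" and B :: "nat \<Rightarrow> real ^ 'd ^ 'd" and x :: "nat \<Rightarrow> real ^ 'd"
    and \<alpha> z :: "nat \<Rightarrow> real" and \<alpha>bar M c1 c2 :: real
  assumes f_C1: "C1 f" and f_coercive: "coercive f"
    and x_Suc: "\<And>k. x (Suc k) = x k - \<alpha> k *\<^sub>R (B k *v gradient f (x k))"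
    and alpha_pos: "\<And>k. 0 < \<alpha> k" and alpha_le: "\<And>k. \<alpha> k \<le> \<alpha>bar" and alphabar: "\<alpha>bar < 2"
    and smooth: "\<And>k. upper_one_smooth_along f (B k)"
    and B_psd: "\<And>k. psd (B k)" and B_le: "\<And>k. B k \<preceq> M *\<^sub>R mat 1" and M_pos: "0 < M"
    and c1_eq: "c1 = (1 - \<alpha>bar / 2) / M" and c2_pos: "0 < c2"
    and z_eq: "\<And>k. z k = (if gradient f (x k) \<noteq> 0
       then (norm (x (Suc k) - x k))\<^sup>2 / ((\<alpha> k)\<^sup>2 * (norm (gradient f (x k)))\<^sup>2)
       else c2)"
begin

abbreviation g :: "nat \<Rightarrow> real ^ 'd" where "g k \<equiv> gradient f (x k)"

lemma c1_pos: "0 < c1"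
  using alphabar M_pos by (simp add: c1_eq)

lemma norm_step: "norm (x (Suc k) - x k) = \<alpha> k * norm (B k *v g k)"
  using alpha_pos[of k] by (simp add: x_Suc)

lemma z_mult: "z k * (norm (g k))\<^sup>2 = (norm (B k *v g k))\<^sup>2"
  using alpha_pos[of k] by (auto simp: z_eq norm_step power_mult_distrib)

lemma z_nonneg: "0 \<le> z k"
  using c2_pos by (simp add: z_eq)

text \<open>Smoothness with \<open>u = - \<alpha> k * g k\<close> gives a decrease of
  \<open>(1 - \<alpha> k / 2) * \<alpha> k * ?q\<close>, where \<open>?q\<close> is the form of
  \<open>B k\<close> at the gradient. Passing from \<open>?q\<close> to the squared norm costs the
  factor \<open>M\<close> in the denominator of \<open>c1\<close>.\<close>

lemma descent_norm: "c1 * \<alpha> k * (norm (B k *v g k))\<^sup>2 \<le> f (x k) - f (x (Suc k))"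
proof -
  let ?q = "g k \<bullet> (B k *v g k)"
  have q: "(norm (B k *v g k))\<^sup>2 \<le> M * ?q"
    using norm_psd_mult_le(1)[OF B_psd B_le M_pos] .
  have "c1 * \<alpha> k * (norm (B k *v g k))\<^sup>2 \<le> c1 * \<alpha> k * (M * ?q)"
    using c1_pos alpha_pos[of k] by (intro mult_left_mono q) auto
  also have "\<dots> = (1 - \<alpha>bar / 2) * (\<alpha> k * ?q)"
    using M_pos by (simp add: c1_eq)
  also have "\<dots> \<le> (1 - \<alpha> k / 2) * (\<alpha> k * ?q)"
    using alpha_le[of k] alpha_pos[of k] B_psd[of k]
    by (intro mult_right_mono mult_nonneg_nonneg) (auto simp: psd_def)
  also have "\<dots> \<le> f (x k) - f (x (Suc k))"
  proof -
    have "f (x k + B k *v (- \<alpha> k *\<^sub>R g k)) \<le> f (x k) + g k \<bullet> (B k *v (- \<alpha> k *\<^sub>R g k)) +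
        1 / 2 * ((- \<alpha> k *\<^sub>R g k) \<bullet> (B k *v (- \<alpha> k *\<^sub>R g k)))"
      using smooth[of k] unfolding upper_one_smooth_along_def by blast
    also have "x k + B k *v (- \<alpha> k *\<^sub>R g k) = x (Suc k)"
      unfolding matrix_vector_mult_scaleR by (simp add: x_Suc)
    finally show ?thesis
      unfolding matrix_vector_mult_scaleR
      by (simp only: inner_scaleR_left inner_scaleR_right) (simp add: algebra_simps)
  qed
  finally show ?thesis .
qed

lemma descent: "c1 * \<alpha> k * z k * (norm (g k))\<^sup>2 \<le> f (x k) - f (x (Suc k))"
  using descent_norm[of k] by (simp add: z_mult mult.assoc)

lemma step_descent: "c1 * (norm (x (Suc k) - x k))\<^sup>2 \<le> \<alpha> k * (f (x k) - f (x (Suc k)))"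
proof -
  have "c1 * (norm (x (Suc k) - x k))\<^sup>2 = \<alpha> k * (c1 * \<alpha> k * (norm (B k *v g k))\<^sup>2)"
    by (simp add: norm_step power2_eq_square)
  also have "\<dots> \<le> \<alpha> k * (f (x k) - f (x (Suc k)))"
    using alpha_pos[of k] descent_norm by (intro mult_left_mono) auto
  finally show ?thesis .
qed

lemma f_Suc_le: "f (x (Suc k)) \<le> f (x k)"
proof -
  have "0 \<le> c1 * \<alpha> k * (norm (B k *v g k))\<^sup>2"
    using c1_pos alpha_pos[of k] by simp
  then show ?thesis using descent_norm[of k] by linarith
qed

lemma f_antimono: "decseq (\<lambda>k. f (x k))"
  using f_Suc_le by (rule decseq_SucI)

abbreviation sublevel :: "(real ^ 'd) set" where "sublevel \<equiv> {y. f y \<le> f (x 0)}"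

lemma compact_sublevel: "compact sublevel"
  using f_coercive C1_continuous_on[OF f_C1] by (rule coercive_compact_sublevel)

lemma x_sublevel: "x k \<in> sublevel"
  using decseqD[OF f_antimono, of 0 k] by simp

lemma f_convergent: "(\<lambda>k. f (x k)) \<longlonglongrightarrow> lim (\<lambda>k. f (x k))"
proof -
  obtain a where "\<And>y. a \<le> f y" using coercive_bounded_below[OF f_coercive C1_continuous_on[OF f_C1]] by blast
  then obtain L where "(\<lambda>k. f (x k)) \<longlonglongrightarrow> L"
    using decseq_convergent[OF f_antimono, of a] by blast
  then show ?thesis by (simp add: limI)
qed

definition finf :: real where "finf = lim (\<lambda>k. f (x k))"

lemma finf: "(\<lambda>k. f (x k)) \<longlonglongrightarrow> finf"
  unfolding finf_def by (rule f_convergent)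

lemma finf_le: "finf \<le> f (x k)"
  using decseq_ge[OF f_antimono finf] .

text \<open>On the limiting level no decrease is left, and the squared step length is bounded by a
  multiple of the decrease.\<close>

lemma eventually_const:
  assumes "f (x k) = finf" "j \<ge> k"
  shows "x j = x k"
  using assms(2)
proof (induction j rule: dec_induct)
  case (step j)
  have "f (x j) = finf"
    using finf_le[of j] decseqD[OF f_antimono \<open>k \<le> j\<close>] assms(1) by simp
  then have "c1 * (norm (x (Suc j) - x j))\<^sup>2 \<le> \<alpha> j * 0"
    using finf_le[of "Suc j"] step_descent[of j] f_Suc_le[of j] by simp
  then have "x (Suc j) = x j"
    using c1_pos by (simp add: mult_le_0_iff)
  then show ?case using step.IH by simp
qed simp

end

locale KL_GRSD_path = GRSD_path f B x \<alpha> z \<alpha>bar M c1 c2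
  for f :: "real ^ 'd \<Rightarrow> real" and B :: "nat \<Rightarrow> real ^ 'd ^ 'd" and x :: "nat \<Rightarrow> real ^ 'd"
    and \<alpha> z :: "nat \<Rightarrow> real" and \<alpha>bar M c1 c2 :: real +
  fixes \<phi> :: "real ^ 'd \<Rightarrow> real \<Rightarrow> real" and \<eta> :: "real ^ 'd \<Rightarrow> ereal" and t0 :: "real ^ 'd \<Rightarrow> real"
  assumes alpha_sum: "filterlim (\<lambda>k. \<Sum>i<k. \<alpha> i) at_top sequentially"
    and KL: "\<And>xb. critical_point f xb \<Longrightarrow> KL_desingularization f xb (\<eta> xb) (\<phi> xb)"
    and t0: "\<And>xb. critical_point f xb \<Longrightarrow> 0 < t0 xb \<and> ereal (t0 xb) < \<eta> xb"
    and grad_0: "(\<lambda>k. (norm (gradient f (x k)))\<^sup>2) \<longlonglongrightarrow> 0"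
    and density: "ereal c2 \<le> liminf (\<lambda>k. ereal ((\<Sum>i=1..k. \<alpha> i * z i) / (\<Sum>i=1..k. \<alpha> i)))"
begin

lemma norm_grad_0: "(\<lambda>k. norm (g k)) \<longlonglongrightarrow> 0"
  using tendsto_real_sqrt[OF grad_0] by simp

lemma KL_pathI:
  assumes "desingularizing \<Phi> \<eta>'" "0 < t'" "ereal t' < \<eta>'"
    and "\<And>k. finf < f (x k)"
    and "\<And>k. k \<ge> K \<Longrightarrow> ereal (f (x k) - finf) < \<eta>'"
    and "\<And>k. k \<ge> K \<Longrightarrow> 1 \<le> deriv \<Phi> (f (x k) - finf) * norm (g k)"
  shows "KL_path \<Phi> \<eta>' t' (\<lambda>k. f (x k) - finf) (\<lambda>k. norm (g k)) z
    (\<lambda>k. norm (x (Suc k) - x k)) \<alpha> c1 c2 K"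
proof -
  interpret desingularizing \<Phi> \<eta>' by fact
  have "\<alpha> k \<le> 2" for k using alpha_le[of k] alphabar by simp
  then show ?thesis
    using assms(2-) c1_pos c2_pos alpha_pos alpha_sum z_nonneg descent step_descent density
    by unfold_locales auto
qed

lemma eventually_f_less: "0 < \<eta>' \<Longrightarrow> eventually (\<lambda>k. ereal (f (x k) - finf) < \<eta>') sequentially"
proof -
  assume "0 < \<eta>'"
  then obtain r where r: "0 < r" "ereal r < \<eta>'" by (auto dest: ereal_dense2)
  have "(\<lambda>k. f (x k) - finf) \<longlonglongrightarrow> 0" using finf by (simp add: LIM_zero)
  then have "eventually (\<lambda>k. f (x k) - finf < r) sequentially"
    using r by (intro order_tendstoD)
  then show ?thesis
    by eventually_elim (use r(2) in \<open>auto intro: less_trans[of _ "ereal r"]\<close>)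
qed

text \<open>The critical points on the limiting level form a compact set, which the iterates approach;
  the functions belonging to a finite subcover are added up.\<close>

lemma uniformized_KL:
  assumes "\<And>k. finf < f (x k)"
  shows "\<exists>\<Phi> \<eta>' t' K. KL_path \<Phi> \<eta>' t' (\<lambda>k. f (x k) - finf) (\<lambda>k. norm (g k)) z
    (\<lambda>k. norm (x (Suc k) - x k)) \<alpha> c1 c2 K"
proof -
  define C where "C = {y. f y = finf \<and> gradient f y = 0}"
  have "closed C"
    unfolding C_def
    by (intro closed_Collect_conj closed_Collect_eq C1_continuous_on[OF f_C1]
        C1_continuous_on_gradient[OF f_C1] continuous_on_const)
  moreover have "C \<subseteq> sublevel" using finf_le[of 0] by (auto simp: C_def)
  ultimately have "compact C"
    using compact_sublevel compact_Int_closed[of sublevel C] by (simp add: Int_absorb1)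
  have "\<exists>r>0. \<forall>y. norm (y - p) < r \<and> 0 < f y - finf \<and> ereal (f y - finf) < \<eta> p \<longrightarrow>
      1 \<le> deriv (\<phi> p) (f y - finf) * norm (gradient f y)" if p: "p \<in> C" for p
  proof -
    have crit: "critical_point f p" "f p = finf" using p by (auto simp: C_def critical_point_def)
    then obtain \<delta> where \<delta>: "0 < \<delta>" "\<And>y. ereal (norm (y - p)) < \<delta> \<Longrightarrow> 0 < f y - finf \<Longrightarrow>
        ereal (f y - finf) < \<eta> p \<Longrightarrow> 1 \<le> deriv (\<phi> p) (f y - finf) * norm (gradient f y)"
      using KL[OF crit(1)] unfolding KL_desingularization_iff by auto
    obtain r where r: "0 < ereal r" "ereal r < \<delta>" using ereal_dense2[OF \<delta>(1)] by blast
    have "ereal (norm (y - p)) < \<delta>" if "norm (y - p) < r" for y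
      using that r(2) by (auto intro: less_trans[of _ "ereal r"])
    with \<delta>(2) r(1) show ?thesis by (intro exI[of _ r]) auto
  qed
  then obtain r where r: "\<And>p. p \<in> C \<Longrightarrow> 0 < r p" "\<And>p y. p \<in> C \<Longrightarrow> norm (y - p) < r p \<Longrightarrow>
      0 < f y - finf \<Longrightarrow> ereal (f y - finf) < \<eta> p \<Longrightarrow>
      1 \<le> deriv (\<phi> p) (f y - finf) * norm (gradient f y)"
    by metis
  obtain C' where C': "C' \<subseteq> C" "finite C'" "C \<subseteq> (\<Union>p\<in>C'. ball p (r p))"
    by (rule compactE_image[OF \<open>compact C\<close>, of C "\<lambda>p. ball p (r p)"]) (use r(1) in auto)
  let ?U = "\<Union>p\<in>C'. ball p (r p)"
  \<comment> \<open>Otherwise a subsequence stays in the compact set \<open>sublevel - ?U\<close>; a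
    cluster point of it has level \<open>finf\<close> and zero gradient, hence lies in
    \<open>C\<close>, which \<open>?U\<close> covers.\<close>
  have near: "eventually (\<lambda>k. x k \<in> ?U) sequentially"
  proof (rule ccontr)
    assume "\<not> ?thesis"
    then obtain s :: "nat \<Rightarrow> nat" where s: "strict_mono s" "\<And>n. x (s n) \<notin> ?U"
      using not_eventually_sequentiallyD by blast
    have "compact (sublevel - ?U)" using compact_sublevel by (intro compact_diff open_UN) auto
    moreover have "(x \<circ> s) n \<in> sublevel - ?U" for n using s(2)[of n] x_sublevel[of "s n"] by simp
    ultimately obtain l s' where l: "l \<in> sublevel - ?U" "strict_mono s'" "((x \<circ> s) \<circ> s') \<longlonglongrightarrow> l"
      unfolding compact_def by blast
    have ss: "strict_mono (s \<circ> s')" using s l strict_mono_o by blast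
    have lim: "(\<lambda>n. x ((s \<circ> s') n)) \<longlonglongrightarrow> l" using l(3) by (simp add: o_def)
    have "(\<lambda>n. f (x ((s \<circ> s') n))) \<longlonglongrightarrow> f l"
      by (rule continuous_on_tendsto_compose[OF C1_continuous_on[OF f_C1, of UNIV] lim]) auto
    moreover have "(\<lambda>n. f (x ((s \<circ> s') n))) \<longlonglongrightarrow> finf"
      using LIMSEQ_subseq_LIMSEQ[OF finf ss] by (simp add: o_def)
    ultimately have "f l = finf" by (rule LIMSEQ_unique)
    have "(\<lambda>n. norm (gradient f (x ((s \<circ> s') n)))) \<longlonglongrightarrow> norm (gradient f l)"
      by (intro tendsto_norm continuous_on_tendsto_compose[OF C1_continuous_on_gradient[OF f_C1, of UNIV] lim]) auto
    moreover have "(\<lambda>n. norm (gradient f (x ((s \<circ> s') n)))) \<longlonglongrightarrow> 0"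
      using LIMSEQ_subseq_LIMSEQ[OF norm_grad_0 ss] by (simp add: o_def)
    ultimately have "norm (gradient f l) = 0" by (rule LIMSEQ_unique)
    with \<open>f l = finf\<close> have "l \<in> C" by (simp add: C_def)
    then show False using C' l(1) by auto
  qed
  have "C' \<noteq> {}"
    using eventually_happens[OF near] by auto
  have "desingularizing (\<phi> p) (\<eta> p)" if "p \<in> C'" for p
    using that C'(1) KL unfolding KL_desingularization_iff
    by (auto simp: C_def critical_point_def)
  then obtain \<Phi> \<eta>' where \<Phi>: "desingularizing \<Phi> \<eta>'" "\<And>p. p \<in> C' \<Longrightarrow> \<eta>' \<le> \<eta> p"
    "\<And>p t. p \<in> C' \<Longrightarrow> 0 < t \<Longrightarrow> ereal t < \<eta>' \<Longrightarrow> deriv (\<phi> p) t \<le> deriv \<Phi> t"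
    using desingularizing_uniformize[OF \<open>finite C'\<close> \<open>C' \<noteq> {}\<close>, of \<phi> \<eta>] by blast
  interpret desingularizing \<Phi> \<eta>' by fact
  obtain t' where t': "0 < t'" "ereal t' < \<eta>'" using exists_dom by auto
  obtain K where K: "\<And>k. k \<ge> K \<Longrightarrow> x k \<in> ?U \<and> ereal (f (x k) - finf) < \<eta>'"
    using eventually_conj[OF near eventually_f_less[OF eta_pos]]
    unfolding eventually_sequentially by blast
  have "KL_path \<Phi> \<eta>' t' (\<lambda>k. f (x k) - finf) (\<lambda>k. norm (g k)) z
    (\<lambda>k. norm (x (Suc k) - x k)) \<alpha> c1 c2 K"
  proof (rule KL_pathI[OF \<Phi>(1) t' assms])
    fix k assume "k \<ge> K"
    then obtain p where p: "p \<in> C'" "x k \<in> ball p (r p)" and v: "ereal (f (x k) - finf) < \<eta>'"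
      using K by blast
    then have "p \<in> C" using C' by blast
    show "ereal (f (x k) - finf) < \<eta>'" by fact
    have "1 \<le> deriv (\<phi> p) (f (x k) - finf) * norm (g k)"
      using \<open>p \<in> C\<close> p(2) assms[of k] v \<Phi>(2)[OF p(1)]
      by (intro r(2)) (auto simp: dist_norm norm_minus_commute)
    also have "\<dots> \<le> deriv \<Phi> (f (x k) - finf) * norm (g k)"
      using assms[of k] v by (intro mult_right_mono \<Phi>(3) p) auto
    finally show "1 \<le> deriv \<Phi> (f (x k) - finf) * norm (g k)" .
  qed
  then show ?thesis by blast
qed

text \<open>A path that never reaches the limiting level has finite length by the estimate with the
  uniformized function; one that reaches it is eventually constant.\<close>

lemma x_convergent: "convergent x"
proof (cases "\<exists>k. f (x k) = finf")
  case True
  then obtain k where "f (x k) = finf" by blast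
  then have "eventually (\<lambda>j. x j = x k) sequentially"
    unfolding eventually_sequentially using eventually_const by blast
  then show ?thesis
    using tendsto_eventually convergentI by blast
next
  case False
  then have "finf < f (x k)" for k using finf_le[of k] by (metis order_le_less)
  then obtain \<Phi> \<eta>' t' K where "KL_path \<Phi> \<eta>' t' (\<lambda>k. f (x k) - finf) (\<lambda>k. norm (g k)) z
    (\<lambda>k. norm (x (Suc k) - x k)) \<alpha> c1 c2 K"
    using uniformized_KL by blast
  then interpret K: KL_path \<Phi> \<eta>' t' "\<lambda>k. f (x k) - finf" "\<lambda>k. norm (g k)" z
    "\<lambda>k. norm (x (Suc k) - x k)" \<alpha> c1 c2 K .
  obtain n where n: "\<And>k. k \<ge> n \<Longrightarrow> k \<ge> K \<and> K.c * K.A (Suc k) \<le> K.\<psi> (f (x k) - finf)"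
    using K.eventually_psi_v_ge unfolding eventually_sequentially by blast
  have "summable (\<lambda>k. norm (x (Suc (k + n)) - x (k + n)))"
  proof (rule bounded_imp_summable)
    fix N
    have "(\<Sum>k\<le>N. norm (x (Suc (k + n)) - x (k + n))) = (\<Sum>k=n..<Suc N + n. norm (x (Suc k) - x k))"
      using sum.shift_bounds_nat_ivl[of "\<lambda>k. norm (x (Suc k) - x k)" 0 n "Suc N"]
      by (simp add: lessThan_Suc_atMost flip: lessThan_atLeast0)
    also have "\<dots> \<le> sqrt 2 / (c1 * sqrt c2) * \<Phi> (K.y n)"
      using n by (intro K.sum_d_le) auto
    finally show "(\<Sum>k\<le>N. norm (x (Suc (k + n)) - x (k + n))) \<le> sqrt 2 / (c1 * sqrt c2) * \<Phi> (K.y n)" .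
  qed simp
  then have "summable (\<lambda>k. x (Suc (k + n)) - x (k + n))" by (rule summable_norm_cancel)
  then have "convergent (\<lambda>m. \<Sum>k<m. x (Suc (k + n)) - x (k + n))"
    by (simp add: summable_iff_convergent)
  then have "convergent (\<lambda>m. x (m + n) - x n)"
    using sum_lessThan_telescope[of "\<lambda>k. x (k + n)"] by simp
  then have "convergent (\<lambda>m. (x (m + n) - x n) + x n)" by (intro convergent_add convergent_const)
  then have "convergent (\<lambda>m. x (m + n))" by simp
  then show ?thesis by (simp add: convergent_ignore_initial_segment)
qed

definition xs :: "real ^ 'd" where "xs = lim x"

lemma x_lim: "x \<longlonglongrightarrow> xs"
  using x_convergent by (simp add: xs_def convergent_LIMSEQ_iff)

lemma f_xs: "f xs = finf"
proof -
  have "(\<lambda>n. f (x n)) \<longlonglongrightarrow> f xs"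
    by (rule continuous_on_tendsto_compose[OF C1_continuous_on[OF f_C1, of UNIV] x_lim]) auto
  then show ?thesis using finf by (rule LIMSEQ_unique)
qed

lemma critical_xs: "critical_point f xs"
proof -
  have "(\<lambda>n. norm (g n)) \<longlonglongrightarrow> norm (gradient f xs)"
    by (intro tendsto_norm continuous_on_tendsto_compose[OF C1_continuous_on_gradient[OF f_C1, of UNIV] x_lim]) auto
  then have "norm (gradient f xs) = 0" using norm_grad_0 by (rule LIMSEQ_unique)
  then show ?thesis by (simp add: critical_point_def)
qed

sublocale D: desingularizing_base "\<phi> xs" "\<eta> xs" "t0 xs"
  using KL[OF critical_xs] t0[OF critical_xs]
  by (intro desingularizing_base.intro desingularizing_base_axioms.intro)
    (auto simp: KL_desingularization_iff)

text \<open>Convergence to \<open>xs\<close> brings the iterates into the neighbourhood where the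
  inequality of \<open>xs\<close> itself holds, so the uniformized function can be replaced by
  \<open>\<phi> xs\<close>, in which the rates are stated.\<close>

lemma KL_path_xs:
  assumes "\<And>k. finf < f (x k)"
  shows "\<exists>K. KL_path (\<phi> xs) (\<eta> xs) (t0 xs) (\<lambda>k. f (x k) - finf) (\<lambda>k. norm (g k)) z
    (\<lambda>k. norm (x (Suc k) - x k)) \<alpha> c1 c2 K"
proof -
  obtain \<delta> where \<delta>: "0 < \<delta>" "\<And>y. ereal (norm (y - xs)) < \<delta> \<Longrightarrow> 0 < f y - finf \<Longrightarrow>
      ereal (f y - finf) < \<eta> xs \<Longrightarrow> 1 \<le> deriv (\<phi> xs) (f y - finf) * norm (gradient f y)"
    using KL[OF critical_xs] unfolding KL_desingularization_iff f_xs by auto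
  obtain r where r: "0 < ereal r" "ereal r < \<delta>" using ereal_dense2[OF \<delta>(1)] by blast
  have "eventually (\<lambda>k. dist (x k) xs < r) sequentially"
    using x_lim r by (intro tendstoD) auto
  from eventually_conj[OF this eventually_f_less[OF D.eta_pos]]
  obtain K where K: "\<And>k. k \<ge> K \<Longrightarrow> dist (x k) xs < r \<and> ereal (f (x k) - finf) < \<eta> xs"
    unfolding eventually_sequentially by blast
  have "KL_path (\<phi> xs) (\<eta> xs) (t0 xs) (\<lambda>k. f (x k) - finf) (\<lambda>k. norm (g k)) z
    (\<lambda>k. norm (x (Suc k) - x k)) \<alpha> c1 c2 K"
  proof (rule KL_pathI[OF D.desingularizing_axioms D.t0_pos D.t0_less assms])
    fix k assume k: "k \<ge> K"
    show *: "ereal (f (x k) - finf) < \<eta> xs" using K k by blast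
    have "ereal (norm (x k - xs)) < ereal r" using K k by (simp add: dist_norm)
    then show "1 \<le> deriv (\<phi> xs) (f (x k) - finf) * norm (g k)"
      using assms[of k] * by (intro \<delta>(2) less_trans[OF _ r(2)]) auto
  qed
  then show ?thesis by blast
qed

lemma terminates:
  assumes "f (x k) = finf" "j \<ge> k"
  shows "x j = xs"
proof -
  have "eventually (\<lambda>i. x i = x k) sequentially"
    unfolding eventually_sequentially using eventually_const[OF assms(1)] by blast
  then have "x \<longlonglongrightarrow> x k" by (rule tendsto_eventually)
  then have "xs = x k" using x_lim LIMSEQ_unique by blast
  then show ?thesis using eventually_const[OF assms] by simp
qed

lemma terminates_of_integrable:
  assumes "integrable_near_0 (\<eta> xs) (\<lambda>t. 1 / KL_phi (\<phi> xs) t)"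
  shows "\<exists>K. \<forall>k\<ge>K. x k = xs"
proof (cases "\<exists>k. f (x k) = finf")
  case True
  then show ?thesis using terminates by blast
next
  case False
  then have "finf < f (x k)" for k using finf_le[of k] by (metis order_le_less)
  then show ?thesis using KL_path_xs KL_path.not_integrable assms by blast
qed

lemma rate_estimates:
  assumes nint: "\<not> integrable_near_0 (\<eta> xs) (\<lambda>t. 1 / KL_phi (\<phi> xs) t)"
    and A: "\<And>k. A k = (\<Sum>i<k. \<alpha> i)"
  shows "KL_rate_estimates f (\<phi> xs) (\<eta> xs) (t0 xs) c1 c2 A x xs"
proof -
  have A_nonneg: "0 \<le> A k" for k
    unfolding A by (intro sum_nonneg less_imp_le[OF alpha_pos])
  have image: "c1 * c2 / 2 * A k \<in> D.\<psi> ` D.dom" for k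
    using c1_pos c2_pos A_nonneg by (intro D.nonneg_in_psi_image[OF nint]) auto
  have "\<exists>K>0. \<forall>k\<ge>K. f (x k) - finf \<le> D.\<psi>_inv (c1 * c2 / 2 * A k) \<and>
      norm (x k - xs) \<le> sqrt 2 / (c1 * sqrt c2) * \<phi> xs (D.\<psi>_inv (c1 * c2 / 2 * A k))"
  proof (cases "\<exists>k. f (x k) = finf")
    \<comment> \<open>After termination both left-hand sides are 0, while the right-hand sides are
      positive because \<open>\<psi>_inv\<close> takes values in the domain.\<close>
    case True
    then obtain K where "\<And>k. k \<ge> K \<Longrightarrow> x k = xs" using terminates by blast
    moreover have "0 < D.\<psi>_inv (c1 * c2 / 2 * A k)" "0 < \<phi> xs (D.\<psi>_inv (c1 * c2 / 2 * A k))" for k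
      using D.psi_inv_dom[OF image] D.pos[OF D.psi_inv_dom[OF image]] by auto
    ultimately show ?thesis
      using c1_pos c2_pos f_xs by (intro exI[of _ "Suc K"]) (auto intro: less_imp_le)
  next
    case False
    then have pos: "finf < f (x k)" for k using finf_le[of k] by (metis order_le_less)
    then obtain K where "KL_path (\<phi> xs) (\<eta> xs) (t0 xs) (\<lambda>k. f (x k) - finf) (\<lambda>k. norm (g k)) z
      (\<lambda>k. norm (x (Suc k) - x k)) \<alpha> c1 c2 K"
      using KL_path_xs by blast
    then interpret K: KL_path "\<phi> xs" "\<eta> xs" "t0 xs" "\<lambda>k. f (x k) - finf" "\<lambda>k. norm (g k)" z
      "\<lambda>k. norm (x (Suc k) - x k)" \<alpha> c1 c2 K .
    have y: "K.y k = D.\<psi>_inv (c1 * c2 / 2 * A k)" for k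
      by (simp add: K.y_def K.c_def K.A_def A)
    obtain n where n: "\<And>k. k \<ge> n \<Longrightarrow> k \<ge> K \<and> K.c * K.A (Suc k) \<le> D.\<psi> (f (x k) - finf)"
      using K.eventually_psi_v_ge unfolding eventually_sequentially by blast
    have "f (x k) - finf \<le> K.y k" if "k \<ge> n" for k
      using K.v_le_y[of k] K.y_Suc_le[of k] n[OF that] by simp
    moreover have "norm (x k - xs) \<le> sqrt 2 / (c1 * sqrt c2) * \<phi> xs (K.y k)" if k: "k \<ge> n" for k
    proof (rule tendsto_upperbound)
      show "(\<lambda>N. norm (x k - x N)) \<longlonglongrightarrow> norm (x k - xs)"
        by (intro tendsto_intros x_lim)
      \<comment> \<open>The path length from \<open>k\<close> to \<open>N\<close> is bounded
        independently of \<open>N\<close>, so the estimate passes to the limit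
        \<open>N \<longlonglongrightarrow> \<infinity>\<close>.\<close>
      have "norm (x k - x N) \<le> sqrt 2 / (c1 * sqrt c2) * \<phi> xs (K.y k)" if "N \<ge> k" for N
      proof -
        have "norm (x k - x N) = norm (\<Sum>i=k..<N. x (Suc i) - x i)"
          using that by (simp add: sum_Suc_diff' norm_minus_commute)
        also have "\<dots> \<le> (\<Sum>i=k..<N. norm (x (Suc i) - x i))" by (rule norm_sum)
        also have "\<dots> \<le> sqrt 2 / (c1 * sqrt c2) * \<phi> xs (K.y k)"
          using n k by (intro K.sum_d_le) auto
        finally show ?thesis .
      qed
      then show "eventually (\<lambda>N. norm (x k - x N) \<le> sqrt 2 / (c1 * sqrt c2) * \<phi> xs (K.y k)) sequentially"
        by (auto simp: eventually_sequentially)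
    qed simp
    ultimately show ?thesis
      by (intro exI[of _ "Suc n"]) (simp add: y)
  qed
  then show ?thesis
    using image unfolding KL_rate_estimates_def finf_def[symmetric] by auto
qed

text \<open>Values along the path never drop below \<open>finf = f xs\<close>, and close to a local
  maximizer they cannot exceed it; so the limiting level is reached.\<close>

lemma terminates_at_local_maximizer:
  assumes "local_maximizer f xs"
  shows "\<exists>K. \<forall>k\<ge>K. x k = xs"
proof -
  have "eventually (\<lambda>k. f (x k) \<le> f xs) sequentially"
    using assms x_lim unfolding local_maximizer_def filterlim_iff by blast
  then obtain k where "f (x k) \<le> finf"
    unfolding f_xs eventually_sequentially by blast
  then show ?thesis using terminates[of k] finf_le[of k] by force
qed

end

section \<open>Almost sure events\<close>

context GRSD_path
begin

text \<open>Compactness turns local Lipschitz constants into one. The notion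
  \<open>local_lipschitz\<close> concerns time-dependent maps, hence the dummy time set
  \<open>{0}\<close>.\<close>

lemma gradient_lipschitz_sublevel:
  assumes "locally_Lipschitz (gradient f)"
  shows "\<exists>L. L-lipschitz_on sublevel (gradient f)"
proof -
  have "local_lipschitz {0::real} sublevel (\<lambda>_. gradient f)"
  proof (rule local_lipschitzI)
    fix t :: real and y assume "y \<in> sublevel"
    obtain r L where r: "0 < r" "L-lipschitz_on (ball y r) (gradient f)"
      using assms unfolding locally_Lipschitz_def by blast
    have "L-lipschitz_on (cball y (r / 2) \<inter> sublevel) (gradient f)"
      by (rule lipschitz_on_subset[OF r(2)]) (use r(1) in auto)
    then show "\<exists>u>0. \<exists>L. \<forall>t\<in>cball t u \<inter> {0}. L-lipschitz_on (cball y u \<inter> sublevel) (gradient f)"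
      using r(1) by (intro exI[of _ "r / 2"]) auto
  qed
  then obtain L where "\<And>t. t \<in> {0::real} \<Longrightarrow> L-lipschitz_on sublevel (gradient f)"
    by (rule local_lipschitz_compact_implies_lipschitz[OF _ compact_sublevel])
      (auto intro: continuous_on_const)
  then show ?thesis by blast
qed

text \<open>Summability against divergent stepsizes alone gives only a vanishing lower limit. As a
  step has length at most \<open>M * \<alpha> k * norm (g k)\<close>, the Lipschitz gradient bounds
  the increments of \<open>(norm (g k))\<^sup>2\<close> by the same summable terms. So the sequence
  converges, and a positive limit would make the stepsizes summable.\<close>

lemma norm_gradient_tendsto_0:
  assumes lip: "locally_Lipschitz (gradient f)"
    and diverges: "filterlim (\<lambda>k. \<Sum>i<k. \<alpha> i) at_top sequentially"
    and sum: "summable (\<lambda>k. \<alpha> k * (norm (g k))\<^sup>2)"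
  shows "(\<lambda>k. (norm (g k))\<^sup>2) \<longlonglongrightarrow> 0"
proof -
  obtain L where L: "L-lipschitz_on sublevel (gradient f)"
    using gradient_lipschitz_sublevel[OF lip] by blast
  have L0: "0 \<le> L" using L by (rule lipschitz_on_nonneg)
  define u where "u k = (norm (g k))\<^sup>2" for k
  \<comment> \<open>A difference of squares: \<open>L * M\<close> comes from the difference of the
    norms, and \<open>2 + 2 * (L * M)\<close> from their sum, where
    \<open>\<alpha> k \<le> 2\<close> is used.\<close>
  define C where "C = L * M * (2 + 2 * (L * M))"
  have C: "0 \<le> L * M" using L0 M_pos by simp
  have diff: "norm (u (Suc k) - u k) \<le> C * (\<alpha> k * u k)" for k
  proof -
    have "norm (g (Suc k) - g k) \<le> L * norm (x (Suc k) - x k)"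
      using lipschitz_onD[OF L x_sublevel x_sublevel, of "Suc k" k] by (simp add: dist_norm)
    also have "\<dots> = L * \<alpha> k * norm (B k *v g k)" by (simp add: norm_step)
    also have "\<dots> \<le> L * \<alpha> k * (M * norm (g k))"
      using L0 alpha_pos[of k] by (intro mult_left_mono norm_psd_mult_le(2)[OF B_psd B_le M_pos]) auto
    finally have 1: "norm (g (Suc k) - g k) \<le> L * M * \<alpha> k * norm (g k)" by (simp add: mult_ac)
    have "L * M * \<alpha> k * norm (g k) \<le> L * M * 2 * norm (g k)"
      using C alpha_le[of k] alphabar by (intro mult_right_mono mult_left_mono) auto
    then have "norm (g (Suc k)) + norm (g k) \<le> (2 + 2 * (L * M)) * norm (g k)"
      using 1 norm_triangle_ineq2[of "g (Suc k)" "g k"] by (simp add: algebra_simps)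
    moreover have "\<bar>norm (g (Suc k)) - norm (g k)\<bar> \<le> L * M * \<alpha> k * norm (g k)"
      using 1 norm_triangle_ineq3[of "g (Suc k)" "g k"] by linarith
    ultimately have "\<bar>norm (g (Suc k)) - norm (g k)\<bar> * (norm (g (Suc k)) + norm (g k)) \<le>
        (L * M * \<alpha> k * norm (g k)) * ((2 + 2 * (L * M)) * norm (g k))"
      by (intro mult_mono) (auto intro: order_trans[OF abs_ge_zero])
    also have "\<dots> = C * (\<alpha> k * u k)" by (simp add: C_def u_def power2_eq_square)
    also have "\<bar>norm (g (Suc k)) - norm (g k)\<bar> * (norm (g (Suc k)) + norm (g k)) = norm (u (Suc k) - u k)"
      by (simp add: u_def power2_eq_square square_diff_square_factored abs_mult mult.commute)
    finally show ?thesis .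
  qed
  have "summable (\<lambda>k. u (Suc k) - u k)"
    using diff by (rule summable_comparison_test'[where N = 0, rotated])
      (use sum in \<open>auto simp: u_def intro: summable_mult\<close>)
  then have "convergent (\<lambda>n. \<Sum>k<n. u (Suc k) - u k)" by (simp add: summable_iff_convergent)
  then have "convergent (\<lambda>n. (u n - u 0) + u 0)"
    using sum_lessThan_telescope[of u] by (intro convergent_add convergent_const) simp
  then obtain l where l: "u \<longlonglongrightarrow> l" by (auto simp: convergent_def)
  have "l = 0"
  proof (rule ccontr)
    assume "l \<noteq> 0"
    moreover have "0 \<le> l" using LIMSEQ_le_const[OF l, of 0] by (auto simp: u_def)
    ultimately have l_pos: "0 < l" by simp
    have "eventually (\<lambda>k. l / 2 < u k) sequentially"
      using l l_pos by (intro order_tendstoD) auto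
    then have "eventually (\<lambda>k. norm (\<alpha> k) \<le> 2 / l * (\<alpha> k * u k)) sequentially"
    proof eventually_elim
      case (elim k)
      then have "\<alpha> k * (l / 2) \<le> \<alpha> k * u k" using alpha_pos[of k] by simp
      then show ?case using alpha_pos[of k] l_pos by (simp add: field_simps)
    qed
    moreover have "summable (\<lambda>k. 2 / l * (\<alpha> k * u k))"
      using sum by (simp add: u_def summable_mult)
    ultimately have "summable \<alpha>" by (rule summable_comparison_test_ev)
    then have "convergent (\<lambda>n. \<Sum>i<n. \<alpha> i)" by (simp add: summable_iff_convergent)
    then obtain a where "(\<lambda>n. \<Sum>i<n. \<alpha> i) \<longlonglongrightarrow> a" by (auto simp: convergent_def)
    then show False
      using diverges filterlim_at_top_imp_at_infinity not_tendsto_and_filterlim_at_infinity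
      by (metis sequentially_bot)
  qed
  with l show ?thesis unfolding u_def by blast
qed

end

section \<open>Almost sure summability and a weighted law of large numbers\<close>

context prob_space
begin

lemma AE_summable:
  assumes int: "\<And>k. integrable M (X k)" and nonneg: "\<And>k. AE \<omega> in M. 0 \<le> X k \<omega>"
    and sum: "summable (\<lambda>k. expectation (X k))"
  shows "AE \<omega> in M. summable (\<lambda>k. X k \<omega> :: real)"
proof -
  note [measurable] = borel_measurable_integrable[OF int]
  have "(\<integral>\<^sup>+\<omega>. (\<Sum>k. ennreal (X k \<omega>)) \<partial>M) = (\<Sum>k. \<integral>\<^sup>+\<omega>. ennreal (X k \<omega>) \<partial>M)"
    by (intro nn_integral_suminf) simp
  also have "\<dots> = (\<Sum>k. ennreal (expectation (X k)))"
    by (intro suminf_cong nn_integral_eq_integral int nonneg)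
  also have "\<dots> = ennreal (\<Sum>k. expectation (X k))"
    using sum by (intro suminf_ennreal2 integral_nonneg_AE nonneg)
  finally have "(\<integral>\<^sup>+\<omega>. (\<Sum>k. ennreal (X k \<omega>)) \<partial>M) \<noteq> \<infinity>" by simp
  then have "AE \<omega> in M. (\<Sum>k. ennreal (X k \<omega>)) \<noteq> \<infinity>"
    by (intro nn_integral_PInf_AE) simp_all
  moreover have "AE \<omega> in M. \<forall>k. 0 \<le> X k \<omega>" using nonneg by (simp add: AE_all_countable)
  ultimately show ?thesis
    by eventually_elim (auto intro: summable_suminf_not_top)
qed

text \<open>Along the indices at which the total weight first reaches \<^term>\<open>j\<^sup>2\<close> the second moments
  of the averages are summable, and in between the averages move little.\<close>

lemma weighted_SLLN:
  fixes D :: "nat \<Rightarrow> 'a \<Rightarrow> real" and \<alpha> :: "nat \<Rightarrow> real"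
  assumes D_meas: "\<And>k. D k \<in> borel_measurable M"
    and D_bound: "\<And>k. AE \<omega> in M. \<bar>D k \<omega>\<bar> \<le> C"
    and orth: "\<And>i j. i < j \<Longrightarrow> expectation (\<lambda>\<omega>. D i \<omega> * D j \<omega>) = 0"
    and alpha: "\<And>k. 0 < \<alpha> k" "\<And>k. \<alpha> k \<le> a"
    and diverges: "filterlim (\<lambda>n. \<Sum>i<n. \<alpha> i) at_top sequentially"
  shows "AE \<omega> in M. (\<lambda>n. (\<Sum>i<n. \<alpha> i * D i \<omega>) / (\<Sum>i<n. \<alpha> i)) \<longlonglongrightarrow> 0"
proof -
  note [measurable] = D_meas
  define A where "A n = (\<Sum>i<n. \<alpha> i)" for n
  define S where "S n \<omega> = (\<Sum>i<n. \<alpha> i * D i \<omega>)" for n \<omega>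
  have [measurable]: "S n \<in> borel_measurable M" for n unfolding S_def by measurable
  have A_mono: "A m \<le> A n" if "m \<le> n" for m n
    unfolding A_def using that alpha(1) by (intro sum_mono2) (auto intro: less_imp_le)
  have A_nonneg: "0 \<le> A n" for n using A_mono[of 0 n] by (simp add: A_def)
  have "AE \<omega> in M. 0 \<le> C"
    using D_bound[of 0] by eventually_elim linarith
  then have C: "0 \<le> C" by simp
  have a: "0 < a" using alpha[of 0] by linarith
  have bounds: "AE \<omega> in M. \<forall>k. \<bar>D k \<omega>\<bar> \<le> C" using D_bound by (simp add: AE_all_countable)
  have D_prod_bound: "AE \<omega> in M. norm (D i \<omega> * D j \<omega>) \<le> C * C" for i j
    using bounds by eventually_elim (auto simp: abs_mult intro!: mult_mono C)
  have int_DD: "integrable M (\<lambda>\<omega>. D i \<omega> * D j \<omega>)" for i j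
    by (rule integrable_const_bound[OF D_prod_bound]) simp
  have int_SD: "integrable M (\<lambda>\<omega>. S n \<omega> * D m \<omega>)" for n m
  proof -
    have "(\<lambda>\<omega>. S n \<omega> * D m \<omega>) = (\<lambda>\<omega>. \<Sum>i<n. \<alpha> i * (D i \<omega> * D m \<omega>))"
      by (simp add: S_def sum_distrib_right mult.assoc)
    then show ?thesis using int_DD by simp
  qed
  have S_D: "expectation (\<lambda>\<omega>. S n \<omega> * D n \<omega>) = 0" for n
  proof -
    have "expectation (\<lambda>\<omega>. S n \<omega> * D n \<omega>) = expectation (\<lambda>\<omega>. \<Sum>i<n. \<alpha> i * (D i \<omega> * D n \<omega>))"
      by (simp add: S_def sum_distrib_right mult.assoc)
    also have "\<dots> = (\<Sum>i<n. \<alpha> i * expectation (\<lambda>\<omega>. D i \<omega> * D n \<omega>))"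
      using int_DD by (subst Bochner_Integration.integral_sum) auto
    also have "\<dots> = 0" using orth by (intro sum.neutral) simp
    finally show ?thesis .
  qed
  \<comment> \<open>Orthogonality removes the cross term, so each step adds at most
    \<open>(\<alpha> n)\<^sup>2 * C\<^sup>2\<close>, and one factor \<open>\<alpha> n\<close> is
    bounded by \<open>a\<close> to express the total through \<open>A n\<close>.\<close>
  have second_moment: "integrable M (\<lambda>\<omega>. (S n \<omega>)\<^sup>2) \<and> expectation (\<lambda>\<omega>. (S n \<omega>)\<^sup>2) \<le> a * C\<^sup>2 * A n" for n
  proof (induction n)
    case 0
    then show ?case by (simp add: S_def A_def)
  next
    case (Suc n)
    have eq: "(\<lambda>\<omega>. (S (Suc n) \<omega>)\<^sup>2) =
        (\<lambda>\<omega>. (S n \<omega>)\<^sup>2 + 2 * \<alpha> n * (S n \<omega> * D n \<omega>) + (\<alpha> n)\<^sup>2 * (D n \<omega> * D n \<omega>))"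
      by (auto simp: S_def power2_eq_square algebra_simps)
    have "expectation (\<lambda>\<omega>. (S (Suc n) \<omega>)\<^sup>2) = expectation (\<lambda>\<omega>. (S n \<omega>)\<^sup>2) +
        2 * \<alpha> n * expectation (\<lambda>\<omega>. S n \<omega> * D n \<omega>) + (\<alpha> n)\<^sup>2 * expectation (\<lambda>\<omega>. D n \<omega> * D n \<omega>)"
      unfolding eq using Suc int_SD int_DD by simp
    also have "\<dots> \<le> a * C\<^sup>2 * A n + (\<alpha> n)\<^sup>2 * C\<^sup>2"
    proof -
      have "expectation (\<lambda>\<omega>. D n \<omega> * D n \<omega>) \<le> expectation (\<lambda>\<omega>. C * C)"
        using D_prod_bound[of n n] int_DD
        by (intro integral_mono_AE) (auto elim!: eventually_mono simp: abs_mult)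
      then have "(\<alpha> n)\<^sup>2 * expectation (\<lambda>\<omega>. D n \<omega> * D n \<omega>) \<le> (\<alpha> n)\<^sup>2 * C\<^sup>2"
        by (intro mult_left_mono) (auto simp: power2_eq_square prob_space)
      then show ?thesis using Suc S_D by simp
    qed
    also have "\<dots> \<le> a * C\<^sup>2 * A n + a * \<alpha> n * C\<^sup>2"
      using alpha[of n] by (auto simp: power2_eq_square intro!: mult_right_mono)
    also have "\<dots> = a * C\<^sup>2 * A (Suc n)" by (simp add: A_def algebra_simps)
    finally show ?case unfolding eq using Suc int_SD int_DD by auto
  qed
  have "\<exists>n. (real j)\<^sup>2 \<le> A n" for j
    using diverges unfolding filterlim_at_top A_def by (metis eventually_sequentially order_refl)
  define N where "N j = (LEAST n. (real j)\<^sup>2 \<le> A n)" for j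
  have N: "(real j)\<^sup>2 \<le> A (N j)" for j
    unfolding N_def using \<open>\<exists>n. (real j)\<^sup>2 \<le> A n\<close> by (rule LeastI_ex)
  have N_le: "N j \<le> n" if "(real j)\<^sup>2 \<le> A n" for j n
    unfolding N_def using that by (rule Least_le)
  define Y where "Y j \<omega> = (S (N j) \<omega> / A (N j))\<^sup>2" for j \<omega>
  have int_Y: "integrable M (Y j)" for j
    unfolding Y_def power_divide using second_moment by (intro integrable_divide) auto
  have Y_le: "expectation (Y j) \<le> a * C\<^sup>2 * inverse ((real j)\<^sup>2)" for j
  proof (cases "j = 0")
    case True
    \<comment> \<open>At \<open>j = 0\<close> the claimed bound is 0, since
      \<open>inverse 0 = 0\<close>; it holds because \<open>S 0\<close> is an empty sum.\<close>
    have "N 0 = 0" using N_le[of 0 0] A_nonneg[of 0] by simp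
    then have "Y j = (\<lambda>\<omega>. 0)" using True by (simp add: Y_def S_def fun_eq_iff)
    then show ?thesis using a by simp
  next
    case False
    then have pos: "0 < A (N j)" using N[of j] by (smt (verit) of_nat_0_less_iff zero_less_power neq0_conv)
    have "expectation (Y j) = expectation (\<lambda>\<omega>. (S (N j) \<omega>)\<^sup>2) / (A (N j))\<^sup>2"
      unfolding Y_def power_divide by simp
    also have "\<dots> \<le> a * C\<^sup>2 * A (N j) / (A (N j))\<^sup>2"
      using second_moment by (intro divide_right_mono) auto
    also have "\<dots> = a * C\<^sup>2 / A (N j)" using pos by (simp add: power2_eq_square)
    also have "\<dots> \<le> a * C\<^sup>2 / (real j)\<^sup>2"
      using N[of j] False a pos by (intro divide_left_mono) auto
    finally show ?thesis by (simp add: divide_inverse)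
  qed
  have "summable (\<lambda>j. a * C\<^sup>2 * inverse ((real j)\<^sup>2))"
    by (intro summable_mult inverse_power_summable) simp
  then have summable_Y: "summable (\<lambda>j. expectation (Y j))"
  proof (rule summable_comparison_test'[where N = 0])
    fix j
    have "0 \<le> expectation (Y j)" by (intro integral_nonneg_AE) (simp add: Y_def)
    then show "norm (expectation (Y j)) \<le> a * C\<^sup>2 * inverse ((real j)\<^sup>2)" using Y_le[of j] by simp
  qed
  have "AE \<omega> in M. summable (\<lambda>j. Y j \<omega>)"
    by (rule AE_summable[OF int_Y _ summable_Y]) (simp add: Y_def)
  with bounds show ?thesis
  proof eventually_elim
    case (elim \<omega>)
    have "(\<lambda>j. sqrt (Y j \<omega>)) \<longlonglongrightarrow> sqrt 0"
      using elim(2) by (intro tendsto_real_sqrt summable_LIMSEQ_zero)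
    then have Y0: "(\<lambda>j. \<bar>S (N j) \<omega> / A (N j)\<bar>) \<longlonglongrightarrow> 0" by (simp add: Y_def)
    have "(\<lambda>j. C * (((real j + 1)\<^sup>2 - (real j)\<^sup>2) / (real j)\<^sup>2)) \<longlonglongrightarrow> C * 0"
      by (intro tendsto_mult tendsto_const) real_asymp
    with Y0 have h: "(\<lambda>j. \<bar>S (N j) \<omega> / A (N j)\<bar> + C * (((real j + 1)\<^sup>2 - (real j)\<^sup>2) / (real j)\<^sup>2))
        \<longlonglongrightarrow> 0 + C * 0"
      by (rule tendsto_add)
    \<comment> \<open>With \<open>j = J n\<close>, \<open>A n\<close> lies between
      \<open>j\<^sup>2\<close> and \<open>(j + 1)\<^sup>2\<close>. Hence the sum changes after
      \<open>N j\<close> by at most \<open>C * ((j + 1)\<^sup>2 - j\<^sup>2)\<close>, which is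
      negligible against \<open>j\<^sup>2\<close>.\<close>
    define J where "J n = nat \<lfloor>sqrt (A n)\<rfloor>" for n
    have "filterlim (\<lambda>n. nat \<lfloor>sqrt (A n)\<rfloor>) at_top sequentially"
      using diverges unfolding A_def
      by (intro filterlim_compose[OF filterlim_nat_sequentially]
          filterlim_compose[OF filterlim_floor_sequentially] filterlim_compose[OF sqrt_at_top])
    then have J: "filterlim J at_top sequentially" unfolding J_def .
    have "(\<lambda>n. \<bar>S (N (J n)) \<omega> / A (N (J n))\<bar> + C * (((real (J n) + 1)\<^sup>2 - (real (J n))\<^sup>2) / (real (J n))\<^sup>2))
        \<longlonglongrightarrow> 0"
      using filterlim_compose[OF h J] by simp
    moreover have "eventually (\<lambda>n. 1 \<le> A n) sequentially"
      using diverges unfolding A_def filterlim_at_top by blast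
    then have "eventually (\<lambda>n. norm (S n \<omega> / A n) \<le> \<bar>S (N (J n)) \<omega> / A (N (J n))\<bar> +
        C * (((real (J n) + 1)\<^sup>2 - (real (J n))\<^sup>2) / (real (J n))\<^sup>2)) sequentially"
    proof eventually_elim
      case (elim n)
      let ?j = "real (J n)" and ?m = "N (J n)"
      have j: "?j \<le> sqrt (A n)" "sqrt (A n) < ?j + 1" "1 \<le> ?j"
        using elim by (auto simp: J_def le_nat_iff le_floor_iff)
      have "?j\<^sup>2 \<le> (sqrt (A n))\<^sup>2" using j by (intro power_mono) auto
      then have lower: "?j\<^sup>2 \<le> A n" using A_nonneg by simp
      have "(sqrt (A n))\<^sup>2 \<le> (?j + 1)\<^sup>2" using j A_nonneg[of n] by (intro power_mono) auto
      then have upper: "A n \<le> (?j + 1)\<^sup>2" using A_nonneg by simp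
      have m: "?m \<le> n" using N_le lower by blast
      have j2: "1 \<le> ?j\<^sup>2" using j(3) by (simp add: one_le_power)
      have Am: "?j\<^sup>2 \<le> A ?m" "A ?m \<le> A n" using N A_mono m by auto
      have pos: "0 < ?j\<^sup>2" "0 < A ?m" "0 < A n" using Am j2 by linarith+
      have "S n \<omega> = S ?m \<omega> + (\<Sum>i=?m..<n. \<alpha> i * D i \<omega>)"
        unfolding S_def lessThan_atLeast0 using m by (simp add: sum.atLeastLessThan_concat)
      moreover have "\<bar>\<Sum>i=?m..<n. \<alpha> i * D i \<omega>\<bar> \<le> (\<Sum>i=?m..<n. \<alpha> i * C)"
        using alpha(1) \<open>\<forall>k. \<bar>D k \<omega>\<bar> \<le> C\<close>
        by (intro order_trans[OF sum_abs] sum_mono) (auto simp: abs_mult less_imp_le intro!: mult_mono)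
      moreover have "(\<Sum>i=?m..<n. \<alpha> i * C) = C * (A n - A ?m)"
      proof -
        have "A n = A ?m + (\<Sum>i=?m..<n. \<alpha> i)"
          unfolding A_def lessThan_atLeast0 using m by (simp add: sum.atLeastLessThan_concat)
        then show ?thesis by (simp add: sum_distrib_left mult.commute)
      qed
      ultimately have "\<bar>S n \<omega>\<bar> \<le> \<bar>S ?m \<omega>\<bar> + C * (A n - A ?m)" by linarith
      also have "\<dots> \<le> \<bar>S ?m \<omega>\<bar> + C * ((?j + 1)\<^sup>2 - ?j\<^sup>2)"
        using upper Am C by (intro add_left_mono mult_left_mono) auto
      finally have "\<bar>S n \<omega>\<bar> / A n \<le> (\<bar>S ?m \<omega>\<bar> + C * ((?j + 1)\<^sup>2 - ?j\<^sup>2)) / A n"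
        using A_nonneg by (rule divide_right_mono)
      also have "\<dots> = \<bar>S ?m \<omega>\<bar> / A n + C * ((?j + 1)\<^sup>2 - ?j\<^sup>2) / A n" by (rule add_divide_distrib)
      also have "\<dots> \<le> \<bar>S ?m \<omega>\<bar> / A ?m + C * ((?j + 1)\<^sup>2 - ?j\<^sup>2) / ?j\<^sup>2"
        using Am pos lower C upper by (intro add_mono divide_left_mono mult_nonneg_nonneg mult_pos_pos) auto
      finally show ?case using A_nonneg by (simp add: abs_divide)
    qed
    ultimately have "(\<lambda>n. S n \<omega> / A n) \<longlonglongrightarrow> 0"
      by (rule Lim_null_comparison[rotated])
    then show ?case by (simp add: S_def A_def)
  qed
qed

end

section \<open>Measurability of matrix-valued maps\<close>

lemma borel_measurable_vec_nth:
  fixes X :: "'w \<Rightarrow> 'a::{second_countable_topology, real_normed_vector} ^ 'n"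
  shows "X \<in> borel_measurable G \<Longrightarrow> (\<lambda>\<omega>. X \<omega> $ i) \<in> borel_measurable G"
  by (rule borel_measurable_continuous_on[OF continuous_on_component[OF continuous_on_id]])

lemma borel_measurable_matrix_vector_mult:
  fixes X :: "'w \<Rightarrow> real ^ 'n ^ 'm" and u :: "'w \<Rightarrow> real ^ 'n"
  assumes "X \<in> borel_measurable G" "u \<in> borel_measurable G"
  shows "(\<lambda>\<omega>. X \<omega> *v u \<omega>) \<in> borel_measurable G"
  using assms
  by (rule borel_measurable_continuous_Pair)
    (auto simp: matrix_vector_mult_def intro!: continuous_intros)

lemma borel_measurable_matrix_mult:
  fixes X :: "'w \<Rightarrow> real ^ 'n ^ 'm" and Y :: "'w \<Rightarrow> real ^ 'k ^ 'n"
  assumes "X \<in> borel_measurable G" "Y \<in> borel_measurable G"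
  shows "(\<lambda>\<omega>. X \<omega> ** Y \<omega>) \<in> borel_measurable G"
  using assms
  by (rule borel_measurable_continuous_Pair)
    (auto simp: matrix_matrix_mult_def intro!: continuous_intros)

text \<open>Conditional expectations of matrices are taken entrywise, so quadratic forms have to be
  written as sums over pairs of indices.\<close>

lemma inner_matrix_vector_eq_sum:
  fixes A :: "real ^ 'n ^ 'n"
  shows "u \<bullet> (A *v u) = (\<Sum>(i, j)\<in>UNIV. u $ i * u $ j * A $ i $ j)"
  by (simp add: inner_vec_def matrix_vector_mult_def sum_distrib_left sum.cartesian_product
      UNIV_Times_UNIV[symmetric] mult_ac del: UNIV_Times_UNIV)

section \<open>Conditional moments and the probability of the convergence event\<close>

locale GRSD = prob_space P
  for P :: "'w measure" +
  fixes F :: "nat \<Rightarrow> 'w measure"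
    and B :: "nat \<Rightarrow> 'w \<Rightarrow> real ^ 'd ^ 'd"
    and f :: "real ^ 'd \<Rightarrow> real" and x0 :: "real ^ 'd"
    and x :: "nat \<Rightarrow> 'w \<Rightarrow> real ^ 'd"
    and \<alpha> :: "nat \<Rightarrow> real" and \<alpha>bar M c1 c2 :: real
    and z :: "nat \<Rightarrow> 'w \<Rightarrow> real"
  assumes filtr: "filtration (space P) F" "\<And>k. subalgebra P (F k)"
    and B_meas: "\<And>k. B k \<in> borel_measurable (F (Suc k))"
    and B_psd: "\<And>k \<omega>. \<omega> \<in> space P \<Longrightarrow> psd (B k \<omega>)"
    and x_0: "\<And>\<omega>. \<omega> \<in> space P \<Longrightarrow> x 0 \<omega> = x0"
    and x_Suc: "\<And>k \<omega>. \<omega> \<in> space P \<Longrightarrow>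
      x (Suc k) \<omega> = x k \<omega> - \<alpha> k *\<^sub>R (B k \<omega> *v gradient f (x k \<omega>))"
    and f_C1: "C1 f"
    and f_coercive: "coercive f"
    and f_grad_lip: "locally_Lipschitz (gradient f)"
    and step: "\<And>k. 0 < \<alpha> k" "\<And>k. \<alpha> k \<le> \<alpha>bar" "\<alpha>bar < 2"
    and step_sum: "filterlim (\<lambda>k. \<Sum>i<k. \<alpha> i) at_top sequentially"
    and smooth: "\<And>B'. B' \<in> realizations P B \<Longrightarrow> upper_one_smooth_along f B'"
    and consts_pos: "0 < M" "0 < c2"
    and B_bound: "\<And>k. AE \<omega> in P. 0 \<preceq> B k \<omega> \<and> B k \<omega> \<preceq> M *\<^sub>R mat 1"
    and B_cond: "\<And>k. AE \<omega> in P.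
      c2 *\<^sub>R mat 1 \<preceq> matrix_cond_exp P (F k) (\<lambda>\<omega>'. B k \<omega>' ** B k \<omega>') \<omega>"
    and c1_eq: "c1 = (1 - \<alpha>bar / 2) / M"
    and z_eq: "\<And>k \<omega>. z k \<omega> =
      (if gradient f (x k \<omega>) \<noteq> 0
       then (norm (x (Suc k) \<omega> - x k \<omega>))\<^sup>2 / ((\<alpha> k)\<^sup>2 * (norm (gradient f (x k \<omega>)))\<^sup>2)
       else c2)"
begin

abbreviation grad :: "nat \<Rightarrow> 'w \<Rightarrow> real ^ 'd" where "grad k \<omega> \<equiv> gradient f (x k \<omega>)"

text \<open>Each \<open>k\<close> has its own null set of failure; this is the complement of their
  union, on which the pathwise results apply to the whole path.\<close>

definition good :: "'w \<Rightarrow> bool" where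
  "good \<omega> \<longleftrightarrow> \<omega> \<in> space P \<and> (\<forall>k. 0 \<preceq> B k \<omega> \<and> B k \<omega> \<preceq> M *\<^sub>R mat 1)"

lemma AE_good: "AE \<omega> in P. good \<omega>"
proof -
  have "AE \<omega> in P. \<forall>k. 0 \<preceq> B k \<omega> \<and> B k \<omega> \<preceq> M *\<^sub>R mat 1"
    using B_bound by (simp add: AE_all_countable)
  with AE_space show ?thesis unfolding good_def by eventually_elim blast
qed

lemma path: "good \<omega> \<Longrightarrow> GRSD_path f (\<lambda>k. B k \<omega>) (\<lambda>k. x k \<omega>) \<alpha> (\<lambda>k. z k \<omega>) \<alpha>bar M c1 c2"
proof -
  assume good: "good \<omega>"
  then have "B k \<omega> \<in> realizations P B" for k by (auto simp: good_def realizations_def)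
  with good show ?thesis
    using f_C1 f_coercive x_Suc step smooth B_psd consts_pos c1_eq z_eq
    by unfold_locales (auto simp: good_def)
qed

lemma cond_exp: "sigma_finite_subalgebra P (F k)"
  by (rule finite_measure_subalgebra_is_sigma_finite) (unfold_locales, rule filtr)

lemma measurable_F_mono:
  assumes "X \<in> borel_measurable (F i)" "i \<le> j"
  shows "X \<in> borel_measurable (F j)"
proof -
  have "subalgebra (F j) (F i)"
    using filtr assms(2) filtration.sets_F_mono[OF filtr(1)] by (auto simp: subalgebra_def)
  then show ?thesis using assms(1) by (rule measurable_from_subalg)
qed

lemma measurable_F: "X \<in> borel_measurable (F i) \<Longrightarrow> X \<in> borel_measurable P"
  using measurable_from_subalg[OF filtr(2)] .

lemma gradient_measurable: "X \<in> borel_measurable G \<Longrightarrow> (\<lambda>\<omega>. gradient f (X \<omega>)) \<in> borel_measurable G"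
  by (rule borel_measurable_continuous_on[OF C1_continuous_on_gradient[OF f_C1]])

lemma x_meas: "x k \<in> borel_measurable (F k)"
proof (induction k)
  case 0
  have "(\<lambda>\<omega>. x0) \<in> borel_measurable (F 0)" by simp
  then show ?case
    using filtr(2)[of 0] x_0 by (subst measurable_cong[where g = "\<lambda>\<omega>. x0"]) (auto simp: subalgebra_def)
next
  case (Suc k)
  have "x k \<in> borel_measurable (F (Suc k))" using Suc by (rule measurable_F_mono) simp
  then have "(\<lambda>\<omega>. x k \<omega> - \<alpha> k *\<^sub>R (B k \<omega> *v grad k \<omega>)) \<in> borel_measurable (F (Suc k))"
    using B_meas
    by (intro borel_measurable_diff borel_measurable_scaleR borel_measurable_const
        borel_measurable_matrix_vector_mult gradient_measurable)
  then show ?case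
    using filtr(2)[of "Suc k"] x_Suc
    by (subst measurable_cong[where g = "\<lambda>\<omega>. x k \<omega> - \<alpha> k *\<^sub>R (B k \<omega> *v grad k \<omega>)"])
      (auto simp: subalgebra_def)
qed

lemma x_meas_P [measurable]: "x k \<in> borel_measurable P"
  using x_meas by (rule measurable_F)

lemma g_meas [measurable]: "grad k \<in> borel_measurable (F k)" "grad k \<in> borel_measurable P"
  by (intro gradient_measurable x_meas x_meas_P)+

lemma z_meas_Suc [measurable]: "z k \<in> borel_measurable (F (Suc k))"
proof -
  have [measurable]: "x k \<in> borel_measurable (F (Suc k))" "x (Suc k) \<in> borel_measurable (F (Suc k))"
    using x_meas measurable_F_mono[OF x_meas] by auto
  have [measurable]: "grad k \<in> borel_measurable (F (Suc k))"
    by (intro gradient_measurable) measurable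
  show ?thesis unfolding z_eq[abs_def] by measurable
qed

lemma z_meas [measurable]: "z k \<in> borel_measurable P"
  using z_meas_Suc by (rule measurable_F)

text \<open>\<open>M\<^sup>2\<close> bounds \<open>z\<close> where the gradient is nonzero;
  \<open>c2\<close> is the value assigned where it vanishes.\<close>

definition C :: real where "C = max (M\<^sup>2) c2"

lemma z_bounds:
  assumes "good \<omega>"
  shows "0 \<le> z k \<omega>" "z k \<omega> \<le> C"
proof -
  interpret GRSD_path f "\<lambda>k. B k \<omega>" "\<lambda>k. x k \<omega>" \<alpha> "\<lambda>k. z k \<omega>" \<alpha>bar M c1 c2
    using assms by (rule path)
  show "0 \<le> z k \<omega>" by (rule z_nonneg)
  show "z k \<omega> \<le> C"
  proof (cases "grad k \<omega> = 0")
    case True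
    then show ?thesis by (simp add: z_eq C_def)
  next
    case False
    have "(norm (B k \<omega> *v grad k \<omega>))\<^sup>2 \<le> (M * norm (grad k \<omega>))\<^sup>2"
      by (intro power_mono norm_psd_mult_le(2)[OF B_psd B_le M_pos]) simp
    then have "z k \<omega> * (norm (grad k \<omega>))\<^sup>2 \<le> M\<^sup>2 * (norm (grad k \<omega>))\<^sup>2"
      by (simp add: z_mult power_mult_distrib)
    then show ?thesis using False by (simp add: C_def)
  qed
qed

lemma integrable_z: "integrable P (z k)"
  by (rule integrable_const_bound[where B = C])
    (use AE_good in \<open>auto elim!: eventually_mono simp: z_bounds\<close>)

definition Z :: "nat \<Rightarrow> 'w \<Rightarrow> real" where "Z k = real_cond_exp P (F k) (z k)"

lemma Z_meas: "Z k \<in> borel_measurable (F k)"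
  unfolding Z_def by simp

lemma Z_meas_P [measurable]: "Z k \<in> borel_measurable P"
  using Z_meas by (rule measurable_F)

lemma Z_le: "AE \<omega> in P. Z k \<omega> \<le> C"
  unfolding Z_def
  by (rule sigma_finite_subalgebra.real_cond_exp_le_c[OF cond_exp integrable_z])
    (use AE_good in \<open>auto elim!: eventually_mono simp: z_bounds\<close>)

text \<open>The coefficients depend only on \<open>x k\<close>, known at time \<open>k\<close>, and
  the randomness of \<open>B k\<close> enters through the entries of its square, so the coefficients
  can be pulled out of the conditional expectation. Since \<open>sgn 0 = 0\<close>, the last summand
  supplies the value at a vanishing gradient.\<close>

lemma z_eq_quadratic_form:
  assumes "good \<omega>"
  shows "z k \<omega> = (\<Sum>(i, j)\<in>UNIV. (sgn (grad k \<omega>) $ i * sgn (grad k \<omega>) $ j) * (B k \<omega> ** B k \<omega>) $ i $ j) +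
    (if grad k \<omega> = 0 then c2 else 0)"
proof -
  interpret GRSD_path f "\<lambda>k. B k \<omega>" "\<lambda>k. x k \<omega>" \<alpha> "\<lambda>k. z k \<omega>" \<alpha>bar M c1 c2
    using assms by (rule path)
  let ?u = "sgn (grad k \<omega>)"
  have "?u \<bullet> ((B k \<omega> ** B k \<omega>) *v ?u) = (B k \<omega> *v ?u) \<bullet> (B k \<omega> *v ?u)"
    by (simp add: psd_inner_commute[OF B_psd] flip: matrix_vector_mul_assoc)
  also have "\<dots> = (norm (B k \<omega> *v grad k \<omega>))\<^sup>2 / (norm (grad k \<omega>))\<^sup>2"
    by (simp add: sgn_div_norm matrix_vector_mult_scaleR dot_square_norm power2_eq_square
        divide_inverse mult_ac)
  also have "\<dots> + (if grad k \<omega> = 0 then c2 else 0) = z k \<omega>"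
  proof (cases "grad k \<omega> = 0")
    case True
    then show ?thesis by (simp add: z_eq[of k])
  next
    case False
    then show ?thesis by (simp flip: z_mult)
  qed
  finally show ?thesis by (simp add: inner_matrix_vector_eq_sum)
qed

lemma integrable_BB:
  assumes u: "u \<in> borel_measurable P" "\<And>\<omega>. \<bar>u \<omega>\<bar> \<le> 1"
  shows "integrable P (\<lambda>\<omega>. u \<omega> * (B k \<omega> ** B k \<omega>) $ i $ j)"
proof (rule integrable_const_bound[where B = "M\<^sup>2"])
  have [measurable]: "B k \<in> borel_measurable P" using B_meas by (rule measurable_F)
  show "(\<lambda>\<omega>. u \<omega> * (B k \<omega> ** B k \<omega>) $ i $ j) \<in> borel_measurable P"
    by (intro borel_measurable_times u borel_measurable_vec_nth borel_measurable_matrix_mult) measurable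
  show "AE \<omega> in P. norm (u \<omega> * (B k \<omega> ** B k \<omega>) $ i $ j) \<le> M\<^sup>2"
    using AE_good
  proof eventually_elim
    case (elim \<omega>)
    have B: "psd (B k \<omega>)" "B k \<omega> \<preceq> M *\<^sub>R mat 1" using elim B_psd by (auto simp: good_def)
    have "(B k \<omega> ** B k \<omega>) $ i $ j = axis i 1 \<bullet> ((B k \<omega> ** B k \<omega>) *v axis j 1)"
      by (simp add: inner_axis_axis inner_axis' matrix_vector_mul_component column_def
          matrix_vector_mult_basis)
    also have "\<dots> = (B k \<omega> *v axis i 1) \<bullet> (B k \<omega> *v axis j 1)"
      by (simp add: psd_inner_commute[OF B(1)] flip: matrix_vector_mul_assoc)
    finally have "\<bar>(B k \<omega> ** B k \<omega>) $ i $ j\<bar> \<le> norm (B k \<omega> *v axis i 1) * norm (B k \<omega> *v axis j 1)"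
      using Cauchy_Schwarz_ineq2 by simp
    also have "\<dots> \<le> (M * norm (axis i 1 :: real ^ 'd)) * (M * norm (axis j 1 :: real ^ 'd))"
      using consts_pos by (intro mult_mono norm_psd_mult_le(2)[OF B]) auto
    also have "\<dots> = M\<^sup>2" by (simp add: power2_eq_square)
    finally have "\<bar>(B k \<omega> ** B k \<omega>) $ i $ j\<bar> \<le> M\<^sup>2" .
    then have "\<bar>u \<omega>\<bar> * \<bar>(B k \<omega> ** B k \<omega>) $ i $ j\<bar> \<le> 1 * M\<^sup>2"
      using u(2) by (intro mult_mono) auto
    then show ?case by (simp add: abs_mult)
  qed
qed

lemma sgn_g_meas: "(\<lambda>\<omega>. sgn (grad k \<omega>) $ i) \<in> borel_measurable (F k)"
  unfolding sgn_div_norm by (intro borel_measurable_vec_nth) measurable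

text \<open>Conditioning turns the quadratic form of \<open>B k ** B k\<close> at the unit vector
  \<open>sgn (grad k \<omega>)\<close> into that of its conditional expectation, which is at least
  \<open>c2\<close>. If the gradient vanishes, the form is 0 and \<open>r\<close> provides
  \<open>c2\<close>.\<close>

lemma Z_ge: "AE \<omega> in P. c2 \<le> Z k \<omega>"
proof -
  interpret sigma_finite_subalgebra P "F k" by (rule cond_exp)
  define u where "u p \<omega> = sgn (grad k \<omega>) $ fst p * sgn (grad k \<omega>) $ snd p" for p :: "'d \<times> 'd" and \<omega>
  define W where "W p \<omega> = (B k \<omega> ** B k \<omega>) $ fst p $ snd p" for p :: "'d \<times> 'd" and \<omega>
  define r where "r \<omega> = (if grad k \<omega> = 0 then c2 else 0)" for \<omega>
  have u_meas: "u p \<in> borel_measurable (F k)" for p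
    unfolding u_def by (intro borel_measurable_times sgn_g_meas)
  have u_le: "\<bar>u p \<omega>\<bar> \<le> 1" for p \<omega>
  proof -
    have "\<bar>sgn (grad k \<omega>) $ i\<bar> \<le> 1" for i
      using component_le_norm_cart[of "sgn (grad k \<omega>)" i] norm_sgn[of "grad k \<omega>"] by (auto split: if_splits)
    then have "\<bar>sgn (grad k \<omega>) $ fst p\<bar> * \<bar>sgn (grad k \<omega>) $ snd p\<bar> \<le> 1 * 1" by (intro mult_mono) auto
    then show ?thesis by (simp add: u_def abs_mult)
  qed
  have W_meas: "W p \<in> borel_measurable P" for p
    unfolding W_def
    by (intro borel_measurable_vec_nth borel_measurable_matrix_mult measurable_F[OF B_meas])
  have int_uW: "integrable P (\<lambda>\<omega>. u p \<omega> * W p \<omega>)" for p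
    unfolding W_def by (rule integrable_BB[OF measurable_F[OF u_meas] u_le])
  have r_meas: "r \<in> borel_measurable (F k)" unfolding r_def by measurable
  have int_r: "integrable P r"
  proof (rule integrable_const_bound)
    show "AE \<omega> in P. norm (r \<omega>) \<le> c2" using consts_pos by (simp add: r_def)
  qed (rule measurable_F[OF r_meas])
  have "AE \<omega> in P. z k \<omega> = (\<Sum>p\<in>UNIV. u p \<omega> * W p \<omega>) + r \<omega>"
    using AE_good
    by eventually_elim (simp add: z_eq_quadratic_form u_def W_def r_def case_prod_unfold)
  then have "AE \<omega> in P. Z k \<omega> = real_cond_exp P (F k) (\<lambda>\<omega>. (\<Sum>p\<in>UNIV. u p \<omega> * W p \<omega>) + r \<omega>) \<omega>"
    unfolding Z_def
    by (rule real_cond_exp_cong) (use int_uW int_r in \<open>auto intro!: borel_measurable_add borel_measurable_sum\<close>)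
  moreover have "AE \<omega> in P. real_cond_exp P (F k) (\<lambda>\<omega>. (\<Sum>p\<in>UNIV. u p \<omega> * W p \<omega>) + r \<omega>) \<omega> =
      real_cond_exp P (F k) (\<lambda>\<omega>. \<Sum>p\<in>UNIV. u p \<omega> * W p \<omega>) \<omega> + real_cond_exp P (F k) r \<omega>"
    using int_uW int_r by (intro real_cond_exp_add) auto
  moreover have "AE \<omega> in P. real_cond_exp P (F k) r \<omega> = r \<omega>"
    using int_r r_meas by (rule real_cond_exp_F_meas)
  moreover have "AE \<omega> in P. real_cond_exp P (F k) (\<lambda>\<omega>. \<Sum>p\<in>UNIV. u p \<omega> * W p \<omega>) \<omega> =
      (\<Sum>p\<in>UNIV. real_cond_exp P (F k) (\<lambda>\<omega>. u p \<omega> * W p \<omega>) \<omega>)"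
    using int_uW by (rule real_cond_exp_sum)
  moreover have "AE \<omega> in P. \<forall>p\<in>UNIV. real_cond_exp P (F k) (\<lambda>\<omega>. u p \<omega> * W p \<omega>) \<omega> =
      u p \<omega> * real_cond_exp P (F k) (W p) \<omega>"
    using real_cond_exp_mult[OF u_meas W_meas int_uW] by (intro AE_finite_allI) auto
  moreover note B_cond[of k]
  ultimately show ?thesis
  proof eventually_elim
    case (elim \<omega>)
    let ?u = "sgn (grad k \<omega>)" and ?E = "matrix_cond_exp P (F k) (\<lambda>\<omega>'. B k \<omega>' ** B k \<omega>') \<omega>"
    have E: "real_cond_exp P (F k) (W p) \<omega> = ?E $ fst p $ snd p" for p
      by (simp add: matrix_cond_exp_def W_def[abs_def])
    have "c2 * (?u \<bullet> ?u) \<le> ?u \<bullet> (?E *v ?u)" using elim(6) by (rule mat_loewner_le_D)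
    also have "\<dots> = (\<Sum>p\<in>UNIV. u p \<omega> * ?E $ fst p $ snd p)"
      by (simp add: u_def inner_matrix_vector_eq_sum case_prod_unfold)
    also have "\<dots> = (\<Sum>p\<in>UNIV. real_cond_exp P (F k) (\<lambda>\<omega>. u p \<omega> * W p \<omega>) \<omega>)"
      by (intro sum.cong refl) (simp only: E bspec[OF elim(5) UNIV_I])
    also have "\<dots> = Z k \<omega> - r \<omega>" using elim(1-4) by simp
    finally have "c2 * (norm ?u)\<^sup>2 + r \<omega> \<le> Z k \<omega>" by (simp add: power2_norm_eq_inner)
    then show ?case by (auto simp: r_def norm_sgn split: if_splits)
  qed
qed

text \<open>The defining property of the conditional expectation, tested with bounded functions
  known at time \<open>k\<close>. It serves twice: to insert \<open>Z k \<ge> c2\<close> into the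
  expected descent, and to make the differences \<open>z - Z\<close> pairwise orthogonal.\<close>

lemma z_Z_orthogonal:
  assumes h: "h \<in> borel_measurable (F k)" "AE \<omega> in P. \<bar>h \<omega>\<bar> \<le> H"
  shows "integrable P (\<lambda>\<omega>. h \<omega> * z k \<omega>)" "integrable P (\<lambda>\<omega>. h \<omega> * Z k \<omega>)"
    "expectation (\<lambda>\<omega>. h \<omega> * Z k \<omega>) = expectation (\<lambda>\<omega>. h \<omega> * z k \<omega>)"
proof -
  interpret sigma_finite_subalgebra P "F k" by (rule cond_exp)
  note [measurable] = measurable_F[OF h(1)]
  show int: "integrable P (\<lambda>\<omega>. h \<omega> * z k \<omega>)"
  proof (rule integrable_const_bound)
    show "AE \<omega> in P. norm (h \<omega> * z k \<omega>) \<le> H * C"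
      using h(2) AE_good
      by eventually_elim (auto simp: abs_mult z_bounds intro!: mult_mono intro: order_trans[OF abs_ge_zero])
  qed simp
  show "integrable P (\<lambda>\<omega>. h \<omega> * Z k \<omega>)"
    "expectation (\<lambda>\<omega>. h \<omega> * Z k \<omega>) = expectation (\<lambda>\<omega>. h \<omega> * z k \<omega>)"
    unfolding Z_def using real_cond_exp_intg[OF int h(1) z_meas] by auto
qed

lemma AE_summable_gradient: "AE \<omega> in P. summable (\<lambda>k. \<alpha> k * (norm (grad k \<omega>))\<^sup>2)"
proof -
  have compact: "compact {y. f y \<le> f x0}"
    using f_coercive C1_continuous_on[OF f_C1] by (rule coercive_compact_sublevel)
  obtain H where H: "\<And>y. f y \<le> f x0 \<Longrightarrow> norm (gradient f y) \<le> H"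
    using compact_imp_bounded[OF compact_continuous_image[OF C1_continuous_on_gradient[OF f_C1] compact]]
    unfolding bounded_iff by auto
  obtain h where h: "\<And>y. f y \<le> f x0 \<Longrightarrow> \<bar>f y\<bar> \<le> h"
    using compact_imp_bounded[OF compact_continuous_image[OF C1_continuous_on[OF f_C1] compact]]
    unfolding bounded_iff by auto
  obtain l where l: "\<And>y. l \<le> f y"
    using coercive_bounded_below[OF f_coercive C1_continuous_on[OF f_C1]] by blast
  have sub: "f (x k \<omega>) \<le> f x0" if "good \<omega>" for k \<omega>
    using GRSD_path.x_sublevel[OF path[OF that], of k] x_0[of \<omega>] that by (simp add: good_def)
  have [measurable]: "f \<in> borel_measurable borel"
    by (rule borel_measurable_continuous_onI[OF C1_continuous_on[OF f_C1]])
  have int_f: "integrable P (\<lambda>\<omega>. f (x k \<omega>))" for k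
    by (rule integrable_const_bound[where B = h])
      (use AE_good in \<open>auto elim!: eventually_mono simp: sub h\<close>)
  define G where "G k \<omega> = \<alpha> k * (norm (grad k \<omega>))\<^sup>2" for k \<omega>
  have G_meas: "G k \<in> borel_measurable (F k)" for k unfolding G_def by measurable
  have G_nonneg: "0 \<le> G k \<omega>" for k \<omega> using step(1)[of k] by (simp add: G_def)
  have G_bound: "AE \<omega> in P. \<bar>G k \<omega>\<bar> \<le> \<alpha> k * H\<^sup>2" for k
    using AE_good
    by eventually_elim
      (use step(1)[of k] in \<open>auto simp: G_def abs_mult intro!: mult_left_mono power_mono H sub\<close>)
  have int_G: "integrable P (G k)" for k
    by (rule integrable_const_bound[where B = "\<alpha> k * H\<^sup>2"])
      (use G_bound measurable_F[OF G_meas] in auto)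
  have c1: "0 < c1" using step(3) consts_pos by (simp add: c1_eq)
  have G_le: "c1 * c2 * expectation (G k) \<le> expectation (\<lambda>\<omega>. f (x k \<omega>)) - expectation (\<lambda>\<omega>. f (x (Suc k) \<omega>))" for k
  proof -
    note orth = z_Z_orthogonal[OF G_meas G_bound]
    \<comment> \<open>\<open>G k\<close> is known at time \<open>k\<close>, so \<open>z k\<close>
      may be exchanged for \<open>Z k\<close> under the expectation although \<open>z k\<close>
      itself has no positive lower bound.\<close>
    have "c2 * expectation (G k) = expectation (\<lambda>\<omega>. c2 * G k \<omega>)" by simp
    also have "\<dots> \<le> expectation (\<lambda>\<omega>. G k \<omega> * Z k \<omega>)"
    proof (rule integral_mono_AE)
      show "AE \<omega> in P. c2 * G k \<omega> \<le> G k \<omega> * Z k \<omega>"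
        using Z_ge[of k] by eventually_elim (simp add: mult.commute[of c2] mult_left_mono G_nonneg)
    qed (use int_G orth in auto)
    also have "\<dots> = expectation (\<lambda>\<omega>. G k \<omega> * z k \<omega>)" by (rule orth)
    finally have "c1 * c2 * expectation (G k) \<le> c1 * expectation (\<lambda>\<omega>. G k \<omega> * z k \<omega>)"
      using c1 by (simp add: mult.assoc)
    also have "\<dots> = expectation (\<lambda>\<omega>. c1 * (G k \<omega> * z k \<omega>))" by simp
    also have "\<dots> \<le> expectation (\<lambda>\<omega>. f (x k \<omega>) - f (x (Suc k) \<omega>))"
    proof (rule integral_mono_AE)
      show "AE \<omega> in P. c1 * (G k \<omega> * z k \<omega>) \<le> f (x k \<omega>) - f (x (Suc k) \<omega>)"
        using AE_good
      proof eventually_elim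
        case (elim \<omega>)
        then show ?case using GRSD_path.descent[OF path, of \<omega> k] by (simp add: G_def mult_ac)
      qed
    qed (use int_f orth in auto)
    also have "\<dots> = expectation (\<lambda>\<omega>. f (x k \<omega>)) - expectation (\<lambda>\<omega>. f (x (Suc k) \<omega>))"
      using int_f by simp
    finally show ?thesis .
  qed
  have "summable (\<lambda>k. expectation (G k))"
  proof (rule summableI_nonneg_bounded)
    fix n
    show "0 \<le> expectation (G n)" using G_nonneg by (intro integral_nonneg_AE) simp
    have "c1 * c2 * (\<Sum>k<n. expectation (G k)) \<le>
        (\<Sum>k<n. expectation (\<lambda>\<omega>. f (x k \<omega>)) - expectation (\<lambda>\<omega>. f (x (Suc k) \<omega>)))"
      unfolding sum_distrib_left by (intro sum_mono G_le)
    also have "\<dots> = expectation (\<lambda>\<omega>. f (x 0 \<omega>)) - expectation (\<lambda>\<omega>. f (x n \<omega>))"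
      by (rule sum_lessThan_telescope')
    also have "\<dots> \<le> expectation (\<lambda>\<omega>. f (x 0 \<omega>)) - l"
    proof -
      have "expectation (\<lambda>\<omega>. l) \<le> expectation (\<lambda>\<omega>. f (x n \<omega>))"
        using l int_f by (intro integral_mono) auto
      then show ?thesis by (simp add: prob_space)
    qed
    finally show "(\<Sum>k<n. expectation (G k)) \<le> (expectation (\<lambda>\<omega>. f (x 0 \<omega>)) - l) / (c1 * c2)"
      using c1 consts_pos by (simp add: le_divide_eq mult.commute)
  qed
  then have "AE \<omega> in P. summable (\<lambda>k. G k \<omega>)"
    using int_G G_nonneg by (intro AE_summable) auto
  then show ?thesis by (simp add: G_def)
qed

lemma AE_gradient_tendsto_0: "AE \<omega> in P. (\<lambda>k. (norm (grad k \<omega>))\<^sup>2) \<longlonglongrightarrow> 0"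
  using AE_good AE_summable_gradient
  by eventually_elim (rule GRSD_path.norm_gradient_tendsto_0[OF path f_grad_lip step_sum])

text \<open>Split \<open>z = Z + (z - Z)\<close>: the first part is at least \<open>c2\<close>, and
  the weighted averages of the second, bounded and orthogonal, tend to 0.\<close>

lemma AE_density:
  "AE \<omega> in P. ereal c2 \<le> liminf (\<lambda>k. ereal ((\<Sum>i=1..k. \<alpha> i * z i \<omega>) / (\<Sum>i=1..k. \<alpha> i)))"
proof -
  \<comment> \<open>Shifted by one, since the averages in the density condition start at index 1 and
    those in the law of large numbers at 0.\<close>
  define D where "D k \<omega> = z (Suc k) \<omega> - Z (Suc k) \<omega>" for k \<omega>
  have D_meas: "D k \<in> borel_measurable (F (Suc (Suc k)))" for k
    unfolding D_def
    by (intro borel_measurable_diff z_meas_Suc measurable_F_mono[OF Z_meas]) simp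
  have D_bound: "AE \<omega> in P. \<bar>D k \<omega>\<bar> \<le> C" for k
    using AE_good Z_ge[of "Suc k"] Z_le[of "Suc k"]
  proof eventually_elim
    case (elim \<omega>)
    then show ?case using z_bounds[OF elim(1), of "Suc k"] consts_pos by (auto simp: D_def)
  qed
  have orth: "expectation (\<lambda>\<omega>. D i \<omega> * D j \<omega>) = 0" if "i < j" for i j
  proof -
    \<comment> \<open>\<open>z (Suc i)\<close> involves \<open>B (Suc i)\<close>, known only at time
      \<open>i + 2\<close>; for \<open>i < j\<close> this is at most \<open>j + 1\<close>, the time
      at which \<open>Z (Suc j)\<close> conditions.\<close>
    have D_i: "D i \<in> borel_measurable (F (Suc j))"
      using D_meas by (rule measurable_F_mono) (use that in simp)
    show ?thesis
      using z_Z_orthogonal[OF D_i D_bound] unfolding D_def[of j] by (simp add: right_diff_distrib)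
  qed
  have diverges: "filterlim (\<lambda>n. \<Sum>i<n. \<alpha> (Suc i)) at_top sequentially"
  proof -
    have "filterlim (\<lambda>n. (\<Sum>i<Suc n. \<alpha> i)) at_top sequentially"
      by (rule filterlim_compose[OF step_sum filterlim_Suc])
    then have "filterlim (\<lambda>n. - \<alpha> 0 + (\<Sum>i<Suc n. \<alpha> i)) at_top sequentially"
      by (intro filterlim_tendsto_add_at_top[OF tendsto_const])
    then show ?thesis by (simp only: sum.lessThan_Suc_shift) simp
  qed
  have "AE \<omega> in P. (\<lambda>n. (\<Sum>i<n. \<alpha> (Suc i) * D i \<omega>) / (\<Sum>i<n. \<alpha> (Suc i))) \<longlonglongrightarrow> 0"
    by (rule weighted_SLLN[OF measurable_F[OF D_meas] D_bound orth _ _ diverges, where a = \<alpha>bar])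
      (use step in auto)
  moreover have "AE \<omega> in P. \<forall>k. c2 \<le> Z k \<omega>" using Z_ge by (simp add: AE_all_countable)
  ultimately show ?thesis
  proof eventually_elim
    case (elim \<omega>)
    define R where "R n = (\<Sum>i<n. \<alpha> (Suc i) * D i \<omega>) / (\<Sum>i<n. \<alpha> (Suc i))" for n
    have "(\<lambda>n. ereal (c2 + R n)) \<longlonglongrightarrow> ereal (c2 + 0)"
      using elim(1) unfolding R_def by (intro tendsto_ereal tendsto_add tendsto_const)
    from lim_imp_Liminf[OF trivial_limit_sequentially this]
    have "ereal c2 = liminf (\<lambda>n. ereal (c2 + R n))" by simp
    also have "\<dots> \<le> liminf (\<lambda>k. ereal ((\<Sum>i=1..k. \<alpha> i * z i \<omega>) / (\<Sum>i=1..k. \<alpha> i)))"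
    proof (rule Liminf_mono)
      show "eventually (\<lambda>k. ereal (c2 + R k) \<le>
          ereal ((\<Sum>i=1..k. \<alpha> i * z i \<omega>) / (\<Sum>i=1..k. \<alpha> i))) sequentially"
        using eventually_gt_at_top[of 0]
      proof eventually_elim
        case (elim k)
        have pos: "0 < (\<Sum>i<k. \<alpha> (Suc i))" using step(1) elim by (intro sum_pos) auto
        have "c2 * (\<Sum>i<k. \<alpha> (Suc i)) + (\<Sum>i<k. \<alpha> (Suc i) * D i \<omega>) =
            (\<Sum>i<k. \<alpha> (Suc i) * (c2 + D i \<omega>))"
          by (simp add: sum_distrib_left sum.distrib distrib_left mult.commute)
        also have "\<dots> \<le> (\<Sum>i<k. \<alpha> (Suc i) * z (Suc i) \<omega>)"
          using step(1) \<open>\<forall>k. c2 \<le> Z k \<omega>\<close>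
          by (intro sum_mono mult_left_mono) (auto simp: D_def less_imp_le)
        finally have "(c2 * (\<Sum>i<k. \<alpha> (Suc i)) + (\<Sum>i<k. \<alpha> (Suc i) * D i \<omega>)) / (\<Sum>i<k. \<alpha> (Suc i)) \<le>
            (\<Sum>i<k. \<alpha> (Suc i) * z (Suc i) \<omega>) / (\<Sum>i<k. \<alpha> (Suc i))"
          using pos by (intro divide_right_mono) auto
        then show ?case
          using pos unfolding R_def One_nat_def sum.atLeast1_atMost_eq
          by (simp add: add_divide_distrib)
      qed
    qed
    finally show ?case .
  qed
qed

end

text \<open>\<open>E0\<close> speaks of the gradients and of \<open>z\<close> only, whereas the
  bounds on \<open>B k\<close> hold merely almost surely. The pathwise claims are therefore made for
  the paths in \<open>E0\<close> on which all these bounds hold, a set of full measure.\<close>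

theorem theorem10:
  fixes P :: "'w measure" and F :: "nat \<Rightarrow> 'w measure"
    and B :: "nat \<Rightarrow> 'w \<Rightarrow> real ^ 'd ^ 'd"
    and f :: "real ^ 'd \<Rightarrow> real" and x0 :: "real ^ 'd"
    and x :: "nat \<Rightarrow> 'w \<Rightarrow> real ^ 'd"
    and \<alpha> A :: "nat \<Rightarrow> real" and \<alpha>bar M \<nu> c1 c2 :: real
    and S :: "nat \<Rightarrow> real list set set"
    and \<phi> :: "real ^ 'd \<Rightarrow> real \<Rightarrow> real" and \<eta> :: "real ^ 'd \<Rightarrow> ereal" and t0 :: "real ^ 'd \<Rightarrow> real"
    and z :: "nat \<Rightarrow> 'w \<Rightarrow> real" and E0 :: "'w set"
  assumes prob: "prob_space P"
    and filtr: "filtration (space P) F" "\<And>k. subalgebra P (F k)"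
    and B_meas: "\<And>k. B k \<in> borel_measurable (F (Suc k))"
    and B_psd: "\<And>k \<omega>. \<omega> \<in> space P \<Longrightarrow> psd (B k \<omega>)"
    and x_0: "\<And>\<omega>. \<omega> \<in> space P \<Longrightarrow> x 0 \<omega> = x0"
    and x_Suc: "\<And>k \<omega>. \<omega> \<in> space P \<Longrightarrow>
      x (Suc k) \<omega> = x k \<omega> - \<alpha> k *\<^sub>R (B k \<omega> *v gradient f (x k \<omega>))"
    and f_C1: "C1 f"
    and f_coercive: "coercive f"
    and omin: "o_minimal_structure S"
    and f_definable: "definable S f"
    and f_grad_lip: "locally_Lipschitz (gradient f)"
    and step: "\<And>k. 0 < \<alpha> k" "\<And>k. \<alpha> k \<le> \<alpha>bar" "\<alpha>bar < 2"
    and A_eq: "\<And>k. A k = (\<Sum>i<k. \<alpha> i)"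
    and step_sum: "filterlim (\<lambda>k. \<Sum>i<k. \<alpha> i) at_top sequentially"
    and smooth: "\<And>B'. B' \<in> realizations P B \<Longrightarrow> upper_one_smooth_along f B'"
    and consts_pos: "0 < M" "0 < \<nu>"
    and B_bound: "\<And>k. AE \<omega> in P. 0 \<preceq> B k \<omega> \<and> B k \<omega> \<preceq> M *\<^sub>R mat 1"
    and B_cond: "\<And>k. AE \<omega> in P.
      \<nu> *\<^sub>R mat 1 \<preceq> matrix_cond_exp P (F k) (\<lambda>\<omega>'. B k \<omega>' ** B k \<omega>') \<omega>"
    and KL: "\<And>xb. critical_point f xb \<Longrightarrow> KL_desingularization f xb (\<eta> xb) (\<phi> xb)"
    and t0: "\<And>xb. critical_point f xb \<Longrightarrow> 0 < t0 xb \<and> ereal (t0 xb) < \<eta> xb"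
    and c1_eq: "c1 = (1 - \<alpha>bar / 2) / M"
    and c2_eq: "c2 = \<nu>"
    and z_eq: "\<And>k \<omega>. z k \<omega> =
      (if gradient f (x k \<omega>) \<noteq> 0
       then (norm (x (Suc k) \<omega> - x k \<omega>))\<^sup>2 / ((\<alpha> k)\<^sup>2 * (norm (gradient f (x k \<omega>)))\<^sup>2)
       else c2)"
    and E0_eq: "E0 = {\<omega> \<in> space P.
      (\<lambda>k. (norm (gradient f (x k \<omega>)))\<^sup>2) \<longlonglongrightarrow> 0 \<and>
      liminf (\<lambda>k. ereal ((\<Sum>i=1..k. \<alpha> i * z i \<omega>) / (\<Sum>i=1..k. \<alpha> i))) \<ge> ereal c2}"
  shows "(\<forall>xb. critical_point f xb \<longrightarrow>
      integrable_near_0 (\<eta> xb) (\<lambda>t. 1 / sqrt (KL_phi (\<phi> xb) t)) \<and>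
      (\<not> local_maximizer f xb \<longrightarrow>
        \<not> integrable_near_0 (\<eta> xb) (\<lambda>t. 1 / KL_phi (\<phi> xb) t))) \<and>
    (\<exists>xs \<in> borel_measurable P.
      (AE \<omega> in P. critical_point f (xs \<omega>) \<and> f (xs \<omega>) \<le> f x0 \<and> (\<lambda>k. x k \<omega>) \<longlonglongrightarrow> xs \<omega>) \<and>
      measure P E0 = 1 \<and>
      (\<forall>\<omega>\<in>E0. (\<forall>k. 0 \<preceq> B k \<omega> \<and> B k \<omega> \<preceq> M *\<^sub>R mat 1) \<longrightarrow>
        critical_point f (xs \<omega>) \<and> (\<lambda>k. x k \<omega>) \<longlonglongrightarrow> xs \<omega> \<and>
        (integrable_near_0 (\<eta> (xs \<omega>)) (\<lambda>t. 1 / KL_phi (\<phi> (xs \<omega>)) t) \<longrightarrow>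
          (\<exists>K. \<forall>k\<ge>K. x k \<omega> = x K \<omega>)) \<and>
        (\<not> integrable_near_0 (\<eta> (xs \<omega>)) (\<lambda>t. 1 / KL_phi (\<phi> (xs \<omega>)) t) \<longrightarrow>
          KL_rate_estimates f (\<phi> (xs \<omega>)) (\<eta> (xs \<omega>)) (t0 (xs \<omega>)) c1 c2 A
            (\<lambda>k. x k \<omega>) (xs \<omega>)) \<and>
        ((local_maximizer f (xs \<omega>) \<and> (\<exists>K. \<forall>k\<ge>K. x k \<omega> = xs \<omega>)) \<or>
         (\<not> local_maximizer f (xs \<omega>) \<and>
          KL_rate_estimates f (\<phi> (xs \<omega>)) (\<eta> (xs \<omega>)) (t0 (xs \<omega>)) c1 c2 A
            (\<lambda>k. x k \<omega>) (xs \<omega>)))))"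
proof -
  interpret GRSD P F B f x0 x \<alpha> \<alpha>bar M c1 c2 z
    using prob filtr B_meas B_psd x_0 x_Suc f_C1 f_coercive f_grad_lip step step_sum smooth
      consts_pos B_bound B_cond c1_eq z_eq unfolding c2_eq[symmetric]
    by (intro GRSD.intro GRSD_axioms.intro) assumption+
  have part1: "integrable_near_0 (\<eta> xb) (\<lambda>t. 1 / sqrt (KL_phi (\<phi> xb) t))"
    "\<not> local_maximizer f xb \<Longrightarrow> \<not> integrable_near_0 (\<eta> xb) (\<lambda>t. 1 / KL_phi (\<phi> xb) t)"
    if crit: "critical_point f xb" for xb
  proof -
    obtain \<delta> where "desingularizing (\<phi> xb) (\<eta> xb)" and \<delta>: "0 < \<delta>"
      "\<And>y. ereal (norm (y - xb)) < \<delta> \<Longrightarrow> 0 < f y - f xb \<Longrightarrow> ereal (f y - f xb) < \<eta> xb \<Longrightarrow>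
        1 \<le> deriv (\<phi> xb) (f y - f xb) * norm (gradient f y)"
      using KL[OF crit] unfolding KL_desingularization_iff by auto
    then interpret desingularizing "\<phi> xb" "\<eta> xb" by simp
    show "integrable_near_0 (\<eta> xb) (\<lambda>t. 1 / sqrt (KL_phi (\<phi> xb) t))"
      by (rule integrable_near_0_inverse_sqrt_KL_phi)
    show "\<not> integrable_near_0 (\<eta> xb) (\<lambda>t. 1 / KL_phi (\<phi> xb) t)" if "\<not> local_maximizer f xb"
      using f_C1 f_grad_lip crit that \<delta> by (rule not_integrable_of_not_local_maximizer)
  qed
  \<comment> \<open>\<open>lim\<close> has a value on every path, so \<open>xs\<close> is total; it
    is measurable whether or not individual paths converge.\<close>
  define xs where "xs \<omega> = lim (\<lambda>k. x k \<omega>)" for \<omega>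
  have xs_meas: "xs \<in> borel_measurable P" unfolding xs_def by measurable
  have KL_path: "KL_GRSD_path f (\<lambda>k. B k \<omega>) (\<lambda>k. x k \<omega>) \<alpha> (\<lambda>k. z k \<omega>) \<alpha>bar M c1 c2 \<phi> \<eta> t0"
    if "\<omega> \<in> E0" "good \<omega>" for \<omega>
    using path[OF that(2)] that(1) step_sum KL t0 unfolding E0_eq
    by (intro KL_GRSD_path.intro KL_GRSD_path_axioms.intro) auto
  have E0_sets: "E0 \<in> sets P"
    unfolding E0_eq by measurable
  have AE_E0: "AE \<omega> in P. \<omega> \<in> E0"
    using AE_gradient_tendsto_0 AE_density AE_space
    by eventually_elim (simp add: E0_eq)
  have limit: "critical_point f (xs \<omega>) \<and> (\<lambda>k. x k \<omega>) \<longlonglongrightarrow> xs \<omega>" "f (xs \<omega>) \<le> f x0"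
    if \<omega>: "\<omega> \<in> E0" "good \<omega>" for \<omega>
  proof -
    interpret p: KL_GRSD_path f "\<lambda>k. B k \<omega>" "\<lambda>k. x k \<omega>" \<alpha> "\<lambda>k. z k \<omega>" \<alpha>bar M c1 c2 \<phi> \<eta> t0
      using \<omega> by (rule KL_path)
    have xs: "p.xs = xs \<omega>" by (simp add: p.xs_def xs_def)
    show "critical_point f (xs \<omega>) \<and> (\<lambda>k. x k \<omega>) \<longlonglongrightarrow> xs \<omega>"
      using p.critical_xs p.x_lim by (simp add: xs)
    show "f (xs \<omega>) \<le> f x0"
      using p.f_xs p.finf_le[of 0] x_0[of \<omega>] \<omega>(2) by (simp add: xs good_def)
  qed
  have rates: "(integrable_near_0 (\<eta> (xs \<omega>)) (\<lambda>t. 1 / KL_phi (\<phi> (xs \<omega>)) t) \<longrightarrow>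
        (\<exists>K. \<forall>k\<ge>K. x k \<omega> = x K \<omega>)) \<and>
      (\<not> integrable_near_0 (\<eta> (xs \<omega>)) (\<lambda>t. 1 / KL_phi (\<phi> (xs \<omega>)) t) \<longrightarrow>
        KL_rate_estimates f (\<phi> (xs \<omega>)) (\<eta> (xs \<omega>)) (t0 (xs \<omega>)) c1 c2 A (\<lambda>k. x k \<omega>) (xs \<omega>)) \<and>
      ((local_maximizer f (xs \<omega>) \<and> (\<exists>K. \<forall>k\<ge>K. x k \<omega> = xs \<omega>)) \<or>
       (\<not> local_maximizer f (xs \<omega>) \<and>
        KL_rate_estimates f (\<phi> (xs \<omega>)) (\<eta> (xs \<omega>)) (t0 (xs \<omega>)) c1 c2 A (\<lambda>k. x k \<omega>) (xs \<omega>)))"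
    if \<omega>: "\<omega> \<in> E0" "good \<omega>" for \<omega>
  proof -
    interpret p: KL_GRSD_path f "\<lambda>k. B k \<omega>" "\<lambda>k. x k \<omega>" \<alpha> "\<lambda>k. z k \<omega>" \<alpha>bar M c1 c2 \<phi> \<eta> t0
      using \<omega> by (rule KL_path)
    have xs: "p.xs = xs \<omega>" by (simp add: p.xs_def xs_def)
    have "\<exists>K. \<forall>k\<ge>K. x k \<omega> = x K \<omega>"
      if "integrable_near_0 (\<eta> (xs \<omega>)) (\<lambda>t. 1 / KL_phi (\<phi> (xs \<omega>)) t)"
      using p.terminates_of_integrable that unfolding xs by (metis order_refl)
    moreover have "KL_rate_estimates f (\<phi> (xs \<omega>)) (\<eta> (xs \<omega>)) (t0 (xs \<omega>)) c1 c2 A (\<lambda>k. x k \<omega>) (xs \<omega>)"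
      if "\<not> integrable_near_0 (\<eta> (xs \<omega>)) (\<lambda>t. 1 / KL_phi (\<phi> (xs \<omega>)) t)"
      using p.rate_estimates[OF _ A_eq] that unfolding xs by blast
    moreover have "\<exists>K. \<forall>k\<ge>K. x k \<omega> = xs \<omega>" if "local_maximizer f (xs \<omega>)"
      using p.terminates_at_local_maximizer that unfolding xs by blast
    moreover have "critical_point f (xs \<omega>)" using limit(1)[OF \<omega>] by blast
    \<comment> \<open>At a limit that is not a local maximizer the first part excludes
      integrability, so the rates apply; at a local maximizer termination was obtained
      directly.\<close>
    ultimately show ?thesis using part1(2)[of "xs \<omega>"] by blast
  qed
  show ?thesis
  proof (intro conjI allI impI bexI[of _ xs] xs_meas)
    fix xb assume "critical_point f xb"
    then show "integrable_near_0 (\<eta> xb) (\<lambda>t. 1 / sqrt (KL_phi (\<phi> xb) t))" by (rule part1)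
  next
    fix xb assume "critical_point f xb" "\<not> local_maximizer f xb"
    then show "\<not> integrable_near_0 (\<eta> xb) (\<lambda>t. 1 / KL_phi (\<phi> xb) t)" by (rule part1)
  next
    show "AE \<omega> in P. critical_point f (xs \<omega>) \<and> f (xs \<omega>) \<le> f x0 \<and> (\<lambda>k. x k \<omega>) \<longlonglongrightarrow> xs \<omega>"
      using AE_E0 AE_good by eventually_elim (use limit in blast)
    show "measure P E0 = 1" using prob_eq_1[OF E0_sets] AE_E0 by simp
    show "\<forall>\<omega>\<in>E0. (\<forall>k. 0 \<preceq> B k \<omega> \<and> B k \<omega> \<preceq> M *\<^sub>R mat 1) \<longrightarrow>
        critical_point f (xs \<omega>) \<and> (\<lambda>k. x k \<omega>) \<longlonglongrightarrow> xs \<omega> \<and>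
        (integrable_near_0 (\<eta> (xs \<omega>)) (\<lambda>t. 1 / KL_phi (\<phi> (xs \<omega>)) t) \<longrightarrow>
          (\<exists>K. \<forall>k\<ge>K. x k \<omega> = x K \<omega>)) \<and>
        (\<not> integrable_near_0 (\<eta> (xs \<omega>)) (\<lambda>t. 1 / KL_phi (\<phi> (xs \<omega>)) t) \<longrightarrow>
          KL_rate_estimates f (\<phi> (xs \<omega>)) (\<eta> (xs \<omega>)) (t0 (xs \<omega>)) c1 c2 A
            (\<lambda>k. x k \<omega>) (xs \<omega>)) \<and>
        ((local_maximizer f (xs \<omega>) \<and> (\<exists>K. \<forall>k\<ge>K. x k \<omega> = xs \<omega>)) \<or>
         (\<not> local_maximizer f (xs \<omega>) \<and>
          KL_rate_estimates f (\<phi> (xs \<omega>)) (\<eta> (xs \<omega>)) (t0 (xs \<omega>)) c1 c2 A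
            (\<lambda>k. x k \<omega>) (xs \<omega>)))"
    proof (intro ballI impI)
      fix \<omega> assume "\<omega> \<in> E0" "\<forall>k. 0 \<preceq> B k \<omega> \<and> B k \<omega> \<preceq> M *\<^sub>R mat 1"
      then have "\<omega> \<in> E0" "good \<omega>" by (auto simp: good_def E0_eq)
      then show "critical_point f (xs \<omega>) \<and> (\<lambda>k. x k \<omega>) \<longlonglongrightarrow> xs \<omega> \<and>
        (integrable_near_0 (\<eta> (xs \<omega>)) (\<lambda>t. 1 / KL_phi (\<phi> (xs \<omega>)) t) \<longrightarrow>
          (\<exists>K. \<forall>k\<ge>K. x k \<omega> = x K \<omega>)) \<and>
        (\<not> integrable_near_0 (\<eta> (xs \<omega>)) (\<lambda>t. 1 / KL_phi (\<phi> (xs \<omega>)) t) \<longrightarrow>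
          KL_rate_estimates f (\<phi> (xs \<omega>)) (\<eta> (xs \<omega>)) (t0 (xs \<omega>)) c1 c2 A
            (\<lambda>k. x k \<omega>) (xs \<omega>)) \<and>
        ((local_maximizer f (xs \<omega>) \<and> (\<exists>K. \<forall>k\<ge>K. x k \<omega> = xs \<omega>)) \<or>
         (\<not> local_maximizer f (xs \<omega>) \<and>
          KL_rate_estimates f (\<phi> (xs \<omega>)) (\<eta> (xs \<omega>)) (t0 (xs \<omega>)) c1 c2 A
            (\<lambda>k. x k \<omega>) (xs \<omega>)))"
        using limit(1) rates by blast
    qed
  qed
qed

end
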